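(* Let $q,h\geq 1$ be integers and let $k\geq 3$ be an odd integer. Then \[M_k(q,h)\ll (\log h)^{O(1)}\left(\frac{\phi(q)}{q}h+\left(\frac{\phi(q)}{q}h\right)^{\frac{k-1}{2}}\right)q.\]
   Context: For integers $q,h,k\geq 1$, \[M_k(q,h) = \sum_{1\leq n\leq q}\left(\#\{m\in\mathbb{Z} : n\leq m < n+h,\ \gcd(m,q)=1\}-\frac{\phi(q)}{q}h\right)^k,\] where $\phi$ is Euler's totient function. The notation $f\ll g$ means $|f|\leq Cg$ for some constant $C$.
   Formalization: log h is replaced by max(1, log h), since at h = 1 a positive power of log h is 0 while M_3(3,1) = -2/9; for h ≥ 2 nothing changes up to the constant. The implied constant and the O(1) exponent may depend on k, but not on q or h. *)

theory Defs
  imports Complex_Main "HOL-Number_Theory.Totient"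
begin

definition M :: "nat \<Rightarrow> nat \<Rightarrow> nat \<Rightarrow> real" where
  "M k q h =
    (\<Sum>n = 1..q.
      (real (card {m::int. int n \<le> m \<and> m < int n + int h \<and> gcd m (int q) = 1})
        - real (totient q) / real q * real h) ^ k)"

end

theory Submission
  imports Defs "HOL-Number_Theory.Number_Theory"
begin

text \<open>
  The modulus may be taken squarefree, \<open>q = \<Prod>S\<close>. Primes exceeding a large power of \<open>h\<close> divide at most one
  element of a window, so they thin the window independently with survival probability \<open>p\<close>, and the moments after
  thinning are polynomials in the moments before it. For the remaining primes \<open>\<phi>(q)/q\<close> is at least a negative power
  of \<open>log h\<close>, and expanding in additive characters bounds the \<open>k\<close>-th moment by a weighted count of tuples \<open>b\<close> of
  nonzero residues with \<open>q | \<Sum>b\<^sub>j\<close>; the weight of \<open>b\<^sub>j\<close> is \<open>min (2^N) (q/|b\<^sub>j|)\<close> divided by the denominator of \<open>b\<^sub>j/q\<close>.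

  Record for each prime \<open>p\<close> its type, the set of \<open>j\<close> with \<open>p\<close> not dividing \<open>b\<^sub>j\<close>, and fix dyadic sizes for the
  \<open>b\<^sub>j\<close> and for the products of the primes of each type. Such a cell is counted by choosing the \<open>b\<^sub>j\<close> one after
  the other: once the types of the primes are known, the possible \<open>b\<^sub>j\<close> are well spaced. Running through the indices in some order
  and in its reverse and taking the geometric mean gives the exponent \<open>k/2\<close>. To reach \<open>(k - 1)/2\<close> for odd \<open>k\<close>
  one may at a given index choose \<open>b\<^sub>j\<close> before the types of the new primes and recover the types at the cost of a divisor
  function ("boosting"); then every index costs nothing in one of the two directions, and the odd number of inner indices
  leaves fewer than half of them bad. The divisor function is absorbed by a small power saving, found by
  a case distinction on the graph of large types once tuples with a vanishing proper subsum are treated by induction.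
\<close>

section \<open>Counting the tuples of a dyadic cell\<close>

text \<open>Let \<open>lam j\<close> and \<open>e I\<close> be the binary logarithms, up to
  rounding, of q / |b_j| (capped at \<open>N\<close>, where 2^N is about h) and of the product of
  the primes of type \<open>I\<close>. The weight of a tuple is then about 2 to the sum of
  \<open>lam j\<close> minus the sum of \<open>weight J e j\<close>. If primes of total logarithm W
  leave b_j undetermined, its values are q / 2^W apart in an interval of length about q / 2^lam j,
  so there are about 2^(W - lam j) of them, or one if that is less than one. The excess of
  \<open>lam j\<close> over W is the deficit of \<open>j\<close>, and it is the only loss: each type
  is chosen at its first index and closed at its last, so all other exponents cancel against the
  weights. What remains is to order the indices so that the deficits add up to (k div 2) N plus a
  constant. Averaging two opposite orders gives k N / 2, which for odd k is N / 2 too much. Boosting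
  removes it but costs the divisor function of an integer that may be a power of h, more than any
  power of log h. Hence for k >= 5 a fixed fraction of N has to be gained on top, whereas for k = 3
  the one boosted index has a single new type and costs nothing.\<close>

definition nonzero_residues :: "nat set \<Rightarrow> int set" where
  "nonzero_residues S = {b. b \<noteq> 0 \<and> 2 * \<bar>b\<bar> \<le> int (\<Prod>S)}"

text \<open>The frequency tuples that survive summation over \<open>n\<close> when a power of the
  Fourier expansion is multiplied out. The indices form an arbitrary finite set so that subsums can
  be treated by induction.\<close>

definition zero_sums :: "nat set \<Rightarrow> nat set \<Rightarrow> (nat \<Rightarrow> int) set" where
  "zero_sums S J = {b \<in> J \<rightarrow>\<^sub>E nonzero_residues S. int (\<Prod>S) dvd (\<Sum>j\<in>J. b j)}"

definition ptype :: "nat set \<Rightarrow> (nat \<Rightarrow> int) \<Rightarrow> nat \<Rightarrow> nat set" where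
  "ptype J b p = {j \<in> J. \<not> int p dvd b j}"

definition ptype_prod :: "nat set \<Rightarrow> nat set \<Rightarrow> (nat \<Rightarrow> int) \<Rightarrow> nat set \<Rightarrow> nat" where
  "ptype_prod S J b I = \<Prod>{p \<in> S. ptype J b p = I}"

text \<open>In a tuple with vanishing sum no prime has a type with exactly one element.\<close>

definition types :: "nat set \<Rightarrow> nat set set" where
  "types J = {I. I \<subseteq> J \<and> 2 \<le> card I}"

definition dyadic :: "nat set \<Rightarrow> nat \<Rightarrow> nat set set" where
  "dyadic S e = {Y. Y \<subseteq> S \<and> 2 ^ e \<le> \<Prod>Y \<and> \<Prod>Y < 2 ^ (e + 1)}"

text \<open>The number of sets in \<open>dyadic S e\<close> is at most \<open>2 ^ (e + 1)\<close>
  times this. The normalised form can be summed over all \<open>e\<close>, with total at most the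
  product of 1 + 1/p.\<close>

definition dyadic_mass :: "nat set \<Rightarrow> nat \<Rightarrow> real" where
  "dyadic_mass S e = (\<Sum>Y\<in>dyadic S e. 1 / real (\<Prod>Y))"

text \<open>The second summand serves the indices where the types are chosen last; the exponents there are at most \<open>N\<close>.\<close>

definition cell_mass :: "nat \<Rightarrow> nat set \<Rightarrow> nat \<Rightarrow> real" where
  "cell_mass N S e = dyadic_mass S e + (if e \<le> N then 1 else 0)"

section \<open>Counting by fibres and by spacing\<close>

lemma card_image_le_card_image_mult:
  fixes w c :: real
  assumes "finite F" "\<And>a. a \<in> F \<Longrightarrow> real (card (g ` {x \<in> F. f x = f a})) * w \<le> c" "0 \<le> w"
  shows "real (card (g ` F)) * w \<le> real (card (f ` F)) * c"
proof -
  have "g ` F = (\<Union>y\<in>f ` F. g ` {x \<in> F. f x = y})" by auto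
  then have "card (g ` F) \<le> (\<Sum>y\<in>f ` F. card (g ` {x \<in> F. f x = y}))"
    using card_UN_le[of "f ` F" "\<lambda>y. g ` {x \<in> F. f x = y}"] assms(1) by simp
  then have "real (card (g ` F)) \<le> (\<Sum>y\<in>f ` F. real (card (g ` {x \<in> F. f x = y})))"
    by (simp only: of_nat_sum[symmetric] of_nat_le_iff)
  then have "real (card (g ` F)) * w \<le> (\<Sum>y\<in>f ` F. real (card (g ` {x \<in> F. f x = y})) * w)"
    using mult_right_mono[OF _ assms(3)] by (simp only: sum_distrib_right[symmetric])
  also have "\<dots> \<le> (\<Sum>y\<in>f ` F. c)" by (rule sum_mono) (use assms(2) in auto)
  finally show ?thesis by simp
qed

lemma card_image_le_via:
  assumes "finite B" "g ` F \<subseteq> B" "\<And>x y. x \<in> F \<Longrightarrow> y \<in> F \<Longrightarrow> g x = g y \<Longrightarrow> f x = f y"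
  shows "card (f ` F) \<le> card B"
proof -
  define h where "h = (\<lambda>z. f (SOME x. x \<in> F \<and> g x = z))"
  have "f x = h (g x)" if "x \<in> F" for x
  proof -
    have "(SOME y. y \<in> F \<and> g y = g x) \<in> F \<and> g (SOME y. y \<in> F \<and> g y = g x) = g x"
      by (rule someI[of _ x]) (use that in auto)
    then show ?thesis unfolding h_def using assms(3) that by metis
  qed
  then have "f ` F = h ` (g ` F)" by (auto simp: image_image)
  then have "card (f ` F) \<le> card (g ` F)"
    using card_image_le[OF finite_subset[OF assms(2,1)], of h] by simp
  also have "\<dots> \<le> card B" using assms card_mono by blast
  finally show ?thesis .
qed

text \<open>Rounding \<open>x * 2 ^ z / q\<close> down is injective on \<open>X\<close>, with values
  between about plus and minus 2^(z - l). With truncated subtraction \<open>z + (l - z)\<close> is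
  the maximum of \<open>z\<close> and \<open>l\<close>; when it is \<open>l\<close>, the bound
  merely allows boundedly many values.\<close>

lemma card_spaced_le:
  fixes X :: "int set" and q l z :: nat
  assumes q: "q > 0"
    and bd: "\<And>x. x \<in> X \<Longrightarrow> \<bar>x\<bar> * 2 ^ l \<le> int q"
    and sp: "\<And>x y. x \<in> X \<Longrightarrow> y \<in> X \<Longrightarrow> x \<noteq> y \<Longrightarrow> int q \<le> \<bar>x - y\<bar> * 2 ^ z"
  shows "real (card X) * 2 ^ l \<le> 4 * 2 ^ (z + (l - z))"
proof -
  define f where "f = (\<lambda>x::int. \<lfloor>real_of_int x * 2 ^ z / real q\<rfloor>)"
  define R :: real where "R = 2 ^ z / 2 ^ l"
  have R0: "R \<ge> 0" by (simp add: R_def)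
  have inj: "inj_on f X"
  proof (rule inj_onI, rule ccontr)
    fix x y assume xy: "x \<in> X" "y \<in> X" "f x = f y" "x \<noteq> y"
    have "real_of_int (int q) \<le> real_of_int (\<bar>x - y\<bar> * 2 ^ z)" using sp[OF xy(1,2,4)] by linarith
    then have "real q \<le> \<bar>real_of_int x - real_of_int y\<bar> * 2 ^ z" by simp
    then have "1 \<le> \<bar>real_of_int x - real_of_int y\<bar> * 2 ^ z / real q" using q by (simp add: field_simps)
    also have "\<dots> = \<bar>real_of_int x * 2 ^ z / real q - real_of_int y * 2 ^ z / real q\<bar>"
      using q by (simp add: diff_divide_distrib[symmetric] left_diff_distrib[symmetric] abs_mult)
    finally show False using xy(3) unfolding f_def by linarith
  qed
  have im: "f ` X \<subseteq> {\<lfloor>-R\<rfloor>..\<lfloor>R\<rfloor>}"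
  proof
    fix y assume "y \<in> f ` X"
    then obtain x where x: "x \<in> X" "y = f x" by auto
    have "real_of_int (\<bar>x\<bar> * 2 ^ l) \<le> real_of_int (int q)" using bd[OF x(1)] by linarith
    then have "\<bar>real_of_int x\<bar> * 2 ^ l \<le> real q" by simp
    then have "\<bar>real_of_int x\<bar> / real q \<le> 1 / 2 ^ l" using q by (simp add: field_simps)
    then have "\<bar>real_of_int x\<bar> / real q * 2 ^ z \<le> 1 / 2 ^ l * 2 ^ z" by (rule mult_right_mono) auto
    then have "\<bar>real_of_int x * 2 ^ z / real q\<bar> \<le> R"
      by (simp add: R_def abs_mult)
    then have "- R \<le> real_of_int x * 2 ^ z / real q" "real_of_int x * 2 ^ z / real q \<le> R"
      by (metis abs_le_D2 minus_le_iff, metis abs_le_D1)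
    then show "y \<in> {\<lfloor>-R\<rfloor>..\<lfloor>R\<rfloor>}" unfolding x(2) f_def by (auto intro: floor_mono)
  qed
  have "card X = card (f ` X)" using inj by (simp add: card_image)
  also have "\<dots> \<le> card {\<lfloor>-R\<rfloor>..\<lfloor>R\<rfloor>}" by (rule card_mono[OF _ im]) simp
  finally have "card X \<le> nat (\<lfloor>R\<rfloor> + 1 - \<lfloor>-R\<rfloor>)" by simp
  then have "real (card X) \<le> 2 * R + 2" using R0 by linarith
  then have "real (card X) * 2 ^ l \<le> (2 * R + 2) * 2 ^ l" by (rule mult_right_mono) simp
  also have "\<dots> = 2 * 2 ^ z + 2 * 2 ^ l" by (simp add: R_def field_simps)
  also have "\<dots> \<le> 2 * 2 ^ (z + (l - z)) + 2 * 2 ^ (z + (l - z))"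
    by (intro add_mono mult_left_mono power_increasing) auto
  finally show ?thesis by simp
qed

lemma prod_primes_dvd:
  fixes V :: "nat set" and x :: int
  assumes "finite V" "\<forall>p\<in>V. prime p" "\<And>p. p \<in> V \<Longrightarrow> int p dvd x"
  shows "int (\<Prod>V) dvd x"
  using assms
proof (induction V rule: finite_induct)
  case (insert p V)
  have "coprime p (\<Prod>V)"
  proof (rule prod_coprime_right)
    fix r assume r: "r \<in> V"
    then have "p \<noteq> r" "prime p" "prime r" using insert by auto
    then show "coprime p r" using primes_coprime by blast
  qed
  then have "coprime (int p) (int (\<Prod>V))" by (simp del: of_nat_prod add: coprime_int_iff)
  then have "int p * int (\<Prod>V) dvd x" using insert.prems insert.IH by (intro divides_mult) (simp_all del: of_nat_prod)
  then show ?case using insert(1,2) by simp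
qed auto

text \<open>A nonzero integer is at least as large as its divisor, the product of the primes outside
  \<open>V\<close>. Applied below to differences of two values, to a single \<open>b j\<close> and
  to subsums.\<close>

lemma spacing_of_dvd:
  fixes S V :: "nat set" and x :: int
  assumes "finite S" "\<forall>p\<in>S. prime p" "V \<subseteq> S" "x \<noteq> 0"
    and "\<And>p. p \<in> S - V \<Longrightarrow> int p dvd x" "\<Prod>V \<le> 2 ^ z"
  shows "int (\<Prod>S) \<le> \<bar>x\<bar> * 2 ^ z"
proof -
  have "int (\<Prod>(S - V)) dvd x" by (rule prod_primes_dvd) (use assms in auto)
  then have 1: "int (\<Prod>(S - V)) \<le> \<bar>x\<bar>" using dvd_imp_le_int[OF assms(4)] by (metis abs_ge_self order_trans)
  have "\<Prod>S = \<Prod>(S - V) * \<Prod>V" using prod.subset_diff[OF assms(3,1)] .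
  then have "int (\<Prod>S) = int (\<Prod>(S - V)) * int (\<Prod>V)" by (simp only: of_nat_mult)
  also have "\<dots> \<le> \<bar>x\<bar> * 2 ^ z"
  proof (rule mult_mono[OF 1])
    have "int (\<Prod>V) \<le> int (2 ^ z)" using assms(6) by linarith
    then show "int (\<Prod>V) \<le> 2 ^ z" by simp
  qed (auto simp del: of_nat_prod)
  finally show ?thesis .
qed

lemma dyadic_card_le:
  assumes "finite S"
  shows "real (card (dyadic S e)) \<le> 2 ^ (e + 1) * dyadic_mass S e"
proof -
  have "real (card (dyadic S e)) = (\<Sum>Y\<in>dyadic S e. 1)" by simp
  also have "\<dots> \<le> (\<Sum>Y\<in>dyadic S e. 2 ^ (e + 1) * (1 / real (\<Prod>Y)))"
  proof (rule sum_mono)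
    fix Y assume Y: "Y \<in> dyadic S e"
    have "2 ^ e \<le> \<Prod>Y" "\<Prod>Y \<le> 2 ^ (e + 1)" using Y unfolding dyadic_def by simp_all
    moreover have "0 < (2::nat) ^ e" by simp
    ultimately have "0 < \<Prod>Y" "real (\<Prod>Y) \<le> real (2 ^ (e + 1))"
      by (linarith, simp only: of_nat_le_iff)
    then show "1 \<le> 2 ^ (e + 1) * (1 / real (\<Prod>Y))" by (simp add: field_simps del: of_nat_prod)
  qed
  finally show ?thesis by (simp add: dyadic_mass_def sum_distrib_left)
qed

lemma dyadic_mass_nonneg: "0 \<le> dyadic_mass S e"
  unfolding dyadic_mass_def by (intro sum_nonneg) (simp del: of_nat_prod)

lemma finite_types: "finite J \<Longrightarrow> finite (types J)"
  unfolding types_def by (rule finite_subset[of _ "Pow J"]) auto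

lemma card_types_le: "finite J \<Longrightarrow> card (types J) \<le> 2 ^ card J"
  unfolding types_def using card_mono[of "Pow J" "{I. I \<subseteq> J \<and> 2 \<le> card I}"]
  by (auto simp: card_Pow)

lemma finite_dyadic: "finite S \<Longrightarrow> finite (dyadic S e)"
  unfolding dyadic_def by (rule finite_subset[of _ "Pow S"]) auto

text \<open>\<open>p\<close> divides the full sum, so it cannot divide all summands but one.\<close>

lemma ptype_cases:
  assumes "finite S" "finite J" "b \<in> zero_sums S J" "p \<in> S"
  shows "ptype J b p = {} \<or> ptype J b p \<in> types J"
proof (rule ccontr)
  assume a: "\<not> ?thesis"
  have sub: "ptype J b p \<subseteq> J" by (auto simp: ptype_def)
  have fin: "finite (ptype J b p)" using sub assms(2) finite_subset by blast
  have "card (ptype J b p) \<noteq> 0" "\<not> 2 \<le> card (ptype J b p)" using a sub fin by (simp_all add: types_def)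
  then have "card (ptype J b p) = 1" by linarith
  then obtain j where j: "ptype J b p = {j}" using card_1_singletonE by blast
  have jJ: "j \<in> J" and ndv: "\<not> int p dvd b j" and o: "\<And>i. i \<in> J - {j} \<Longrightarrow> int p dvd b i"
    using j unfolding ptype_def by auto
  have "int p dvd int (\<Prod>S)" using dvd_prodI[OF assms(1,4), of "\<lambda>x. x"] by (simp only: of_nat_dvd_iff)
  then have "int p dvd (\<Sum>j\<in>J. b j)" using assms(3) dvd_trans unfolding zero_sums_def by blast
  moreover have "(\<Sum>j\<in>J. b j) = b j + (\<Sum>i\<in>J - {j}. b i)" using assms(2) jJ by (simp add: sum.remove)
  moreover have "int p dvd (\<Sum>i\<in>J - {j}. b i)" using o by (rule dvd_sum)
  ultimately show False using ndv by (simp add: dvd_add_left_iff)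
qed

text \<open>
  With \<open>pre\<close> the set of indices treated before \<open>j\<close>: the primes of new type are met at \<open>j\<close> for the first time, and the
  open types are those whose primes do not determine \<open>b\<^sub>j\<close> modulo \<open>p\<close> from the past.
\<close>

definition new_types :: "nat set \<Rightarrow> nat set \<Rightarrow> nat \<Rightarrow> nat set set" where
  "new_types J pre j = {I \<in> types J. j \<in> I \<and> I \<inter> pre = {}}"

definition open_types :: "nat set \<Rightarrow> nat set \<Rightarrow> nat \<Rightarrow> nat set set" where
  "open_types J pre j = {I \<in> types J. j \<in> I \<and> \<not> I \<subseteq> insert j pre}"

text \<open>The whole type of a prime, later indices included, counts as known from its first index
  on. The empty set marks primes not met so far; a type that meets \<open>pre\<close> is never
  empty.\<close>

definition past_types :: "nat set \<Rightarrow> nat set \<Rightarrow> (nat \<Rightarrow> int) \<Rightarrow> nat \<Rightarrow> nat set" where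
  "past_types J pre b = (\<lambda>p. if ptype J b p \<inter> pre \<noteq> {} then ptype J b p else {})"

definition past :: "nat set \<Rightarrow> nat set \<Rightarrow> nat set \<Rightarrow> (nat \<Rightarrow> int) \<Rightarrow> (nat \<Rightarrow> int) \<times> (nat \<Rightarrow> nat set)" where
  "past S J pre b = (restrict b pre, restrict (past_types J pre b) S)"

lemma past_eqD:
  assumes "past S J pre a = past S J pre b"
  shows "i \<in> pre \<Longrightarrow> a i = b i"
    and "p \<in> S \<Longrightarrow> ptype J a p \<inter> pre \<noteq> {} \<Longrightarrow> ptype J b p = ptype J a p"
proof -
  have 1: "restrict a pre = restrict b pre" and 2: "restrict (past_types J pre a) S = restrict (past_types J pre b) S"
    using assms by (simp_all add: past_def)
  show "i \<in> pre \<Longrightarrow> a i = b i" using 1 by (metis restrict_apply')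
  assume p: "p \<in> S" and ne: "ptype J a p \<inter> pre \<noteq> {}"
  have "past_types J pre a p = past_types J pre b p" using 2 p by (metis restrict_apply')
  then show "ptype J b p = ptype J a p" using ne by (auto simp: past_types_def split: if_splits)
qed

lemma past_eqI:
  assumes "\<And>i. i \<in> pre \<Longrightarrow> a i = b i"
    and "\<And>p. p \<in> S \<Longrightarrow> past_types J pre a p = past_types J pre b p"
  shows "past S J pre a = past S J pre b"
  using assms unfolding past_def by (auto simp: restrict_def fun_eq_iff)

lemma finite_nonzero_residues: "finite (nonzero_residues S)"
  by (rule finite_subset[of _ "{- int (\<Prod>S)..int (\<Prod>S)}"])
    (auto simp: nonzero_residues_def simp del: of_nat_prod)

lemma finite_zero_sums: "finite J \<Longrightarrow> finite (zero_sums S J)"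
  unfolding zero_sums_def
  by (rule finite_subset[of _ "J \<rightarrow>\<^sub>E nonzero_residues S"]) (auto intro: finite_PiE finite_nonzero_residues)

section \<open>One dyadic cell: congruences and spacing for a single coordinate\<close>

locale dyadic_cell =
  fixes S J :: "nat set" and A :: "(nat \<Rightarrow> int) set" and e :: "nat set \<Rightarrow> nat" and lam :: "nat \<Rightarrow> nat"
  assumes fin: "finite S" "finite J" and primes: "\<forall>p\<in>S. prime p"
    and A: "A \<subseteq> zero_sums S J"
    and e: "\<And>b I. b \<in> A \<Longrightarrow> I \<in> types J \<Longrightarrow> 2 ^ e I \<le> ptype_prod S J b I \<and> ptype_prod S J b I < 2 ^ (e I + 1)"
    and lam: "\<And>b j. b \<in> A \<Longrightarrow> j \<in> J \<Longrightarrow> \<bar>b j\<bar> * 2 ^ lam j \<le> int (\<Prod>S)"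
begin

abbreviation "K \<equiv> 2 ^ card J :: nat"

lemma q_pos: "0 < \<Prod>S"
  using primes fin by (intro prod_pos) (auto intro: prime_gt_0_nat)

lemma finite_A: "finite A"
  using A finite_zero_sums[OF fin(2)] finite_subset by blast

lemma ptype_cases: "b \<in> A \<Longrightarrow> p \<in> S \<Longrightarrow> ptype J b p = {} \<or> ptype J b p \<in> types J"
  using ptype_cases[OF fin] A by blast

lemma prod_family_eq:
  assumes "F \<subseteq> types J"
  shows "\<Prod>{p \<in> S. ptype J b p \<in> F} = (\<Prod>I\<in>F. ptype_prod S J b I)"
proof -
  have fF: "finite F" using assms finite_types[OF fin(2)] finite_subset by blast
  have "(\<Prod>I\<in>F. \<Prod>{p \<in> {p \<in> S. ptype J b p \<in> F}. ptype J b p = I}) = \<Prod>{p \<in> S. ptype J b p \<in> F}"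
    by (rule prod.group) (use fin fF in auto)
  moreover have "{p \<in> {p \<in> S. ptype J b p \<in> F}. ptype J b p = I} = {p \<in> S. ptype J b p = I}" if "I \<in> F" for I
    using that by auto
  ultimately show ?thesis unfolding ptype_prod_def by (metis (no_types, lifting) prod.cong)
qed

text \<open>Each type contributes at most a factor two beyond its dyadic exponent, and there are at
  most \<open>K\<close> types.\<close>

lemma prod_family_le:
  assumes "b \<in> A" "F \<subseteq> types J"
  shows "\<Prod>{p \<in> S. ptype J b p \<in> F} \<le> 2 ^ ((\<Sum>I\<in>F. e I) + K)"
proof -
  have "(\<Prod>I\<in>F. ptype_prod S J b I) \<le> (\<Prod>I\<in>F. 2 ^ (e I + 1))"
  proof (rule prod_mono)
    fix I assume "I \<in> F"
    then have "I \<in> types J" using assms(2) by blast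
    from e[OF assms(1) this] show "0 \<le> ptype_prod S J b I \<and> ptype_prod S J b I \<le> 2 ^ (e I + 1)" by simp
  qed
  also have "\<dots> = 2 ^ (\<Sum>I\<in>F. e I + 1)" by (rule power_sum[symmetric])
  also have "\<dots> = 2 ^ ((\<Sum>I\<in>F. e I) + card F)" by (simp only: sum.distrib sum_constant mult_1_right of_nat_id)
  also have "\<dots> \<le> 2 ^ ((\<Sum>I\<in>F. e I) + K)"
  proof -
    have "card F \<le> card (types J)" using assms(2) finite_types[OF fin(2)] card_mono by blast
    then show ?thesis using card_types_le[OF fin(2)] by (intro power_increasing) auto
  qed
  finally show ?thesis using prod_family_eq[OF assms(2)] by simp
qed

lemma prod_family_ge:
  assumes "b \<in> A" "F \<subseteq> types J"
  shows "2 ^ (\<Sum>I\<in>F. e I) \<le> \<Prod>{p \<in> S. ptype J b p \<in> F}"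
proof -
  have "(\<Prod>I\<in>F. 2 ^ (e I)) \<le> (\<Prod>I\<in>F. ptype_prod S J b I)"
  proof (rule prod_mono)
    fix I assume "I \<in> F"
    then have "I \<in> types J" using assms(2) by blast
    from e[OF assms(1) this] show "0 \<le> (2::nat) ^ e I \<and> 2 ^ e I \<le> ptype_prod S J b I" by simp
  qed
  then show ?thesis using prod_family_eq[OF assms(2)] by (simp add: power_sum)
qed

text \<open>Outside \<open>X\<close> all summands are multiples of \<open>p\<close>, so modulo
  \<open>p\<close> the partial sum is the total, which vanishes. This is why the last index of a
  type is determined by the earlier ones.\<close>

lemma dvd_partial_sum:
  assumes "b \<in> A" "p \<in> S" "ptype J b p \<subseteq> X" "X \<subseteq> J"
  shows "int p dvd (\<Sum>i\<in>X. b i)"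
proof -
  have "int p dvd int (\<Prod>S)" using dvd_prodI[OF fin(1) assms(2), of "\<lambda>x. x"] by (simp only: of_nat_dvd_iff)
  moreover have "int (\<Prod>S) dvd (\<Sum>j\<in>J. b j)" using A assms(1) unfolding zero_sums_def by blast
  ultimately have "int p dvd (\<Sum>j\<in>J. b j)" using dvd_trans by blast
  moreover have "(\<Sum>j\<in>J. b j) = (\<Sum>i\<in>X. b i) + (\<Sum>i\<in>J - X. b i)"
    using sum.subset_diff[OF assms(4) fin(2), of b] by simp
  moreover have "int p dvd (\<Sum>i\<in>J - X. b i)" by (rule dvd_sum) (use assms(3) in \<open>auto simp: ptype_def\<close>)
  ultimately show ?thesis by (simp add: dvd_add_left_iff)
qed

text \<open>Modulo a prime that is neither open nor of disputed new type, \<open>b j\<close> is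
  either 0 or minus the sum of the earlier values, and the common past together with the agreement
  on new types decides which.\<close>

lemma dvd_diff_of_past:
  assumes "a \<in> A" "b \<in> A" "past S J pre a = past S J pre b" "pre \<subseteq> J" "j \<in> J" "j \<notin> pre" "p \<in> S"
    and "ptype J a p \<notin> open_types J pre j" "ptype J a p \<in> new_types J pre j \<Longrightarrow> ptype J b p = ptype J a p"
    and "ptype J b p \<notin> open_types J pre j" "ptype J b p \<in> new_types J pre j \<Longrightarrow> ptype J b p = ptype J a p"
  shows "int p dvd a j - b j"
proof (cases "j \<in> ptype J a p \<or> j \<in> ptype J b p")
  case False
  then have "int p dvd a j" "int p dvd b j" using assms(5) by (auto simp: ptype_def)
  then show ?thesis by (rule dvd_diff)
next
  case True
  have eq: "ptype J a p = ptype J b p"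
  proof (cases "j \<in> ptype J a p")
    case True
    then have "ptype J a p \<in> types J" using ptype_cases[OF assms(1,7)] by auto
    then have "ptype J a p \<in> new_types J pre j \<or> ptype J a p \<inter> pre \<noteq> {}" using True by (auto simp: new_types_def)
    then show ?thesis using assms(9) past_eqD(2)[OF assms(3) assms(7)] by auto
  next
    case False
    with True have j: "j \<in> ptype J b p" by simp
    then have "ptype J b p \<in> types J" using ptype_cases[OF assms(2,7)] by auto
    then have "ptype J b p \<in> new_types J pre j \<or> ptype J b p \<inter> pre \<noteq> {}" using j by (auto simp: new_types_def)
    then show ?thesis using assms(11) past_eqD(2)[OF assms(3)[symmetric] assms(7)] by auto
  qed
  with True have j: "j \<in> ptype J a p" by simp
  then have "ptype J a p \<in> types J" using ptype_cases[OF assms(1,7)] by auto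
  then have sub: "ptype J a p \<subseteq> insert j pre" using assms(8) j by (auto simp: open_types_def)
  have "int p dvd (\<Sum>i\<in>insert j pre. a i)" by (rule dvd_partial_sum) (use assms sub in auto)
  moreover have "int p dvd (\<Sum>i\<in>insert j pre. b i)" by (rule dvd_partial_sum) (use assms sub eq in auto)
  ultimately have "int p dvd (\<Sum>i\<in>insert j pre. a i) - (\<Sum>i\<in>insert j pre. b i)" by (rule dvd_diff)
  moreover have "finite pre" using assms(4) fin(2) finite_subset by blast
  moreover have "sum a pre = sum b pre" using past_eqD(1)[OF assms(3)] by (rule sum.cong[OF refl])
  ultimately show ?thesis using assms(6) by simp
qed

text \<open>The exceptional primes \<open>V\<close> may depend on the pair \<open>a\<close>,
  \<open>b\<close>; the spacing only sees the common bound for their product.\<close>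

lemma card_values_le:
  assumes F: "F \<subseteq> A" and pre: "pre \<subseteq> J" "j \<in> J" "j \<notin> pre"
    and past: "\<And>a b. a \<in> F \<Longrightarrow> b \<in> F \<Longrightarrow> past S J pre a = past S J pre b"
    and z: "\<And>a b. a \<in> F \<Longrightarrow> b \<in> F \<Longrightarrow> \<exists>V\<subseteq>S. \<Prod>V \<le> 2 ^ z \<and>
      (\<forall>p\<in>S - V. ptype J a p \<notin> open_types J pre j \<and> ptype J b p \<notin> open_types J pre j \<and>
        (ptype J a p \<in> new_types J pre j \<or> ptype J b p \<in> new_types J pre j \<longrightarrow> ptype J b p = ptype J a p))"
  shows "real (card ((\<lambda>b. b j) ` F)) * 2 ^ lam j \<le> 4 * 2 ^ (z + (lam j - z))"
proof (rule card_spaced_le[OF q_pos])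
  fix x assume "x \<in> (\<lambda>b. b j) ` F"
  then show "\<bar>x\<bar> * 2 ^ lam j \<le> int (\<Prod>S)" using lam F pre by blast
next
  fix x y assume "x \<in> (\<lambda>b. b j) ` F" "y \<in> (\<lambda>b. b j) ` F" and ne: "x \<noteq> y"
  then obtain a b where ab: "a \<in> F" "b \<in> F" "x = a j" "y = b j" by auto
  from z[OF ab(1,2)] obtain V where V: "V \<subseteq> S" "\<Prod>V \<le> 2 ^ z"
    "\<And>p. p \<in> S - V \<Longrightarrow> ptype J a p \<notin> open_types J pre j \<and> ptype J b p \<notin> open_types J pre j \<and>
        (ptype J a p \<in> new_types J pre j \<or> ptype J b p \<in> new_types J pre j \<longrightarrow> ptype J b p = ptype J a p)"
    by blast
  have "int p dvd x - y" if "p \<in> S - V" for p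
    unfolding ab by (rule dvd_diff_of_past[OF _ _ past[OF ab(1,2)] pre]) (use that V(3)[OF that] ab F in auto)
  then show "int (\<Prod>S) \<le> \<bar>x - y\<bar> * 2 ^ z" by (intro spacing_of_dvd[OF fin(1) primes V(1) _ _ V(2)]) (use ne in auto)
qed

end

context dyadic_cell begin

lemma new_subset_open: "j \<notin> pre \<Longrightarrow> new_types J pre j \<subseteq> open_types J pre j"
proof
  fix I assume I: "I \<in> new_types J pre j"
  have "\<not> I \<subseteq> insert j pre"
  proof
    assume "I \<subseteq> insert j pre"
    then have "I \<subseteq> {j}" using I by (auto simp: new_types_def)
    then have "card I \<le> card {j}" by (intro card_mono) auto
    then show False using I by (simp add: new_types_def types_def)
  qed
  then show "I \<in> open_types J pre j" using I by (simp add: new_types_def open_types_def)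
qed

lemma past_types_insert_eq:
  assumes "a \<in> A" "b \<in> A" "past S J pre a = past S J pre b" "p \<in> S"
    and "ptype J a p \<in> new_types J pre j \<Longrightarrow> ptype J b p = ptype J a p"
    and "ptype J b p \<in> new_types J pre j \<Longrightarrow> ptype J b p = ptype J a p"
  shows "past_types J (insert j pre) a p = past_types J (insert j pre) b p"
proof -
  have *: "ptype J b p = ptype J a p" if "ptype J a p \<inter> insert j pre \<noteq> {}"
  proof (cases "ptype J a p \<inter> pre = {}")
    case False
    then show ?thesis using past_eqD(2)[OF assms(3,4)] by simp
  next
    case True
    then have "ptype J a p \<in> new_types J pre j" using that ptype_cases[OF assms(1,4)] by (auto simp: new_types_def)
    then show ?thesis using assms(5) by simp
  qed
  have **: "ptype J b p = ptype J a p" if "ptype J b p \<inter> insert j pre \<noteq> {}"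
  proof (cases "ptype J b p \<inter> pre = {}")
    case False
    then show ?thesis using past_eqD(2)[OF assms(3)[symmetric] assms(4)] by simp
  next
    case True
    then have "ptype J b p \<in> new_types J pre j" using that ptype_cases[OF assms(2,4)] by (auto simp: new_types_def)
    then show ?thesis using assms(6) by simp
  qed
  show ?thesis
  proof (cases "ptype J b p = ptype J a p")
    case True
    then show ?thesis by (simp add: past_types_def)
  next
    case False
    then have "ptype J a p \<inter> insert j pre = {}" "ptype J b p \<inter> insert j pre = {}" using * ** by metis+
    then show ?thesis unfolding past_types_def by metis
  qed
qed

text \<open>First the sets of primes of each new type are chosen, then \<open>b\<^sub>j\<close>.\<close>

lemma fibre_plain:
  assumes a: "a \<in> A" and pre: "pre \<subseteq> J" "j \<in> J" "j \<notin> pre"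
  defines "z \<equiv> (\<Sum>I\<in>open_types J pre j. e I) + K"
  shows "real (card (past S J (insert j pre) ` {b \<in> A. past S J pre b = past S J pre a})) * 2 ^ lam j
    \<le> real (\<Prod>I\<in>new_types J pre j. card (dyadic S (e I))) * (4 * 2 ^ (z + (lam j - z)))"
proof -
  define F where "F = {b \<in> A. past S J pre b = past S J pre a}"
  define \<tau> where "\<tau> = (\<lambda>b. restrict (past_types J (insert j pre) b) S)"
  have finF: "finite F" using finite_A by (auto simp: F_def)
  have fnew: "finite (new_types J pre j)" using finite_types[OF fin(2)] by (auto simp: new_types_def)
  have Feq: "past S J pre x = past S J pre y" "x \<in> A" "y \<in> A" if "x \<in> F" "y \<in> F" for x y
    using that by (auto simp: F_def)
  have "real (card (past S J (insert j pre) ` F)) * 2 ^ lam j \<le> real (card (\<tau> ` F)) * (4 * 2 ^ (z + (lam j - z)))"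
  proof (rule card_image_le_card_image_mult[OF finF])
    fix b0 assume "b0 \<in> F"
    define F1 where "F1 = {b \<in> F. \<tau> b = \<tau> b0}"
    have F1: "F1 \<subseteq> F" "\<And>x y p. x \<in> F1 \<Longrightarrow> y \<in> F1 \<Longrightarrow> \<tau> x = \<tau> y" by (auto simp: F1_def)
    have ty: "past_types J (insert j pre) x p = past_types J (insert j pre) y p" if "x \<in> F1" "y \<in> F1" "p \<in> S" for x y p
      using F1(2)[OF that(1,2)] that(3) unfolding \<tau>_def by (metis restrict_apply')
    have ty': "ptype J y p = ptype J x p" if "x \<in> F1" "y \<in> F1" "p \<in> S" "j \<in> ptype J x p" for x y p
      using ty[OF that(1-3)] that(4) by (auto simp: past_types_def split: if_splits)
    have "card (past S J (insert j pre) ` F1) \<le> card ((\<lambda>b. b j) ` F1)"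
    proof (rule card_image_le_via[of _ "\<lambda>b. b j"])
      fix x y assume xy: "x \<in> F1" "y \<in> F1" "x j = y j"
      show "past S J (insert j pre) x = past S J (insert j pre) y"
      proof (rule past_eqI)
        fix i assume "i \<in> insert j pre"
        then show "x i = y i" using xy(3) past_eqD(1)[OF Feq(1)[of x y]] xy(1,2) F1(1) by auto
      next
        fix p assume "p \<in> S"
        then show "past_types J (insert j pre) x p = past_types J (insert j pre) y p"
          by (rule ty[OF xy(1,2)])
      qed
    qed (use finite_subset[OF F1(1) finF] in simp_all)
    then have "real (card (past S J (insert j pre) ` F1)) * 2 ^ lam j \<le> real (card ((\<lambda>b. b j) ` F1)) * 2 ^ lam j"
      by (intro mult_right_mono) auto
    also have "\<dots> \<le> 4 * 2 ^ (z + (lam j - z))"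
    proof (rule card_values_le[OF _ pre])
      show "F1 \<subseteq> A" using F1(1) by (auto simp: F_def)
      fix x y assume xy: "x \<in> F1" "y \<in> F1"
      show "past S J pre x = past S J pre y" using Feq(1)[of x y] xy F1(1) by auto
      have o: "\<Prod>{p \<in> S. ptype J x p \<in> open_types J pre j} \<le> 2 ^ z"
        unfolding z_def by (rule prod_family_le) (use Feq(2)[of x x] xy(1) F1(1) in \<open>auto simp: open_types_def\<close>)
      show "\<exists>V\<subseteq>S. \<Prod>V \<le> 2 ^ z \<and> (\<forall>p\<in>S - V. ptype J x p \<notin> open_types J pre j \<and> ptype J y p \<notin> open_types J pre j \<and>
        (ptype J x p \<in> new_types J pre j \<or> ptype J y p \<in> new_types J pre j \<longrightarrow> ptype J y p = ptype J x p))"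
      proof (intro exI[of _ "{p \<in> S. ptype J x p \<in> open_types J pre j}"] conjI ballI)
        fix p assume p: "p \<in> S - {p \<in> S. ptype J x p \<in> open_types J pre j}"
        then show no: "ptype J x p \<notin> open_types J pre j" by auto
        show no': "ptype J y p \<notin> open_types J pre j"
        proof
          assume y: "ptype J y p \<in> open_types J pre j"
          then have "ptype J x p = ptype J y p" using ty'[OF xy(2,1)] p by (auto simp: open_types_def)
          with y no show False by simp
        qed
        show "ptype J x p \<in> new_types J pre j \<or> ptype J y p \<in> new_types J pre j \<longrightarrow> ptype J y p = ptype J x p"
          using new_subset_open[OF pre(3)] no no' by blast
      qed (use o in auto)
    qed
    finally show "real (card (past S J (insert j pre) ` {b \<in> F. \<tau> b = \<tau> b0})) * 2 ^ lam j \<le> 4 * 2 ^ (z + (lam j - z))"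
      unfolding F1_def .
  qed simp
  also have "\<dots> \<le> real (\<Prod>I\<in>new_types J pre j. card (dyadic S (e I))) * (4 * 2 ^ (z + (lam j - z)))"
  proof (rule mult_right_mono)
    have "card (\<tau> ` F) \<le> card (\<Pi>\<^sub>E I\<in>new_types J pre j. dyadic S (e I))"
    proof (rule card_image_le_via[of _ "\<lambda>b. restrict (\<lambda>I. {p \<in> S. ptype J b p = I}) (new_types J pre j)"])
      show "finite (\<Pi>\<^sub>E I\<in>new_types J pre j. dyadic S (e I))"
        by (intro finite_PiE fnew finite_dyadic fin)
      show "(\<lambda>b. restrict (\<lambda>I. {p \<in> S. ptype J b p = I}) (new_types J pre j)) ` F
        \<subseteq> (\<Pi>\<^sub>E I\<in>new_types J pre j. dyadic S (e I))"
        using e by (intro image_subsetI) (auto simp: F_def dyadic_def ptype_prod_def new_types_def restrict_PiE_iff)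
    next
      fix x y assume xy: "x \<in> F" "y \<in> F"
        and eq: "restrict (\<lambda>I. {p \<in> S. ptype J x p = I}) (new_types J pre j) = restrict (\<lambda>I. {p \<in> S. ptype J y p = I}) (new_types J pre j)"
      have eq': "{p \<in> S. ptype J x p = I} = {p \<in> S. ptype J y p = I}" if "I \<in> new_types J pre j" for I
        using eq that by (metis (no_types, lifting) restrict_apply')
      have "past_types J (insert j pre) x p = past_types J (insert j pre) y p" if p: "p \<in> S" for p
        by (rule past_types_insert_eq[OF Feq(2)[OF xy] Feq(3)[OF xy] Feq(1)[OF xy] p]) (use eq' p in blast)+
      then show "\<tau> x = \<tau> y" unfolding \<tau>_def by (auto simp: restrict_def fun_eq_iff)
    qed
    then have "card (\<tau> ` F) \<le> (\<Prod>I\<in>new_types J pre j. card (dyadic S (e I)))" by (simp add: card_PiE fnew)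
    then show "real (card (\<tau> ` F)) \<le> real (\<Prod>I\<in>new_types J pre j. card (dyadic S (e I)))"
      by (simp only: of_nat_le_iff)
  qed simp
  finally show ?thesis unfolding F_def .
qed

text \<open>
  First \<open>b\<^sub>j\<close> is chosen. Its new primes are then known, so \<open>T\<close> bounds the number of ways to distribute them among
  the new types. Two choices of \<open>b\<^sub>j\<close> may differ in their new primes, whence the additional weight in \<open>z\<close>.
\<close>

lemma fibre_boosted:
  fixes T :: real
  assumes a: "a \<in> A" and pre: "pre \<subseteq> J" "j \<in> J" "j \<notin> pre"
    and T: "\<And>U. U \<subseteq> S \<Longrightarrow> \<Prod>U \<le> 2 ^ ((\<Sum>I\<in>new_types J pre j. e I) + K) \<Longrightarrow> real (card (new_types J pre j)) ^ card U \<le> T"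
    and T0: "0 \<le> T"
  defines "z \<equiv> (\<Sum>I\<in>open_types J pre j. e I) + (\<Sum>I\<in>new_types J pre j. e I) + 2 * K"
  shows "real (card (past S J (insert j pre) ` {b \<in> A. past S J pre b = past S J pre a})) * 2 ^ lam j
    \<le> T * (4 * 2 ^ (z + (lam j - z)))"
proof -
  define F where "F = {b \<in> A. past S J pre b = past S J pre a}"
  have finF: "finite F" using finite_A by (auto simp: F_def)
  have fnew: "finite (new_types J pre j)" using finite_types[OF fin(2)] by (auto simp: new_types_def)
  have Feq: "past S J pre x = past S J pre y" "x \<in> A" "y \<in> A" if "x \<in> F" "y \<in> F" for x y
    using that by (auto simp: F_def)
  have one: "real (card ((\<lambda>b. b j) ` F)) * 2 ^ lam j \<le> 4 * 2 ^ (z + (lam j - z))"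
  proof (rule card_values_le[OF _ pre])
    show "F \<subseteq> A" by (auto simp: F_def)
    fix x y assume xy: "x \<in> F" "y \<in> F"
    show "past S J pre x = past S J pre y" using Feq(1) xy by blast
    \<comment> \<open>Open types of \<open>y\<close> that are not new meet \<open>pre\<close> and
      are therefore types of \<open>x\<close> as well. So the open primes of \<open>x\<close> and
      the new primes of \<open>y\<close> cover all exceptions.\<close>
    define V1 where "V1 = {p \<in> S. ptype J x p \<in> open_types J pre j}"
    define V2 where "V2 = {p \<in> S. ptype J y p \<in> new_types J pre j}"
    have o: "\<Prod>V1 \<le> 2 ^ ((\<Sum>I\<in>open_types J pre j. e I) + K)" "\<Prod>V2 \<le> 2 ^ ((\<Sum>I\<in>new_types J pre j. e I) + K)"
      unfolding V1_def V2_def by (rule prod_family_le; use Feq xy in \<open>auto simp: open_types_def new_types_def\<close>)+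
    have "\<Prod>(V1 \<union> V2) = \<Prod>V1 * \<Prod>(V2 - V1)"
      using prod.union_disjoint[of V1 "V2 - V1" "\<lambda>x. x"] fin(1) unfolding V1_def V2_def by (simp add: Un_Diff_cancel)
    also have "\<dots> \<le> \<Prod>V1 * \<Prod>V2"
    proof (rule mult_left_mono)
      have "\<Prod>(V2 - V1) dvd \<Prod>V2" by (rule prod_dvd_prod_subset) (use fin in \<open>auto simp: V2_def\<close>)
      moreover have "0 < \<Prod>V2" using primes fin by (intro prod_pos) (auto intro: prime_gt_0_nat simp: V2_def)
      ultimately show "\<Prod>(V2 - V1) \<le> \<Prod>V2" by (rule dvd_imp_le)
    qed simp
    also have "\<dots> \<le> 2 ^ ((\<Sum>I\<in>open_types J pre j. e I) + K) * 2 ^ ((\<Sum>I\<in>new_types J pre j. e I) + K)"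
      by (rule mult_mono[OF o]) auto
    also have "\<dots> = 2 ^ z" by (simp add: z_def power_add[symmetric] ac_simps mult_2)
    finally have V: "\<Prod>(V1 \<union> V2) \<le> 2 ^ z" .
    show "\<exists>V\<subseteq>S. \<Prod>V \<le> 2 ^ z \<and> (\<forall>p\<in>S - V. ptype J x p \<notin> open_types J pre j \<and> ptype J y p \<notin> open_types J pre j \<and>
        (ptype J x p \<in> new_types J pre j \<or> ptype J y p \<in> new_types J pre j \<longrightarrow> ptype J y p = ptype J x p))"
    proof (intro exI[of _ "V1 \<union> V2"] conjI ballI)
      fix p assume p: "p \<in> S - (V1 \<union> V2)"
      then show no: "ptype J x p \<notin> open_types J pre j" by (auto simp: V1_def)
      have nn: "ptype J y p \<notin> new_types J pre j" using p by (auto simp: V2_def)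
      show no': "ptype J y p \<notin> open_types J pre j"
      proof
        assume y: "ptype J y p \<in> open_types J pre j"
        then have "ptype J y p \<inter> pre \<noteq> {}" using nn by (auto simp: open_types_def new_types_def)
        then have "ptype J x p = ptype J y p" using past_eqD(2)[OF Feq(1)[OF xy(2,1)]] p by auto
        with y no show False by simp
      qed
      show "ptype J x p \<in> new_types J pre j \<or> ptype J y p \<in> new_types J pre j \<longrightarrow> ptype J y p = ptype J x p"
        using new_subset_open[OF pre(3)] no no' by blast
    qed (use V in \<open>auto simp: V1_def V2_def\<close>)
  qed
  have two: "real (card (past S J (insert j pre) ` F)) * 1 \<le> real (card ((\<lambda>b. b j) ` F)) * T"
  proof (rule card_image_le_card_image_mult[OF finF])
    fix b0 assume b0: "b0 \<in> F"
    define F1 where "F1 = {b \<in> F. b j = b0 j}"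
    define U where "U = {p \<in> S. ptype J b0 p \<in> new_types J pre j}"
    have F1: "x \<in> F" "x j = b0 j" if "x \<in> F1" for x using that by (auto simp: F1_def)
    \<comment> \<open>Being new at \<open>j\<close> means that \<open>p\<close> does not divide
      \<open>b j\<close> and was not met before, which depends only on the past and on
      \<open>b j\<close>. Hence one set \<open>U\<close> serves the whole fibre.\<close>
    have new: "ptype J x p \<in> new_types J pre j" if "x \<in> F" "y \<in> F" "x j = y j" "ptype J y p \<in> new_types J pre j" "p \<in> S" for x y p
    proof -
      have "j \<in> ptype J x p" using that by (auto simp: ptype_def new_types_def)
      moreover have "ptype J x p \<inter> pre = {}"
        using past_eqD(2)[OF Feq(1)[OF that(1,2)] that(5)] that(4) by (auto simp: new_types_def)
      ultimately show ?thesis using ptype_cases[OF Feq(2)[OF that(1,2)] that(5)] by (auto simp: new_types_def)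
    qed
    have "card (past S J (insert j pre) ` F1) \<le> card (U \<rightarrow>\<^sub>E new_types J pre j)"
    proof (rule card_image_le_via[of _ "\<lambda>b. restrict (ptype J b) U"])
      show "finite (U \<rightarrow>\<^sub>E new_types J pre j)" by (intro finite_PiE fnew) (use fin in \<open>auto simp: U_def\<close>)
      show "(\<lambda>b. restrict (ptype J b) U) ` F1 \<subseteq> (U \<rightarrow>\<^sub>E new_types J pre j)"
      proof -
        have "restrict (ptype J x) U \<in> U \<rightarrow>\<^sub>E new_types J pre j" if "x \<in> F1" for x
          using new[of x b0] F1[OF that] b0 by (auto simp: U_def)
        then show ?thesis by blast
      qed
      fix x y assume xy: "x \<in> F1" "y \<in> F1" and eq: "restrict (ptype J x) U = restrict (ptype J y) U"
      have xyF: "x \<in> F" "y \<in> F" using xy F1 by auto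
      show "past S J (insert j pre) x = past S J (insert j pre) y"
      proof (rule past_eqI)
        fix i assume "i \<in> insert j pre"
        then show "x i = y i" using past_eqD(1)[OF Feq(1)[OF xyF]] F1(2)[OF xy(1)] F1(2)[OF xy(2)] by auto
      next
        fix p assume p: "p \<in> S"
        have u: "ptype J y p = ptype J x p" if "p \<in> U" using eq that by (metis restrict_apply')
        show "past_types J (insert j pre) x p = past_types J (insert j pre) y p"
        proof (rule past_types_insert_eq[OF Feq(2)[OF xyF] Feq(3)[OF xyF] Feq(1)[OF xyF] p])
          assume "ptype J x p \<in> new_types J pre j"
          then have "p \<in> U" using new[OF b0 xyF(1) F1(2)[OF xy(1), symmetric]] p by (auto simp: U_def)
          then show "ptype J y p = ptype J x p" by (rule u)
        next
          assume "ptype J y p \<in> new_types J pre j"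
          then have "p \<in> U" using new[OF b0 xyF(2) F1(2)[OF xy(2), symmetric]] p by (auto simp: U_def)
          then show "ptype J y p = ptype J x p" by (rule u)
        qed
      qed
    qed
    also have "\<dots> = card (new_types J pre j) ^ card U"
      by (subst card_PiE) (use fin in \<open>auto simp: U_def\<close>)
    finally have "real (card (past S J (insert j pre) ` F1)) \<le> real (card (new_types J pre j)) ^ card U"
      by (simp only: of_nat_power[symmetric] of_nat_le_iff)
    also have "\<dots> \<le> T"
    proof (rule T)
      show "\<Prod>U \<le> 2 ^ ((\<Sum>I\<in>new_types J pre j. e I) + K)"
        unfolding U_def by (rule prod_family_le) (use b0 in \<open>auto simp: F_def new_types_def\<close>)
    qed (auto simp: U_def)
    finally show "real (card (past S J (insert j pre) ` {b \<in> F. b j = b0 j})) * 1 \<le> T" unfolding F1_def by simp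
  qed simp
  have "real (card (past S J (insert j pre) ` F)) * 2 ^ lam j \<le> real (card ((\<lambda>b. b j) ` F)) * T * 2 ^ lam j"
    using two by (intro mult_right_mono) auto
  also have "\<dots> = T * (real (card ((\<lambda>b. b j) ` F)) * 2 ^ lam j)" by simp
  also have "\<dots> \<le> T * (4 * 2 ^ (z + (lam j - z)))" by (rule mult_left_mono[OF one T0])
  finally show ?thesis unfolding F_def .
qed

end

section \<open>The count of a cell along an order of the indices\<close>

definition first_types :: "nat set \<Rightarrow> (nat \<Rightarrow> int) \<Rightarrow> nat \<Rightarrow> nat set set" where
  "first_types J \<rho> j = {I \<in> types J. j \<in> I \<and> (\<forall>i\<in>I. \<rho> j \<le> \<rho> i)}"

definition first_weight :: "nat set \<Rightarrow> (nat set \<Rightarrow> nat) \<Rightarrow> (nat \<Rightarrow> int) \<Rightarrow> nat \<Rightarrow> nat" where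
  "first_weight J e \<rho> j = (\<Sum>I\<in>first_types J \<rho> j. e I)"

definition last_weight :: "nat set \<Rightarrow> (nat set \<Rightarrow> nat) \<Rightarrow> (nat \<Rightarrow> int) \<Rightarrow> nat \<Rightarrow> nat" where
  "last_weight J e \<rho> = first_weight J e (\<lambda>i. - \<rho> i)"

text \<open>Up to the constant \<open>K\<close> the binary logarithm of the reduced denominator of
  \<open>b j / \<Prod>S\<close>.\<close>

definition weight :: "nat set \<Rightarrow> (nat set \<Rightarrow> nat) \<Rightarrow> nat \<Rightarrow> nat" where
  "weight J e j = (\<Sum>I\<in>{I \<in> types J. j \<in> I}. e I)"

text \<open>
  The order of the indices is given by the injective function \<open>\<rho>\<close>, so that \<open>-\<rho>\<close> is the reverse order; \<open>B\<close> is the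
  set of boosted indices. The truncated subtraction is the positive part.
\<close>

definition deficit :: "nat set \<Rightarrow> (nat set \<Rightarrow> nat) \<Rightarrow> (nat \<Rightarrow> nat) \<Rightarrow> (nat \<Rightarrow> int) \<Rightarrow> nat set \<Rightarrow> nat \<Rightarrow> nat" where
  "deficit J e lam \<rho> B j =
    lam j - (weight J e j - last_weight J e \<rho> j + (if j \<in> B then first_weight J e \<rho> j else 0))"

text \<open>Brings the plain and the boosted count of one index to the same shape: the plain count
  lacks the factor \<open>T\<close>, the boosted one the factor \<open>P\<close>.\<close>

lemma pow2_regroup:
  fixes P T :: real and F K W D :: nat
  assumes "0 \<le> P" "1 \<le> T"
  shows "(2 ^ (F + K) * P) * (4 * 2 ^ (W + K + D)) \<le> 2 ^ (4 * K + 2) * T * 2 ^ D * 2 ^ (W + F) * P"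
    and "1 \<le> P \<Longrightarrow> T * (4 * 2 ^ (W + F + 2 * K + D)) \<le> 2 ^ (4 * K + 2) * T * 2 ^ D * 2 ^ (W + F) * P"
proof -
  have 4: "(4::real) = 2 ^ 2" by simp
  have K2: "(2::real) ^ (2 * K) = 2 ^ K * 2 ^ K" by (simp add: mult_2 power_add)
  have mono: "(2::real) ^ (2 * K + 2) \<le> 2 ^ (4 * K + 2)" by (rule power_increasing) auto
  have "(2 ^ (F + K) * P) * (4 * 2 ^ (W + K + D)) = 2 ^ (2 * K + 2) * (2 ^ D * 2 ^ (W + F) * P)"
    unfolding 4 power_add K2 by (simp only: ac_simps)
  also have "\<dots> \<le> 2 ^ (4 * K + 2) * T * (2 ^ D * 2 ^ (W + F) * P)"
    using mult_mono[OF mono assms(2)] assms(1) by (intro mult_right_mono) auto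
  finally show "(2 ^ (F + K) * P) * (4 * 2 ^ (W + K + D)) \<le> 2 ^ (4 * K + 2) * T * 2 ^ D * 2 ^ (W + F) * P"
    by (simp only: ac_simps)
  assume P: "1 \<le> P"
  have "T * (4 * 2 ^ (W + F + 2 * K + D)) = 2 ^ (2 * K + 2) * 1 * (T * 2 ^ D * 2 ^ (W + F))"
    unfolding 4 power_add K2 by (simp only: ac_simps mult_1_right)
  also have "\<dots> \<le> 2 ^ (4 * K + 2) * P * (T * 2 ^ D * 2 ^ (W + F))"
    using mult_mono[OF mono P] assms by (intro mult_right_mono) auto
  finally show "T * (4 * 2 ^ (W + F + 2 * K + D)) \<le> 2 ^ (4 * K + 2) * T * 2 ^ D * 2 ^ (W + F) * P"
    by (simp only: ac_simps)
qed

text \<open>By injectivity of \<open>\<rho>\<close> each type has exactly one first index. Applied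
  to \<open>\<rho>\<close> and to its negative, this gives the first weights and the last weights
  the same total.\<close>

lemma first_types_partition:
  fixes f :: "nat set \<Rightarrow> 'a :: comm_monoid_add"
  assumes "finite J" "inj_on \<rho> J"
  shows "(\<Sum>j\<in>J. \<Sum>I\<in>first_types J \<rho> j. f I) = (\<Sum>I\<in>types J. f I)"
proof -
  have eq: "first_types J \<rho> j = {I \<in> types J. arg_min_on \<rho> I = j}" for j
  proof -
    have "(j \<in> I \<and> (\<forall>i\<in>I. \<rho> j \<le> \<rho> i)) \<longleftrightarrow> arg_min_on \<rho> I = j" if I: "I \<in> types J" for I
    proof -
      have I': "finite I" "I \<noteq> {}" "I \<subseteq> J" using I assms(1) finite_subset by (auto simp: types_def)
      note m = arg_min_if_finite[OF I'(1,2), of \<rho>]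
      show ?thesis
      proof
        assume j: "j \<in> I \<and> (\<forall>i\<in>I. \<rho> j \<le> \<rho> i)"
        then have "\<rho> (arg_min_on \<rho> I) = \<rho> j" using m by (meson linorder_not_le order_antisym)
        then show "arg_min_on \<rho> I = j" using j m(1) I'(3) assms(2) by (meson inj_onD subsetD)
      next
        assume "arg_min_on \<rho> I = j"
        then show "j \<in> I \<and> (\<forall>i\<in>I. \<rho> j \<le> \<rho> i)" using m by (auto simp: not_less)
      qed
    qed
    then show ?thesis unfolding first_types_def by blast
  qed
  have sub: "arg_min_on \<rho> ` types J \<subseteq> J"
  proof
    fix x assume "x \<in> arg_min_on \<rho> ` types J"
    then obtain I where I: "I \<in> types J" "x = arg_min_on \<rho> I" by auto
    have I': "finite I" "I \<noteq> {}" "I \<subseteq> J" using I assms(1) finite_subset by (auto simp: types_def)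
    then show "x \<in> J" using arg_min_if_finite(1)[OF I'(1,2), of \<rho>] I by auto
  qed
  show ?thesis unfolding eq using sum.group[OF finite_types[OF assms(1)] assms(1) sub, of f] by simp
qed

lemma first_types_partition_prod:
  fixes f :: "nat set \<Rightarrow> real"
  assumes "finite J" "inj_on \<rho> J"
  shows "(\<Prod>j\<in>J. \<Prod>I\<in>first_types J \<rho> j. f I) = (\<Prod>I\<in>types J. f I)"
proof -
  have fin: "\<forall>j\<in>J. finite (first_types J \<rho> j)" using finite_types[OF assms(1)] by (auto simp: first_types_def)
  have "(\<Prod>j\<in>J. \<Prod>I\<in>first_types J \<rho> j. f I) = prod f (\<Union>j\<in>J. first_types J \<rho> j)"
  proof (rule prod.UNION_disjoint[OF assms(1) fin, symmetric], intro ballI impI)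
    fix i j assume ij: "i \<in> J" "j \<in> J" "i \<noteq> j"
    then have "\<rho> i \<noteq> \<rho> j" using assms(2) by (auto dest: inj_onD)
    then show "first_types J \<rho> i \<inter> first_types J \<rho> j = {}" by (force simp: first_types_def)
  qed
  also have "(\<Union>j\<in>J. first_types J \<rho> j) = types J"
  proof
    show "types J \<subseteq> (\<Union>j\<in>J. first_types J \<rho> j)"
    proof
      fix I assume I: "I \<in> types J"
      have I': "finite I" "I \<noteq> {}" "I \<subseteq> J" using I assms(1) finite_subset by (auto simp: types_def)
      have "I \<in> first_types J \<rho> (arg_min_on \<rho> I)"
        using arg_min_if_finite[OF I'(1,2), of \<rho>] I by (auto simp: first_types_def not_less)
      then show "I \<in> (\<Union>j\<in>J. first_types J \<rho> j)" using arg_min_if_finite(1)[OF I'(1,2), of \<rho>] I'(3) by blast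
    qed
  qed (auto simp: first_types_def)
  finally show ?thesis .
qed

lemma new_types_eq_first_types:
  assumes "j \<in> J"
  shows "new_types J {i \<in> J. \<rho> i < \<rho> j} j = first_types J \<rho> j"
  using assms unfolding new_types_def first_types_def types_def by force

text \<open>A type at \<open>j\<close> fails to be open exactly when \<open>j\<close> is its last
  index, so the open weight is the weight at \<open>j\<close> minus the last weight.\<close>

lemma open_types_eq:
  assumes "j \<in> J" "inj_on \<rho> J"
  shows "open_types J {i \<in> J. \<rho> i < \<rho> j} j = {I \<in> types J. j \<in> I} - first_types J (\<lambda>i. - \<rho> i) j"
proof -
  have "I \<subseteq> insert j {i \<in> J. \<rho> i < \<rho> j} \<longleftrightarrow> (\<forall>i\<in>I. \<rho> i \<le> \<rho> j)" if "I \<subseteq> J" for I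
  proof
    assume "\<forall>i\<in>I. \<rho> i \<le> \<rho> j"
    then have "i = j \<or> \<rho> i < \<rho> j" if "i \<in> I" for i
      using that \<open>I \<subseteq> J\<close> assms by (metis inj_onD order_le_less subsetD)
    then show "I \<subseteq> insert j {i \<in> J. \<rho> i < \<rho> j}" using that by auto
  qed auto
  then show ?thesis unfolding open_types_def first_types_def types_def by auto
qed

context dyadic_cell begin

lemma open_weight_eq:
  assumes "j \<in> J" "inj_on \<rho> J"
  shows "(\<Sum>I\<in>open_types J {i \<in> J. \<rho> i < \<rho> j} j. e I) = weight J e j - last_weight J e \<rho> j"
    and "last_weight J e \<rho> j \<le> weight J e j"
proof -
  have f: "finite (first_types J (\<lambda>i. - \<rho> i) j)" "first_types J (\<lambda>i. - \<rho> i) j \<subseteq> {I \<in> types J. j \<in> I}"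
    "finite {I \<in> types J. j \<in> I}"
    using finite_types[OF fin(2)] by (auto simp: first_types_def)
  show "(\<Sum>I\<in>open_types J {i \<in> J. \<rho> i < \<rho> j} j. e I) = weight J e j - last_weight J e \<rho> j"
    unfolding open_types_eq[OF assms] weight_def last_weight_def first_weight_def
    by (rule sum_diff_nat[OF f(1,2)])
  show "last_weight J e \<rho> j \<le> weight J e j"
    unfolding weight_def last_weight_def first_weight_def by (rule sum_mono2[OF f(3,2)]) simp
qed

lemma card_past_insert_le:
  fixes T :: real
  assumes j: "j \<in> J" and inj: "inj_on \<rho> J" and T1: "1 \<le> T"
    and B: "j \<in> B \<Longrightarrow> \<forall>I\<in>first_types J \<rho> j. e I \<le> N"
    and T: "\<And>U. j \<in> B \<Longrightarrow> U \<subseteq> S \<Longrightarrow> \<Prod>U \<le> 2 ^ (first_weight J e \<rho> j + K) \<Longrightarrow> real (card (first_types J \<rho> j)) ^ card U \<le> T"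
  defines "pre \<equiv> {i \<in> J. \<rho> i < \<rho> j}"
  shows "real (card (past S J (insert j pre) ` A)) * 2 ^ lam j \<le> real (card (past S J pre ` A)) *
    (2 ^ (4 * K + 2) * T * 2 ^ deficit J e lam \<rho> B j *
     2 ^ (weight J e j - last_weight J e \<rho> j + first_weight J e \<rho> j) * (\<Prod>I\<in>first_types J \<rho> j. cell_mass N S (e I)))"
proof (rule card_image_le_card_image_mult[OF finite_A])
  fix a assume a: "a \<in> A"
  have pre: "pre \<subseteq> J" "j \<notin> pre" by (auto simp: pre_def)
  define W where "W = weight J e j - last_weight J e \<rho> j"
  define F where "F = first_weight J e \<rho> j"
  define P where "P = (\<Prod>I\<in>first_types J \<rho> j. cell_mass N S (e I))"
  define D where "D = deficit J e lam \<rho> B j"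
  have new: "new_types J pre j = first_types J \<rho> j" unfolding pre_def by (rule new_types_eq_first_types[OF j])
  have F: "(\<Sum>I\<in>new_types J pre j. e I) = F" unfolding new F_def first_weight_def ..
  have W: "(\<Sum>I\<in>open_types J pre j. e I) = W" unfolding W_def pre_def by (rule open_weight_eq[OF j inj])
  have ft: "finite (first_types J \<rho> j)" using finite_types[OF fin(2)] by (auto simp: first_types_def)
  have P0: "0 \<le> P" unfolding P_def cell_mass_def by (intro prod_nonneg) (use dyadic_mass_nonneg in \<open>auto intro!: add_nonneg_nonneg\<close>)
  have "real (card (past S J (insert j pre) ` {b \<in> A. past S J pre b = past S J pre a})) * 2 ^ lam j
    \<le> 2 ^ (4 * K + 2) * T * 2 ^ D * 2 ^ (W + F) * P"
  proof (cases "j \<in> B")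
    case False
    have "real (card (past S J (insert j pre) ` {b \<in> A. past S J pre b = past S J pre a})) * 2 ^ lam j
      \<le> real (\<Prod>I\<in>new_types J pre j. card (dyadic S (e I))) * (4 * 2 ^ (W + K + (lam j - (W + K))))"
      using fibre_plain[OF a pre(1) j pre(2)] unfolding W .
    also have "\<dots> \<le> (2 ^ (F + K) * P) * (4 * 2 ^ (W + K + D))"
    proof (rule mult_mono)
      have "real (\<Prod>I\<in>new_types J pre j. card (dyadic S (e I))) = (\<Prod>I\<in>first_types J \<rho> j. real (card (dyadic S (e I))))"
        unfolding new by simp
      also have "\<dots> \<le> (\<Prod>I\<in>first_types J \<rho> j. 2 ^ (e I + 1) * cell_mass N S (e I))"
      proof (rule prod_mono)
        fix I assume "I \<in> first_types J \<rho> j"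
        have "real (card (dyadic S (e I))) \<le> 2 ^ (e I + 1) * dyadic_mass S (e I)" by (rule dyadic_card_le[OF fin(1)])
        also have "\<dots> \<le> 2 ^ (e I + 1) * cell_mass N S (e I)" by (intro mult_left_mono) (auto simp: cell_mass_def)
        finally show "0 \<le> real (card (dyadic S (e I))) \<and> real (card (dyadic S (e I))) \<le> 2 ^ (e I + 1) * cell_mass N S (e I)" by simp
      qed
      also have "\<dots> = 2 ^ (\<Sum>I\<in>first_types J \<rho> j. e I + 1) * P"
        unfolding P_def prod.distrib power_sum ..
      also have "(\<Sum>I\<in>first_types J \<rho> j. e I + 1) = F + card (first_types J \<rho> j)"
        unfolding F_def first_weight_def by (simp only: sum.distrib sum_constant mult_1_right of_nat_id)
      also have "2 ^ (F + card (first_types J \<rho> j)) * P \<le> 2 ^ (F + K) * P"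
      proof (rule mult_right_mono[OF power_increasing P0])
        have "card (first_types J \<rho> j) \<le> card (types J)" using finite_types[OF fin(2)] by (intro card_mono) (auto simp: first_types_def)
        then show "F + card (first_types J \<rho> j) \<le> F + K" using card_types_le[OF fin(2)] by simp
      qed simp
      finally show "real (\<Prod>I\<in>new_types J pre j. card (dyadic S (e I))) \<le> 2 ^ (F + K) * P" .
      have "lam j - (W + K) \<le> D" using False unfolding D_def deficit_def W_def by simp
      then show "(4::real) * 2 ^ (W + K + (lam j - (W + K))) \<le> 4 * 2 ^ (W + K + D)"
        by (intro mult_left_mono power_increasing) auto
    qed (use P0 in auto)
    also have "\<dots> \<le> 2 ^ (4 * K + 2) * T * 2 ^ D * 2 ^ (W + F) * P" by (rule pow2_regroup(1)[OF P0 T1])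
    finally show ?thesis .
  next
    case True
    have "real (card (past S J (insert j pre) ` {b \<in> A. past S J pre b = past S J pre a})) * 2 ^ lam j
      \<le> T * (4 * 2 ^ (W + F + 2 * K + (lam j - (W + F + 2 * K))))"
    proof -
      have "real (card (past S J (insert j pre) ` {b \<in> A. past S J pre b = past S J pre a})) * 2 ^ lam j
        \<le> T * (4 * 2 ^ ((\<Sum>I\<in>open_types J pre j. e I) + (\<Sum>I\<in>new_types J pre j. e I) + 2 * K + (lam j - ((\<Sum>I\<in>open_types J pre j. e I) + (\<Sum>I\<in>new_types J pre j. e I) + 2 * K))))"
      proof (rule fibre_boosted[OF a pre(1) j pre(2)])
        fix U assume U: "U \<subseteq> S" "\<Prod>U \<le> 2 ^ ((\<Sum>I\<in>new_types J pre j. e I) + K)"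
        then show "real (card (new_types J pre j)) ^ card U \<le> T" unfolding new using T[OF True U(1)] by (simp add: first_weight_def)
      qed (use T1 in auto)
      then show ?thesis unfolding F W .
    qed
    also have "\<dots> \<le> T * (4 * 2 ^ (W + F + 2 * K + D))"
    proof -
      have "lam j - (W + F + 2 * K) \<le> D" using True unfolding D_def deficit_def W_def F_def by simp
      then show ?thesis using T1 by (intro mult_left_mono power_increasing) auto
    qed
    also have "\<dots> \<le> 2 ^ (4 * K + 2) * T * 2 ^ D * 2 ^ (W + F) * P"
    proof (rule pow2_regroup(2)[OF P0 T1])
      \<comment> \<open>The boosted count has no factor for the sets of new primes. Here the summand
        1 of \<open>cell_mass\<close>, and with it the condition \<open>e I \<le> N\<close>,
        enters.\<close>
      show "1 \<le> P" unfolding P_def cell_mass_def by (rule prod_ge_1) (use B[OF True] dyadic_mass_nonneg in auto)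
    qed
    finally show ?thesis .
  qed
  then show "real (card (past S J (insert j pre) ` {b \<in> A. past S J pre b = past S J pre a})) * 2 ^ lam j
    \<le> 2 ^ (4 * K + 2) * T * 2 ^ deficit J e lam \<rho> B j *
     2 ^ (weight J e j - last_weight J e \<rho> j + first_weight J e \<rho> j) * (\<Prod>I\<in>first_types J \<rho> j. cell_mass N S (e I))"
    unfolding D_def W_def F_def P_def .
qed simp

text \<open>The bounds for single indices are multiplied along initial segments of the order. The
  exponents other than the deficits add up to the total weight, because every type is counted once
  as first and once as last.\<close>

theorem card_cell_le:
  fixes T :: real
  assumes inj: "inj_on \<rho> J" and T1: "1 \<le> T"
    and B: "\<And>j. j \<in> J \<inter> B \<Longrightarrow> \<forall>I\<in>first_types J \<rho> j. e I \<le> N"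
    and T: "\<And>j U. j \<in> J \<inter> B \<Longrightarrow> U \<subseteq> S \<Longrightarrow> \<Prod>U \<le> 2 ^ (first_weight J e \<rho> j + K) \<Longrightarrow> real (card (first_types J \<rho> j)) ^ card U \<le> T"
  shows "real (card A) * 2 ^ (\<Sum>j\<in>J. lam j) \<le> (2 ^ (4 * K + 2) * T) ^ card J *
    2 ^ (\<Sum>j\<in>J. deficit J e lam \<rho> B j) * 2 ^ (\<Sum>j\<in>J. weight J e j) * (\<Prod>I\<in>types J. cell_mass N S (e I))"
proof -
  define c where "c = (\<lambda>j. 2 ^ (4 * K + 2) * T * 2 ^ deficit J e lam \<rho> B j *
     2 ^ (weight J e j - last_weight J e \<rho> j + first_weight J e \<rho> j) * (\<Prod>I\<in>first_types J \<rho> j. cell_mass N S (e I)))"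
  have k0: "0 \<le> cell_mass N S x" for x unfolding cell_mass_def using dyadic_mass_nonneg by auto
  have c0: "0 \<le> c j" for j unfolding c_def using T1 k0 by (intro mult_nonneg_nonneg prod_nonneg) auto
  have "X \<subseteq> J \<Longrightarrow> (\<forall>i\<in>X. \<forall>i'\<in>J. \<rho> i' < \<rho> i \<longrightarrow> i' \<in> X) \<Longrightarrow>
    real (card (past S J X ` A)) * (\<Prod>j\<in>X. 2 ^ lam j) \<le> (\<Prod>j\<in>X. c j)" if "finite X" for X
    using that
  proof (induction X rule: finite_ranking_induct[where f = \<rho>])
    case empty
    have "past S J {} ` A \<subseteq> {past S J {} undefined}" by (auto simp: past_def past_types_def)
    then have "card (past S J {} ` A) \<le> 1" using card_mono[of "{past S J {} undefined}"] by simp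
    then show ?case by simp
  next
    case (insert j X)
    show ?case
    proof (cases "j \<in> X")
      case True
      then show ?thesis using insert by (simp add: insert_absorb)
    next
      case False
      have jX: "j \<in> J" "X \<subseteq> J" using insert by auto
      have lt: "\<rho> i < \<rho> j" if "i \<in> X" for i
        using insert(2)[rule_format, OF that] inj that jX False by (metis inj_onD order_le_less subsetD)
      have X: "X = {i \<in> J. \<rho> i < \<rho> j}" using lt jX insert(5) by auto
      have IH: "real (card (past S J X ` A)) * (\<Prod>j\<in>X. 2 ^ lam j) \<le> (\<Prod>j\<in>X. c j)"
      proof (rule insert(3)[OF jX(2)], intro ballI impI)
        fix i i' assume "i \<in> X" "i' \<in> J" "\<rho> i' < \<rho> i"
        then show "i' \<in> X" using X by auto
      qed
      have "real (card (past S J (insert j X) ` A)) * 2 ^ lam j \<le> real (card (past S J X ` A)) * c j"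
        unfolding c_def X by (rule card_past_insert_le[OF jX(1) inj T1]) (use B T jX in auto)
      then have "real (card (past S J (insert j X) ` A)) * 2 ^ lam j * (\<Prod>j\<in>X. 2 ^ lam j)
        \<le> real (card (past S J X ` A)) * c j * (\<Prod>j\<in>X. 2 ^ lam j)"
        by (rule mult_right_mono) (auto intro: prod_nonneg)
      also have "\<dots> = c j * (real (card (past S J X ` A)) * (\<Prod>j\<in>X. 2 ^ lam j))" by simp
      also have "\<dots> \<le> c j * (\<Prod>j\<in>X. c j)" by (rule mult_left_mono[OF IH c0])
      finally show ?thesis using insert(1) False by (simp add: mult.assoc)
    qed
  qed
  from this[OF fin(2)] have "real (card (past S J J ` A)) * (\<Prod>j\<in>J. 2 ^ lam j) \<le> (\<Prod>j\<in>J. c j)" by simp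
  moreover have "card (past S J J ` A) = card A"
  proof (rule card_image, rule inj_onI)
    fix x y assume xy: "x \<in> A" "y \<in> A" "past S J J x = past S J J y"
    then have "x i = y i" if "i \<in> J" for i using past_eqD(1) that by blast
    moreover have "x \<in> extensional J" "y \<in> extensional J" using xy A by (auto simp: zero_sums_def PiE_def)
    ultimately show "x = y" by (metis extensionalityI)
  qed
  moreover have "(\<Prod>j\<in>J. 2 ^ lam j) = (2::real) ^ (\<Sum>j\<in>J. lam j)" by (simp add: power_sum)
  moreover have "(\<Prod>j\<in>J. c j) = (2 ^ (4 * K + 2) * T) ^ card J *
    2 ^ (\<Sum>j\<in>J. deficit J e lam \<rho> B j) * 2 ^ (\<Sum>j\<in>J. weight J e j) * (\<Prod>I\<in>types J. cell_mass N S (e I))"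
  proof -
    have "(\<Sum>j\<in>J. weight J e j - last_weight J e \<rho> j + first_weight J e \<rho> j) + (\<Sum>j\<in>J. last_weight J e \<rho> j)
      = (\<Sum>j\<in>J. weight J e j + first_weight J e \<rho> j)"
      unfolding sum.distrib[symmetric]
    proof (rule sum.cong[OF refl])
      fix j assume "j \<in> J"
      from open_weight_eq(2)[OF this inj]
      show "weight J e j - last_weight J e \<rho> j + first_weight J e \<rho> j + last_weight J e \<rho> j
        = weight J e j + first_weight J e \<rho> j" by simp
    qed
    moreover have "inj_on (\<lambda>i. - \<rho> i) J" using inj by (auto simp: inj_on_def)
    ultimately have w: "(\<Sum>j\<in>J. weight J e j - last_weight J e \<rho> j + first_weight J e \<rho> j) = (\<Sum>j\<in>J. weight J e j)"
      unfolding last_weight_def first_weight_def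
      by (simp add: sum.distrib first_types_partition[OF fin(2) inj] first_types_partition[OF fin(2)])
    define C where "C = 2 ^ (4 * K + 2) * T"
    have "(\<Prod>j\<in>J. c j) = C ^ card J *
      2 ^ (\<Sum>j\<in>J. deficit J e lam \<rho> B j) * 2 ^ (\<Sum>j\<in>J. weight J e j) * (\<Prod>I\<in>types J. cell_mass N S (e I))"
      unfolding c_def C_def[symmetric] prod.distrib power_sum[symmetric] w
      by (simp only: first_types_partition_prod[OF fin(2) inj] prod_constant)
    then show ?thesis unfolding C_def .
  qed
  ultimately show ?thesis by simp
qed

end

section \<open>Choosing the order of the indices\<close>

text \<open>The deficit if every index were boosted, which is easier to optimise;
  \<open>deficit_boost_le\<close> returns to admissible sets of boosted indices.\<close>

definition boosted_deficit :: "nat set \<Rightarrow> (nat set \<Rightarrow> nat) \<Rightarrow> (nat \<Rightarrow> nat) \<Rightarrow> (nat \<Rightarrow> int) \<Rightarrow> nat \<Rightarrow> nat" where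
  "boosted_deficit J e lam \<rho> j =
    lam j - (weight J e j - last_weight J e \<rho> j + first_weight J e \<rho> j)"

text \<open>Logarithmic size of the primes that can fail to divide the subsum over \<open>T\<close>:
  those whose type neither avoids \<open>T\<close> nor lies inside it.\<close>

definition cut_weight :: "nat set \<Rightarrow> (nat set \<Rightarrow> nat) \<Rightarrow> nat set \<Rightarrow> nat" where
  "cut_weight J e T = (\<Sum>I\<in>{I \<in> types J. I \<inter> T \<noteq> {} \<and> \<not> I \<subseteq> T}. e I)"

lemma last_weight_uminus: "last_weight J e (\<lambda>i. - \<rho> i) = first_weight J e \<rho>"
  unfolding last_weight_def by simp

lemma first_weight_uminus: "first_weight J e (\<lambda>i. - \<rho> i) = last_weight J e \<rho>"
  unfolding last_weight_def by simp

text \<open>All that the choice of an order has to know about a nonempty cell, apart from the cut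
  condition, which is assumed where it is used. \<open>K\<close> is a bounded slack.\<close>

locale cell_exponents =
  fixes J :: "nat set" and e :: "nat set \<Rightarrow> nat" and lam :: "nat \<Rightarrow> nat" and N K :: nat
  assumes finite_J: "finite J"
    and lam_le: "\<And>j. j \<in> J \<Longrightarrow> lam j \<le> N"
    and lam_le_weight: "\<And>j. j \<in> J \<Longrightarrow> lam j \<le> weight J e j + K"
begin

lemma finT: "finite {I \<in> types J. P I}" using finite_types[OF finite_J] by simp

lemma first_weight_eq: "first_weight J e \<rho> j = (\<Sum>I\<in>{I \<in> types J. j \<in> I \<and> (\<forall>i\<in>I. \<rho> j \<le> \<rho> i)}. e I)"
  unfolding first_weight_def first_types_def ..

lemma last_weight_eq: "last_weight J e \<rho> j = (\<Sum>I\<in>{I \<in> types J. j \<in> I \<and> (\<forall>i\<in>I. \<rho> i \<le> \<rho> j)}. e I)"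
  unfolding last_weight_def first_weight_def first_types_def by simp

text \<open>A type has at least two elements, so no type both begins and ends at
  \<open>j\<close>.\<close>

lemma last_add_first_le:
  assumes "inj_on \<rho> J" "j \<in> J"
  shows "last_weight J e \<rho> j + first_weight J e \<rho> j \<le> weight J e j"
proof -
  let ?L = "{I \<in> types J. j \<in> I \<and> (\<forall>i\<in>I. \<rho> i \<le> \<rho> j)}" and ?F = "{I \<in> types J. j \<in> I \<and> (\<forall>i\<in>I. \<rho> j \<le> \<rho> i)}"
  have "?L \<inter> ?F = {}"
  proof (rule ccontr)
    assume "?L \<inter> ?F \<noteq> {}"
    then obtain I where I: "I \<in> types J" "\<forall>i\<in>I. \<rho> i = \<rho> j" by force
    then have "I \<subseteq> {j}" using assms by (auto simp: types_def dest: inj_onD)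
    then have "card I \<le> card {j}" by (intro card_mono) auto
    then show False using I by (simp add: types_def)
  qed
  then have "last_weight J e \<rho> j + first_weight J e \<rho> j = (\<Sum>I\<in>?L \<union> ?F. e I)"
    unfolding first_weight_eq last_weight_eq by (intro sum.union_disjoint[symmetric] finT)
  also have "\<dots> \<le> weight J e j"
    unfolding weight_def by (rule sum_mono2[OF finT]) auto
  finally show ?thesis .
qed

lemma boosted_deficit_le_lam: "boosted_deficit J e lam \<rho> j \<le> lam j"
  by (simp add: boosted_deficit_def)

lemma boosted_deficit_le_N: "j \<in> J \<Longrightarrow> boosted_deficit J e lam \<rho> j \<le> N"
  using boosted_deficit_le_lam lam_le order_trans by blast

lemma boosted_deficit_le_of_last_le_first:
  assumes "inj_on \<rho> J" "j \<in> J" "last_weight J e \<rho> j \<le> first_weight J e \<rho> j"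
  shows "boosted_deficit J e lam \<rho> j \<le> K"
  using last_add_first_le[OF assms(1,2)] lam_le_weight[OF assms(2)] assms(3) unfolding boosted_deficit_def by linarith

text \<open>Boosting compares \<open>lam j\<close> with \<open>weight - last + first\<close>, and
  reversal swaps the last two terms. In the direction with \<open>last \<le> first\<close> this is
  at least the weight, hence at least \<open>lam j - K\<close>.\<close>

lemma good_in_one_direction:
  assumes "inj_on \<rho> J" "j \<in> J"
  shows "boosted_deficit J e lam \<rho> j \<le> K \<or> boosted_deficit J e lam (\<lambda>i. - \<rho> i) j \<le> K"
proof -
  have inj': "inj_on (\<lambda>i. - \<rho> i) J" using assms(1) by (auto simp: inj_on_def)
  show ?thesis
    using boosted_deficit_le_of_last_le_first[OF assms] boosted_deficit_le_of_last_le_first[OF inj' assms(2)]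
    unfolding last_weight_uminus first_weight_uminus by linarith
qed

lemma boosted_deficit_first_le:
  assumes "inj_on \<rho> J" "j \<in> J" "\<And>i. i \<in> J \<Longrightarrow> \<rho> j \<le> \<rho> i"
  shows "boosted_deficit J e lam \<rho> j \<le> K"
proof (rule boosted_deficit_le_of_last_le_first[OF assms(1,2)])
  have "first_weight J e \<rho> j = weight J e j"
    unfolding first_weight_eq weight_def by (rule sum.cong) (use assms(3) in \<open>auto simp: types_def\<close>)
  then show "last_weight J e \<rho> j \<le> first_weight J e \<rho> j" using last_add_first_le[OF assms(1,2)] by simp
qed

text \<open>Where boosting is not allowed, a new type has exponent above \<open>N\<close> and there is no deficit anyway.\<close>

lemma deficit_boost_le:
  assumes inj: "inj_on \<rho> J" "j \<in> J"
  shows "deficit J e lam \<rho> {i. \<forall>I\<in>first_types J \<rho> i. e I \<le> N} j \<le> boosted_deficit J e lam \<rho> j"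
proof (cases "\<forall>I\<in>first_types J \<rho> j. e I \<le> N")
  case True
  then show ?thesis unfolding deficit_def boosted_deficit_def by simp
next
  case False
  then obtain I where I: "I \<in> first_types J \<rho> j" "N < e I" by (auto simp: not_le)
  have "finite (first_types J \<rho> j)" unfolding first_types_def by (rule finT)
  then have "e I \<le> first_weight J e \<rho> j" unfolding first_weight_def using I by (intro member_le_sum) auto
  then have "lam j \<le> weight J e j - last_weight J e \<rho> j"
    using I last_add_first_le[OF inj] lam_le[OF inj(2)] by linarith
  then show ?thesis unfolding deficit_def by simp
qed

text \<open>At each index the deficits of the two directions add up to at most \<open>N + K\<close>:
  if both are positive, their sum is at most \<open>2 * lam j - weight J e j\<close>. One direction
  is no worse than the average. As nothing is boosted, no divisor function appears.\<close>

lemma exists_order_half: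
  "\<exists>\<rho>. inj_on \<rho> J \<and> 2 * (\<Sum>j\<in>J. deficit J e lam \<rho> {} j) \<le> card J * (N + K)"
proof -
  define \<rho> where "\<rho> = int"
  have inj: "inj_on \<rho> J" "inj_on (\<lambda>i. - \<rho> i) J" by (auto simp: inj_on_def \<rho>_def)
  have "(\<Sum>j\<in>J. deficit J e lam \<rho> {} j) + (\<Sum>j\<in>J. deficit J e lam (\<lambda>i. - \<rho> i) {} j) \<le> (\<Sum>j\<in>J. N + K)"
    unfolding sum.distrib[symmetric]
  proof (rule sum_mono)
    fix j assume j: "j \<in> J"
    show "deficit J e lam \<rho> {} j + deficit J e lam (\<lambda>i. - \<rho> i) {} j \<le> N + K"
      using last_add_first_le[OF inj(1) j] lam_le_weight[OF j] lam_le[OF j]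
      unfolding deficit_def last_weight_uminus by simp
  qed
  then have "2 * (\<Sum>j\<in>J. deficit J e lam \<rho> {} j) \<le> card J * (N + K) \<or>
     2 * (\<Sum>j\<in>J. deficit J e lam (\<lambda>i. - \<rho> i) {} j) \<le> card J * (N + K)" by simp linarith
  then show ?thesis using inj by blast
qed

text \<open>Every inner element is bad in at most one of the two directions, and an odd number of inner elements
  leaves strictly less than half of them bad in the better direction.\<close>

lemma few_bad_in_one_direction:
  assumes "inj_on \<rho> J" "X \<subseteq> J" "odd (card X)"
  obtains \<sigma> where "\<sigma> = \<rho> \<or> \<sigma> = (\<lambda>i. - \<rho> i)"
    "(\<Sum>j\<in>X. boosted_deficit J e lam \<sigma> j) \<le> (card X div 2) * N + card X * K"
proof -
  have finX: "finite X" using assms(2) finite_J finite_subset by blast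
  define bad where "bad = (\<lambda>\<sigma>. {j \<in> X. \<not> boosted_deficit J e lam \<sigma> j \<le> K})"
  have le: "(\<Sum>j\<in>X. boosted_deficit J e lam \<sigma> j) \<le> card (bad \<sigma>) * N + card X * K" for \<sigma>
  proof -
    have "(\<Sum>j\<in>X. boosted_deficit J e lam \<sigma> j) \<le> (\<Sum>j\<in>X. (if j \<in> bad \<sigma> then N else 0) + K)"
    proof (rule sum_mono)
      fix j assume "j \<in> X"
      then show "boosted_deficit J e lam \<sigma> j \<le> (if j \<in> bad \<sigma> then N else 0) + K"
        using boosted_deficit_le_N[of j \<sigma>] assms(2) unfolding bad_def by auto
    qed
    also have "\<dots> = card (bad \<sigma>) * N + card X * K"
    proof -
      have "X \<inter> bad \<sigma> = bad \<sigma>" by (auto simp: bad_def)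
      then show ?thesis using finX by (simp add: sum.distrib sum.If_cases)
    qed
    finally show ?thesis .
  qed
  have "bad \<rho> \<inter> bad (\<lambda>i. - \<rho> i) = {}" using good_in_one_direction[OF assms(1)] assms(2) by (auto simp: bad_def)
  moreover have fb: "finite (bad \<sigma>)" for \<sigma> using finX by (simp add: bad_def)
  ultimately have "card (bad \<rho>) + card (bad (\<lambda>i. - \<rho> i)) = card (bad \<rho> \<union> bad (\<lambda>i. - \<rho> i))"
    by (simp add: card_Un_disjoint)
  also have "\<dots> \<le> card X" by (rule card_mono[OF finX]) (auto simp: bad_def)
  finally have "card (bad \<rho>) \<le> card X div 2 \<or> card (bad (\<lambda>i. - \<rho> i)) \<le> card X div 2" using assms(3) by presburger
  then obtain \<sigma> where \<sigma>: "\<sigma> = \<rho> \<or> \<sigma> = (\<lambda>i. - \<rho> i)" "card (bad \<sigma>) \<le> card X div 2" by blast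
  have "(\<Sum>j\<in>X. boosted_deficit J e lam \<sigma> j) \<le> (card X div 2) * N + card X * K"
  proof -
    have "card (bad \<sigma>) * N \<le> (card X div 2) * N" by (rule mult_right_mono[OF \<sigma>(2)]) simp
    then show ?thesis using le[of \<sigma>] by linarith
  qed
  then show ?thesis using that \<sigma>(1) by blast
qed

text \<open>With \<open>u\<close> first and \<open>v\<close> last, in either direction one end costs
  at most \<open>K\<close> and the other at most \<open>N - s\<close>. The inner indices, k - 2 in
  number, cost (k - 3)/2 times \<open>N\<close> up to bounded terms in the better direction.\<close>

lemma exists_order_two_small:
  assumes J: "odd (card J)" and u: "u \<in> J" "v \<in> J" "u \<noteq> v" and s: "lam u + s \<le> N" "lam v + s \<le> N"
  shows "\<exists>\<rho>. inj_on \<rho> J \<and> (\<Sum>j\<in>J. boosted_deficit J e lam \<rho> j) + s \<le> (card J div 2) * N + card J * K"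
proof -
  define \<rho> where "\<rho> = (\<lambda>i. if i = u then - 1 else if i = v then int (Max J) + 1 else int i)"
  have le_Max: "i \<le> Max J" if "i \<in> J" for i using that finite_J by simp
  have inj: "inj_on \<rho> J" "inj_on (\<lambda>i. - \<rho> i) J"
    using le_Max by (force simp: inj_on_def \<rho>_def)+
  have mm: "\<rho> u \<le> \<rho> i" "\<rho> i \<le> \<rho> v" if "i \<in> J" for i
    using le_Max[OF that] u by (auto simp: \<rho>_def)
  define X where "X = J - {u, v}"
  have cX: "card X = card J - 2" unfolding X_def using u finite_J by (simp add: card_Diff_subset)
  have c2: "card J \<ge> 3"
  proof -
    have "card {u, v} \<le> card J" using u finite_J by (intro card_mono) auto
    then show ?thesis using J u(3) by (cases "card J = 2") auto
  qed
  have oX: "odd (card X)" using cX J c2 by simp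
  have split: "(\<Sum>j\<in>J. f j) = f u + f v + (\<Sum>j\<in>X. f j)" for f :: "nat \<Rightarrow> nat"
  proof -
    have "(\<Sum>j\<in>J. f j) = (\<Sum>j\<in>X. f j) + (\<Sum>j\<in>{u, v}. f j)"
      unfolding X_def by (rule sum.subset_diff) (use u finite_J in auto)
    then show ?thesis using u(3) by simp
  qed
  obtain \<sigma> where \<sigma>: "\<sigma> = \<rho> \<or> \<sigma> = (\<lambda>i. - \<rho> i)"
    "(\<Sum>j\<in>X. boosted_deficit J e lam \<sigma> j) \<le> (card X div 2) * N + card X * K"
    using few_bad_in_one_direction[OF inj(1) _ oX] unfolding X_def by blast
  have "boosted_deficit J e lam \<sigma> u \<le> K \<and> boosted_deficit J e lam \<sigma> v + s \<le> N \<or>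
    boosted_deficit J e lam \<sigma> v \<le> K \<and> boosted_deficit J e lam \<sigma> u + s \<le> N"
    using \<sigma>(1)
  proof
    assume "\<sigma> = \<rho>"
    then show ?thesis using boosted_deficit_first_le[OF inj(1) u(1) mm(1)] boosted_deficit_le_lam[of \<rho> v] s by auto
  next
    assume "\<sigma> = (\<lambda>i. - \<rho> i)"
    then show ?thesis using boosted_deficit_first_le[OF inj(2) u(2)] mm(2) boosted_deficit_le_lam[of "\<lambda>i. - \<rho> i" u] s by auto
  qed
  then have "(\<Sum>j\<in>J. boosted_deficit J e lam \<sigma> j) + s \<le> K + N + ((card X div 2) * N + card X * K)"
    unfolding split using \<sigma>(2) by linarith
  also have "\<dots> = (card X div 2 + 1) * N + (card X + 1) * K" by (simp add: algebra_simps)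
  also have "\<dots> \<le> (card J div 2) * N + card J * K"
    by (intro add_mono mult_right_mono) (use cX c2 in auto)
  finally show ?thesis using \<sigma>(1) inj by blast
qed

end

text \<open>A graph in which any two edges meet is a star or a triangle. With at least four
  vertices, connectedness supplies an edge leaving the triangle, and it misses the opposite
  side.\<close>

lemma disjoint_pairs_or_star:
  fixes R :: "nat \<Rightarrow> nat \<Rightarrow> bool"
  assumes J: "4 \<le> card J"
    and R: "\<And>x y. R x y \<Longrightarrow> R y x" "\<And>x y. R x y \<Longrightarrow> x \<in> J \<and> y \<in> J \<and> x \<noteq> y"
    and conn: "\<And>T. T \<subseteq> J \<Longrightarrow> T \<noteq> {} \<Longrightarrow> T \<noteq> J \<Longrightarrow> \<exists>x\<in>T. \<exists>y\<in>J - T. R x y"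
  shows "(\<exists>a b c d. distinct [a, b, c, d] \<and> R a b \<and> R c d) \<or> (\<exists>z\<in>J. \<forall>x y. R x y \<longrightarrow> x = z \<or> y = z)"
proof (rule ccontr)
  assume neg: "\<not> ?thesis"
  have fin: "finite J" using J by (metis card.infinite not_numeral_le_zero)
  have meet: "x = a \<or> x = b \<or> y = a \<or> y = b" if "R a b" "R x y" for a b x y
    using neg that R(2)[OF that(1)] R(2)[OF that(2)] by auto
  have nostar: "\<exists>x y. R x y \<and> x \<noteq> z \<and> y \<noteq> z" if "z \<in> J" for z using neg that by blast
  obtain x0 where x0: "x0 \<in> J" using J by fastforce
  obtain a b where ab: "R a b" using nostar[OF x0] by blast
  obtain x y where xy: "R x y" "x \<noteq> a" "y \<noteq> a" using nostar R(2)[OF ab] by blast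
  obtain c where c: "R b c" "c \<noteq> a" using meet[OF ab xy(1)] xy R(1) by blast
  obtain x' y' where xy': "R x' y'" "x' \<noteq> b" "y' \<noteq> b" using nostar R(2)[OF ab] by blast
  have ac: "R a c" using meet[OF ab xy'(1)] meet[OF c(1) xy'(1)] xy' c R by metis
  have T: "{a, b, c} \<subseteq> J" using R(2) ab c by blast
  have "card {a, b, c} \<le> 3" by (simp add: card_insert_if)
  then have "{a, b, c} \<noteq> J" using J by auto
  then obtain p r where pr: "p \<in> {a, b, c}" "r \<in> J - {a, b, c}" "R p r" using conn[OF T] by blast
  show False
    using pr meet[OF ab pr(3)] meet[OF c(1) pr(3)] meet[OF ac pr(3)] R(2)[OF ab] R(2)[OF c(1)] R(2)[OF ac] by auto
qed

section \<open>Orders for two disjoint heavy pairs, for a star and for three indices\<close>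

context cell_exponents begin

definition pair_weight :: "nat \<Rightarrow> nat \<Rightarrow> nat" where
  "pair_weight x y = (\<Sum>I\<in>{I \<in> types J. x \<in> I \<and> y \<in> I}. e I)"

definition out_weight :: "nat \<Rightarrow> nat \<Rightarrow> nat" where
  "out_weight x y = (\<Sum>I\<in>{I \<in> types J. x \<in> I \<and> y \<notin> I}. e I)"

lemma weight_split: "weight J e x = pair_weight x y + out_weight x y"
proof -
  have eq: "{I \<in> types J. x \<in> I} = {I \<in> types J. x \<in> I \<and> y \<in> I} \<union> {I \<in> types J. x \<in> I \<and> y \<notin> I}" by auto
  show ?thesis unfolding weight_def pair_weight_def out_weight_def eq
    by (rule sum.union_disjoint[OF finT finT]) auto
qed

lemma pair_weight_commute: "pair_weight x y = pair_weight y x"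
  unfolding pair_weight_def by (simp add: conj_commute)

text \<open>The right side counts every type that meets \<open>{a, b}\<close>. The type
  \<open>{a, b}\<close> itself does not cross the cut, so it can be added on the left.\<close>

lemma cut_pair_le:
  assumes "a \<noteq> b" "a \<in> J" "b \<in> J"
  shows "cut_weight J e {a, b} + e {a, b} \<le> pair_weight a b + out_weight a b + out_weight b a"
proof -
  let ?P = "{I \<in> types J. a \<in> I \<and> b \<in> I}" and ?A = "{I \<in> types J. a \<in> I \<and> b \<notin> I}" and ?B = "{I \<in> types J. b \<in> I \<and> a \<notin> I}"
  let ?C = "{I \<in> types J. I \<inter> {a, b} \<noteq> {} \<and> \<not> I \<subseteq> {a, b}}"
  have ty: "{a, b} \<in> types J" using assms by (simp add: types_def)
  have "cut_weight J e {a, b} + e {a, b} = (\<Sum>I\<in>insert {a, b} ?C. e I)"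
    unfolding cut_weight_def by (subst sum.insert[OF finT]) auto
  also have "\<dots> \<le> (\<Sum>I\<in>?P \<union> ?A \<union> ?B. e I)"
    by (rule sum_mono2) (use finite_types[OF finite_J] ty in auto)
  also have "\<dots> \<le> pair_weight a b + out_weight a b + out_weight b a"
  proof -
    have "(\<Sum>I\<in>?P \<union> ?A \<union> ?B. e I) = (\<Sum>I\<in>?P \<union> ?A. e I) + (\<Sum>I\<in>?B. e I)"
      by (rule sum.union_disjoint) (use finite_types[OF finite_J] in auto)
    moreover have "(\<Sum>I\<in>?P \<union> ?A. e I) = (\<Sum>I\<in>?P. e I) + (\<Sum>I\<in>?A. e I)"
      by (rule sum.union_disjoint) (use finite_types[OF finite_J] in auto)
    ultimately show ?thesis unfolding pair_weight_def out_weight_def by simp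
  qed
  finally show ?thesis .
qed

text \<open>
  The cut condition for \<open>{a, b}\<close> bounds the deficit at the second index, provided that the first two indices
  are put in the right order.
\<close>

lemma boosted_deficit_second_le:
  assumes inj: "inj_on \<rho> J" and ab: "a \<in> J" "b \<in> J" "\<rho> a < \<rho> b" "\<And>i. i \<in> J \<Longrightarrow> i \<noteq> a \<Longrightarrow> i \<noteq> b \<Longrightarrow> \<rho> b < \<rho> i"
    and out: "out_weight a b \<le> out_weight b a" and cut: "N \<le> cut_weight J e {a, b} + t"
  shows "boosted_deficit J e lam \<rho> b \<le> t"
proof -
  have ne: "a \<noteq> b" using ab(3) by auto
  have "last_weight J e \<rho> b \<le> (\<Sum>I\<in>{{a, b}}. e I)"
    unfolding last_weight_eq
  proof (rule sum_mono2)
    show "{I \<in> types J. b \<in> I \<and> (\<forall>i\<in>I. \<rho> i \<le> \<rho> b)} \<subseteq> {{a, b}}"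
    proof
      fix I assume I: "I \<in> {I \<in> types J. b \<in> I \<and> (\<forall>i\<in>I. \<rho> i \<le> \<rho> b)}"
      then have sub: "I \<subseteq> {a, b}" using ab(4) by (force simp: types_def)
      have "card {a, b} \<le> card I" using I ne by (simp add: types_def)
      then show "I \<in> {{a, b}}" using card_seteq[OF _ sub] by auto
    qed
  qed auto
  moreover have "out_weight b a \<le> first_weight J e \<rho> b"
    unfolding out_weight_def first_weight_eq
  proof (rule sum_mono2[OF finT])
    show "{I \<in> types J. b \<in> I \<and> a \<notin> I} \<subseteq> {I \<in> types J. b \<in> I \<and> (\<forall>i\<in>I. \<rho> b \<le> \<rho> i)}"
      using ab(4) by (force simp: types_def)
  qed simp
  moreover note last_add_first_le[OF inj ab(2)] cut_pair_le[OF ne ab(1,2)] weight_split[of b a]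
    pair_weight_commute[of a b] out cut lam_le[OF ab(2)]
  ultimately show ?thesis unfolding boosted_deficit_def by simp
qed

text \<open>A type that also contains the later index \<open>d\<close> does not end at
  \<open>c\<close>, so its weight is not subtracted.\<close>

lemma boosted_deficit_before_le:
  assumes inj: "inj_on \<rho> J" and cd: "c \<in> J" "d \<in> J" "\<rho> c < \<rho> d"
  shows "boosted_deficit J e lam \<rho> c \<le> lam c - pair_weight c d"
proof -
  have "last_weight J e \<rho> c \<le> out_weight c d"
    unfolding out_weight_def last_weight_eq by (rule sum_mono2[OF finT]) (use cd(3) in auto)
  then show ?thesis
    using weight_split[of c d] unfolding boosted_deficit_def by simp
qed

text \<open>The pairs occupy the two ends of the order, each oriented by its out-weights. In either
  direction the leading pair costs at most \<open>K + t\<close> and the trailing pair at most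
  \<open>2 * N - h\<close>, while the k - 4 inner indices cost (k - 5)/2 times \<open>N\<close> up
  to bounded terms in the better direction.\<close>

lemma exists_order_disjoint_pairs:
  assumes J: "odd (card J)" and d: "distinct [a, b, c, d]" "{a, b, c, d} \<subseteq> J"
    and h: "h \<le> pair_weight a b" "h \<le> pair_weight c d" "h \<le> N"
    and cut: "N \<le> cut_weight J e {a, b} + t" "N \<le> cut_weight J e {c, d} + t"
  shows "\<exists>\<rho>. inj_on \<rho> J \<and> (\<Sum>j\<in>J. boosted_deficit J e lam \<rho> j) + h \<le> (card J div 2) * N + card J * K + t"
proof -
  have "\<exists>\<rho>. inj_on \<rho> J \<and> (\<Sum>j\<in>J. boosted_deficit J e lam \<rho> j) + h \<le> (card J div 2) * N + card J * K + t"
    if d: "distinct [a, b, c, d]" "{a, b, c, d} \<subseteq> J"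
      and h: "h \<le> pair_weight a b" "h \<le> pair_weight c d"
      and cut: "N \<le> cut_weight J e {a, b} + t" "N \<le> cut_weight J e {c, d} + t"
      and out: "out_weight a b \<le> out_weight b a" "out_weight d c \<le> out_weight c d" for a b c d
  proof -
    define \<rho> where "\<rho> = (\<lambda>i. if i = a then - 2 else if i = b then - 1 else
      if i = c then int (Max J) + 1 else if i = d then int (Max J) + 2 else int i)"
    have le_Max: "int i \<le> int (Max J)" if "i \<in> J" for i using that finite_J by simp
    have dd: "a \<noteq> b" "a \<noteq> c" "a \<noteq> d" "b \<noteq> c" "b \<noteq> d" "c \<noteq> d" using d by auto
    have m: "a \<in> J" "b \<in> J" "c \<in> J" "d \<in> J" using d by auto
    have inj: "inj_on \<rho> J"
    proof (rule inj_onI)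
      fix x y assume "x \<in> J" "y \<in> J" "\<rho> x = \<rho> y"
      then show "x = y" using le_Max[of x] le_Max[of y] unfolding \<rho>_def by (simp split: if_splits)
    qed
    then have inj': "inj_on (\<lambda>i. - \<rho> i) J" by (auto simp: inj_on_def)
    have v: "\<rho> a = - 2" "\<rho> b = - 1" "\<rho> c = int (Max J) + 1" "\<rho> d = int (Max J) + 2" using dd by (auto simp: \<rho>_def)
    have o: "0 \<le> \<rho> i \<and> \<rho> i \<le> int (Max J)" if "i \<in> J" "i \<notin> {a, b, c, d}" for i
      using that le_Max[of i] by (auto simp: \<rho>_def)
    have ord: "\<rho> a \<le> \<rho> i" "\<rho> i \<le> \<rho> d" "i \<noteq> a \<Longrightarrow> i \<noteq> b \<Longrightarrow> \<rho> b < \<rho> i" "i \<noteq> c \<Longrightarrow> i \<noteq> d \<Longrightarrow> \<rho> i < \<rho> c" if "i \<in> J" for i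
      using o[OF that] v by (cases "i \<in> {a, b, c, d}"; auto)+
    define X where "X = J - {a, b, c, d}"
    have c4: "card {a, b, c, d} = 4" using dd by simp
    have cX: "card X = card J - 4" unfolding X_def using m c4 finite_J by (subst card_Diff_subset) auto
    have "card {a, b, c, d} \<le> card J" using m finite_J by (intro card_mono) auto
    then have c5: "5 \<le> card J" using J c4 by (cases "card J = 4") auto
    have oX: "odd (card X)" using cX J c5 by simp
    have split: "(\<Sum>j\<in>J. f j) = f a + f b + f c + f d + (\<Sum>j\<in>X. f j)" for f :: "nat \<Rightarrow> nat"
    proof -
      have "(\<Sum>j\<in>J. f j) = (\<Sum>j\<in>X. f j) + (\<Sum>j\<in>{a, b, c, d}. f j)"
        unfolding X_def by (rule sum.subset_diff) (use m finite_J in auto)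
      then show ?thesis using dd by simp
    qed
    obtain \<sigma> where \<sigma>: "\<sigma> = \<rho> \<or> \<sigma> = (\<lambda>i. - \<rho> i)"
      "(\<Sum>j\<in>X. boosted_deficit J e lam \<sigma> j) \<le> (card X div 2) * N + card X * K"
      using few_bad_in_one_direction[OF inj(1) _ oX] unfolding X_def by blast
    have four: "boosted_deficit J e lam \<sigma> a + boosted_deficit J e lam \<sigma> b + boosted_deficit J e lam \<sigma> c
      + boosted_deficit J e lam \<sigma> d + h \<le> 2 * N + K + t"
      using \<sigma>(1)
    proof
      assume s: "\<sigma> = \<rho>"
      have "boosted_deficit J e lam \<rho> a \<le> K" by (rule boosted_deficit_first_le[OF inj m(1) ord(1)])
      moreover have "boosted_deficit J e lam \<rho> b \<le> t"
        by (rule boosted_deficit_second_le[OF inj m(1,2) _ ord(3) out(1) cut(1)]) (use v in auto)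
      moreover have "boosted_deficit J e lam \<rho> c \<le> lam c - pair_weight c d"
        by (rule boosted_deficit_before_le[OF inj m(3,4)]) (use v in auto)
      moreover have "boosted_deficit J e lam \<rho> d \<le> N" by (rule boosted_deficit_le_N[OF m(4)])
      ultimately show ?thesis using lam_le[OF m(3)] h \<open>h \<le> N\<close> unfolding s by linarith
    next
      assume s: "\<sigma> = (\<lambda>i. - \<rho> i)"
      have "boosted_deficit J e lam \<sigma> d \<le> K"
        unfolding s by (rule boosted_deficit_first_le[OF inj' m(4)]) (use ord(2) in simp)
      moreover have "boosted_deficit J e lam \<sigma> c \<le> t"
        unfolding s
      proof (rule boosted_deficit_second_le[OF inj' m(4,3) _ _ out(2)])
        show "- \<rho> d < - \<rho> c" using v by simp
        show "N \<le> cut_weight J e {d, c} + t" using cut(2) by (simp add: insert_commute)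
        show "- \<rho> c < - \<rho> i" if "i \<in> J" "i \<noteq> d" "i \<noteq> c" for i using ord(4) that by simp
      qed
      moreover have "boosted_deficit J e lam \<sigma> b \<le> lam b - pair_weight b a"
        unfolding s by (rule boosted_deficit_before_le[OF inj' m(2,1)]) (use v in auto)
      moreover have "boosted_deficit J e lam \<sigma> a \<le> N" by (rule boosted_deficit_le_N[OF m(1)])
      ultimately show ?thesis using lam_le[OF m(2)] h \<open>h \<le> N\<close> pair_weight_commute[of a b] by linarith
    qed
    have "(\<Sum>j\<in>J. boosted_deficit J e lam \<sigma> j) + h \<le> 2 * N + K + t + ((card X div 2) * N + card X * K)"
      unfolding split using four \<sigma>(2) by linarith
    also have "\<dots> = (card X div 2 + 2) * N + (card X + 1) * K + t" by (simp add: algebra_simps)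
    also have "\<dots> \<le> (card J div 2) * N + card J * K + t"
      by (intro add_mono mult_right_mono order_refl) (use cX c5 in auto)
    finally show ?thesis using \<sigma>(1) inj inj' by blast
  qed note core = this
  have sw: "{b, a} = {a, b}" "{d, c} = {c, d}" "pair_weight b a = pair_weight a b" "pair_weight d c = pair_weight c d"
    by (auto intro: pair_weight_commute)
  have d': "distinct [b, a, c, d]" "distinct [a, b, d, c]" "distinct [b, a, d, c]"
    "{b, a, c, d} \<subseteq> J" "{a, b, d, c} \<subseteq> J" "{b, a, d, c} \<subseteq> J" using d by auto
  consider "out_weight a b \<le> out_weight b a" "out_weight d c \<le> out_weight c d"
    | "out_weight a b \<le> out_weight b a" "out_weight c d \<le> out_weight d c"
    | "out_weight b a \<le> out_weight a b" "out_weight d c \<le> out_weight c d"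
    | "out_weight b a \<le> out_weight a b" "out_weight c d \<le> out_weight d c" by linarith
  then show ?thesis
  proof cases
    case 1
    show ?thesis by (rule core[OF d h(1,2) cut 1])
  next
    case 2
    show ?thesis by (rule core[OF d'(2,5) _ _ _ _ 2]) (simp_all only: sw h cut)
  next
    case 3
    show ?thesis by (rule core[OF d'(1,4) _ _ _ _ 3]) (simp_all only: sw h cut)
  next
    case 4
    show ?thesis by (rule core[OF d'(3,6) _ _ _ _ 4]) (simp_all only: sw h cut)
  qed
qed

text \<open>All leaves but one come first, then the centre \<open>z\<close>, then a leaf
  \<open>l\<close> other than \<open>u\<close>. A leaf before \<open>z\<close> has almost its whole
  weight in types shared with \<open>z\<close>; and \<open>z\<close> shares with \<open>l\<close>
  almost the whole weight of \<open>l\<close>, which is at least nearly \<open>N\<close>. Only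
  \<open>l\<close> itself costs \<open>N\<close>.\<close>

lemma exists_order_star:
  assumes J: "5 \<le> card J" and z: "z \<in> J"
    and light: "\<And>I. I \<in> types J \<Longrightarrow> (\<nexists>l. I = {z, l}) \<Longrightarrow> e I < h"
    and lam: "\<And>j. j \<in> J \<Longrightarrow> j \<noteq> u \<Longrightarrow> N \<le> lam j + s"
  shows "\<exists>\<rho>. inj_on \<rho> J \<and> (\<Sum>j\<in>J. boosted_deficit J e lam \<rho> j) \<le> N + card J * (K + 2 ^ card J * h) + s"
proof -
  define W where "W = 2 ^ card J * h"
  have "\<exists>l. l \<in> J - {z, u}"
  proof (rule ccontr)
    assume "\<not> ?thesis"
    then have "card J \<le> card {z, u}" by (intro card_mono) auto
    also have "\<dots> \<le> 2" by (simp add: card_insert_if)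
    finally show False using J by simp
  qed
  then obtain l where l: "l \<in> J" "l \<noteq> z" "l \<noteq> u" by auto
  define \<rho> where "\<rho> = (\<lambda>i. if i = z then int (Max J) + 1 else if i = l then int (Max J) + 2 else int i)"
  have le_Max: "int i \<le> int (Max J)" if "i \<in> J" for i using that finite_J by simp
  have inj: "inj_on \<rho> J"
  proof (rule inj_onI)
    fix x y assume "x \<in> J" "y \<in> J" "\<rho> x = \<rho> y"
    then show "x = y" using le_Max[of x] le_Max[of y] unfolding \<rho>_def by (simp split: if_splits)
  qed
  have lt: "\<rho> i < \<rho> z" if "i \<in> J" "i \<noteq> z" "i \<noteq> l" for i using that le_Max[of i] l by (auto simp: \<rho>_def)
  have zl: "\<rho> z < \<rho> l" using l by (auto simp: \<rho>_def)
  have pw: "weight J e i \<le> pair_weight i z + W" if i: "i \<in> J" "i \<noteq> z" for i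
  proof -
    have "out_weight i z \<le> (\<Sum>I\<in>{I \<in> types J. i \<in> I \<and> z \<notin> I}. h)"
      unfolding out_weight_def
    proof (rule sum_mono)
      fix I assume "I \<in> {I \<in> types J. i \<in> I \<and> z \<notin> I}"
      then have "I \<in> types J" "\<nexists>l. I = {z, l}" by auto
      then show "e I \<le> h" using light less_imp_le by blast
    qed
    also have "\<dots> = card {I \<in> types J. i \<in> I \<and> z \<notin> I} * h" by simp
    also have "\<dots> \<le> card (types J) * h" by (intro mult_right_mono card_mono finite_types finite_J) auto
    also have "\<dots> \<le> W" unfolding W_def by (intro mult_right_mono card_types_le finite_J) auto
    finally show ?thesis using weight_split[of i z] by simp
  qed
  have leaf: "boosted_deficit J e lam \<rho> i \<le> K + W" if i: "i \<in> J" "i \<noteq> z" "i \<noteq> l" for i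
    using boosted_deficit_before_le[OF inj i(1) z lt[OF i]] pw[OF i(1,2)] lam_le_weight[OF i(1)] by linarith
  have centre: "boosted_deficit J e lam \<rho> z \<le> K + W + s"
    using boosted_deficit_before_le[OF inj z l(1) zl] pw[OF l(1,2)] lam_le_weight[OF l(1)] lam[OF l(1,3)] lam_le[OF z]
      pair_weight_commute[of l z] by linarith
  have "(\<Sum>j\<in>J. boosted_deficit J e lam \<rho> j) \<le> (\<Sum>j\<in>J. (K + W) + (if j = z then s else 0) + (if j = l then N else 0))"
  proof (rule sum_mono)
    fix j assume j: "j \<in> J"
    show "boosted_deficit J e lam \<rho> j \<le> (K + W) + (if j = z then s else 0) + (if j = l then N else 0)"
      using leaf[OF j] centre boosted_deficit_le_N[OF j, of \<rho>] l by auto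
  qed
  also have "\<dots> = N + card J * (K + W) + s" using z l finite_J by (simp add: sum.distrib)
  finally show ?thesis using inj unfolding W_def by blast
qed

text \<open>Two indices with \<open>lam\<close> at most \<open>N - s\<close> supply the saving
  directly. Otherwise types of total weight nearly \<open>N\<close> cross every proper nonempty
  subset, so the heavy types connect \<open>J\<close>.\<close>

theorem exists_order_irreducible:
  assumes J: "odd (card J)" "5 \<le> card J" and s: "1 \<le> s" "12 * 2 ^ card J * card J * s \<le> N"
    and cut: "\<And>T m. T \<subseteq> J \<Longrightarrow> T \<noteq> {} \<Longrightarrow> T \<noteq> J \<Longrightarrow> (\<And>j. j \<in> T \<Longrightarrow> m \<le> lam j) \<Longrightarrow> m \<le> cut_weight J e T + s"
  shows "\<exists>\<rho>. inj_on \<rho> J \<and> (\<Sum>j\<in>J. boosted_deficit J e lam \<rho> j) + s \<le> (card J div 2) * N + card J * K"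
proof (cases "\<exists>u\<in>J. \<exists>v\<in>J. u \<noteq> v \<and> lam u + s \<le> N \<and> lam v + s \<le> N")
  case True
  then show ?thesis using exists_order_two_small[OF J(1)] by blast
next
  case False
  obtain j0 where j0: "j0 \<in> J" using J by fastforce
  obtain u where u: "u \<in> J" "\<And>j. j \<in> J \<Longrightarrow> j \<noteq> u \<Longrightarrow> N \<le> lam j + s"
  proof (cases "\<exists>u\<in>J. lam u + s \<le> N")
    case True
    then obtain u where "u \<in> J" "lam u + s \<le> N" by blast
    then show ?thesis using that[of u] False by (metis nat_le_linear)
  next
    case False
    then show ?thesis using that[OF j0] by (metis nat_le_linear)
  qed
  \<comment> \<open>Two disjoint pairs gain \<open>h\<close> and lose \<open>2 * s\<close> through
    the cut condition, so \<open>4 * s\<close> leaves at least the required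
    \<open>s\<close>.\<close>
  define h where "h = 4 * s"
  have big: "2 ^ card J * h + 2 * s < N" "h \<le> N" "2 * s + card J * (2 ^ card J * h) \<le> N"
  proof -
    have k: "1 \<le> card J" "(1::nat) \<le> 2 ^ card J" using J by auto
    define P where "P = 2 ^ card J * (card J * s)"
    have 1: "2 ^ card J * s \<le> P" unfolding P_def using k by (intro mult_left_mono) auto
    have 2: "s \<le> 2 ^ card J * s" by simp
    have N: "12 * P \<le> N" using s(2) unfolding P_def by (simp add: mult.assoc)
    have e: "2 ^ card J * h = 4 * (2 ^ card J * s)" "card J * (2 ^ card J * h) = 4 * P" by (simp_all add: h_def P_def)
    show "2 ^ card J * h + 2 * s < N" "h \<le> N" "2 * s + card J * (2 ^ card J * h) \<le> N"
      using e h_def 1 2 N s(1) by linarith+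
  qed
  \<comment> \<open>One of \<open>T\<close> and its complement avoids \<open>u\<close>, and both
    have the same cut.\<close>
  have cut': "N \<le> cut_weight J e T + 2 * s" if T: "T \<subseteq> J" "T \<noteq> {}" "T \<noteq> J" for T
  proof (cases "u \<in> T")
    case False
    then have "N - s \<le> lam j" if "j \<in> T" for j using u(2)[of j] that T(1) by fastforce
    then show ?thesis using cut[OF T, of "N - s"] by simp
  next
    case True
    have "N - s \<le> lam j" if "j \<in> J - T" for j using u(2)[of j] that True by fastforce
    then have "N - s \<le> cut_weight J e (J - T) + s" using cut[of "J - T"] T by blast
    moreover have "cut_weight J e (J - T) = cut_weight J e T"
      unfolding cut_weight_def by (rule sum.cong) (auto simp: types_def)
    ultimately show ?thesis by simp
  qed
  define R where "R = (\<lambda>x y. x \<in> J \<and> y \<in> J \<and> x \<noteq> y \<and> (\<exists>I\<in>types J. x \<in> I \<and> y \<in> I \<and> h \<le> e I))"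
  have R_pair: "h \<le> pair_weight x y" if R: "R x y" for x y
  proof -
    obtain I where I: "I \<in> types J" "x \<in> I" "y \<in> I" "h \<le> e I" using R by (auto simp: R_def)
    then have "e I \<le> pair_weight x y" unfolding pair_weight_def by (intro member_le_sum finT) auto
    then show ?thesis using I by simp
  qed
  have conn: "\<exists>x\<in>T. \<exists>y\<in>J - T. R x y" if T: "T \<subseteq> J" "T \<noteq> {}" "T \<noteq> J" for T
  proof -
    have "\<exists>I\<in>{I \<in> types J. I \<inter> T \<noteq> {} \<and> \<not> I \<subseteq> T}. h \<le> e I"
    proof (rule ccontr)
      assume "\<not> ?thesis"
      then have "cut_weight J e T \<le> (\<Sum>I\<in>{I \<in> types J. I \<inter> T \<noteq> {} \<and> \<not> I \<subseteq> T}. h)"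
        unfolding cut_weight_def by (intro sum_mono) (meson nat_le_linear)
      also have "\<dots> = card {I \<in> types J. I \<inter> T \<noteq> {} \<and> \<not> I \<subseteq> T} * h" by simp
      also have "\<dots> \<le> card (types J) * h" by (intro mult_right_mono card_mono finite_types finite_J) auto
      also have "\<dots> \<le> 2 ^ card J * h" by (intro mult_right_mono card_types_le finite_J) auto
      finally show False using cut'[OF T] big(1) by linarith
    qed
    then obtain I where I: "I \<in> types J" "I \<inter> T \<noteq> {}" "\<not> I \<subseteq> T" "h \<le> e I" by blast
    then obtain x y where "x \<in> I" "x \<in> T" "y \<in> I" "y \<notin> T" by blast
    moreover have "I \<subseteq> J" using I by (simp add: types_def)
    ultimately show ?thesis using I unfolding R_def by blast
  qed
  have alt: "(\<exists>a b c d. distinct [a, b, c, d] \<and> R a b \<and> R c d) \<or> (\<exists>z\<in>J. \<forall>x y. R x y \<longrightarrow> x = z \<or> y = z)"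
    by (rule disjoint_pairs_or_star) (use J conn in \<open>auto simp: R_def\<close>)
  then show ?thesis
  proof
    assume "\<exists>a b c d. distinct [a, b, c, d] \<and> R a b \<and> R c d"
    then obtain a b c d where d: "distinct [a, b, c, d]" "R a b" "R c d" by blast
    have sub: "{a, b, c, d} \<subseteq> J" using d by (auto simp: R_def)
    have small: "{x, y} \<noteq> J" for x y
    proof
      assume "{x, y} = J"
      then have "card J \<le> 2" using card_insert_if[of "{y}" x] by auto
      then show False using J by simp
    qed
    have "N \<le> cut_weight J e {a, b} + 2 * s" "N \<le> cut_weight J e {c, d} + 2 * s"
      by (rule cut'; use sub small in auto)+
    then obtain \<rho> where "inj_on \<rho> J" "(\<Sum>j\<in>J. boosted_deficit J e lam \<rho> j) + h \<le> (card J div 2) * N + card J * K + 2 * s"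
      using exists_order_disjoint_pairs[OF J(1) d(1) sub R_pair[OF d(2)] R_pair[OF d(3)] big(2)] by blast
    then show ?thesis unfolding h_def by (intro exI[of _ \<rho>]) linarith
  next
    assume "\<exists>z\<in>J. \<forall>x y. R x y \<longrightarrow> x = z \<or> y = z"
    then obtain z where z: "z \<in> J" "\<And>x y. R x y \<Longrightarrow> x = z \<or> y = z" by blast
    have light: "e I < h" if I: "I \<in> types J" "\<nexists>l. I = {z, l}" for I
    proof (rule ccontr)
      assume "\<not> e I < h"
      then have R: "R x y" if "x \<in> I" "y \<in> I" "x \<noteq> y" for x y using that I(1) unfolding R_def types_def by auto
      have fI: "finite I" "2 \<le> card I" using I(1) finite_J finite_subset by (auto simp: types_def)
      obtain x y where xy: "x \<in> I" "y \<in> I" "x \<noteq> y" using fI by (metis card_le_Suc0_iff_eq not_less_eq_eq numeral_2_eq_2)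
      then have zI: "z \<in> I" using z(2)[OF R[OF xy]] by auto
      then obtain l where l: "l \<in> I" "l \<noteq> z" using xy by metis
      have "I \<subseteq> {z, l}"
      proof
        fix w assume "w \<in> I"
        then show "w \<in> {z, l}" using z(2)[OF R[of w l]] l by auto
      qed
      then have "I = {z, l}" using zI l by auto
      then show False using I(2) by blast
    qed
    obtain \<rho> where \<rho>: "inj_on \<rho> J" "(\<Sum>j\<in>J. boosted_deficit J e lam \<rho> j) \<le> N + card J * (K + 2 ^ card J * h) + s"
      using exists_order_star[OF J(2) z(1) light u(2)] by blast
    \<comment> \<open>The star costs only one \<open>N\<close>, whereas two are available from five
      indices on; the spare one pays for all the other terms.\<close>
    have "2 * N \<le> (card J div 2) * N" by (intro mult_right_mono) (use J in auto)
    moreover have "card J * (K + 2 ^ card J * h) = card J * K + card J * (2 ^ card J * h)" by (rule distrib_left)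
    ultimately have "(\<Sum>j\<in>J. boosted_deficit J e lam \<rho> j) + s \<le> (card J div 2) * N + card J * K"
      using \<rho>(2) big(3) by linarith
    then show ?thesis using \<rho>(1) by blast
  qed
qed

text \<open>After renaming, the type beginning at the middle index \<open>b\<close> weighs at least
  as much as the one ending there, so boosting \<open>b\<close> leaves a deficit of at most
  \<open>K\<close>; \<open>a\<close> also costs at most \<open>K\<close> and \<open>c\<close> at
  most \<open>N\<close>. As only \<open>{b, c}\<close> begins at \<open>b\<close>, there is nothing
  to distribute and no divisor function is lost.\<close>

lemma exists_order_three:
  assumes "card J = 3"
  shows "\<exists>\<rho> B. inj_on \<rho> J \<and> B \<subseteq> J \<and> (\<Sum>j\<in>J. deficit J e lam \<rho> B j) \<le> N + 2 * K \<and>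
    (\<forall>j\<in>B. (\<forall>I\<in>first_types J \<rho> j. e I \<le> N) \<and> card (first_types J \<rho> j) \<le> 1)"
proof -
  obtain a b c where J: "J = {a, b, c}" "a \<noteq> b" "b \<noteq> c" "a \<noteq> c" "e {a, b} \<le> e {b, c}"
  proof -
    obtain a b c where J: "J = {a, b, c}" "a \<noteq> b" "b \<noteq> c" "a \<noteq> c"
      using assms by (metis card_3_iff)
    show ?thesis
    proof (cases "e {a, b} \<le> e {b, c}")
      case True
      then show ?thesis using that J by blast
    next
      case False
      then have "e {c, b} \<le> e {b, a}" by (simp add: insert_commute)
      then show ?thesis using that[of c b a] J by (simp add: insert_commute)
    qed
  qed
  define \<rho> where "\<rho> = (\<lambda>i. if i = a then 0 else if i = b then 1 else (2::int))"
  have v: "\<rho> a = 0" "\<rho> b = 1" "\<rho> c = 2" using J by (auto simp: \<rho>_def)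
  have inj: "inj_on \<rho> J" using v unfolding J(1) inj_on_def by auto
  have m: "a \<in> J" "b \<in> J" "c \<in> J" using J by auto
  have t: "{a, b} \<in> types J" "{b, c} \<in> types J" using J by (auto simp: types_def)
  have ty: "2 \<le> card I \<and> I \<subseteq> {a, b, c}" if "I \<in> types J" for I using that J(1) by (simp add: types_def)
  have notsing: "\<not> I \<subseteq> {x}" if "I \<in> types J" for I x
  proof
    assume "I \<subseteq> {x}"
    then have "card I \<le> card {x}" by (intro card_mono) auto
    then show False using ty[OF that] by simp
  qed
  have fb: "first_types J \<rho> b = {{b, c}}"
  proof
    show "first_types J \<rho> b \<subseteq> {{b, c}}"
    proof
      fix I assume I: "I \<in> first_types J \<rho> b"
      then have I': "I \<in> types J" "b \<in> I" "a \<notin> I" using v by (auto simp: first_types_def)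
      then have "I \<subseteq> {b, c}" "\<not> I \<subseteq> {b}" using ty notsing by blast+
      then show "I \<in> {{b, c}}" using I'(2) by auto
    qed
    show "{{b, c}} \<subseteq> first_types J \<rho> b" using t v by (auto simp: first_types_def)
  qed
  have lb: "first_types J (\<lambda>i. - \<rho> i) b \<subseteq> {{a, b}}"
  proof
    fix I assume I: "I \<in> first_types J (\<lambda>i. - \<rho> i) b"
    then have I': "I \<in> types J" "b \<in> I" "c \<notin> I" using v by (auto simp: first_types_def)
    then have "I \<subseteq> {a, b}" "\<not> I \<subseteq> {b}" using ty notsing by blast+
    then show "I \<in> {{a, b}}" using I'(2) by auto
  qed
  have la: "first_types J (\<lambda>i. - \<rho> i) a = {}"
  proof (rule ccontr)
    assume "first_types J (\<lambda>i. - \<rho> i) a \<noteq> {}"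
    then obtain I where I: "I \<in> types J" "\<forall>i\<in>I. \<rho> i \<le> \<rho> a" by (auto simp: first_types_def)
    then have "I \<subseteq> {a}" using ty[OF I(1)] v by fastforce
    then show False using notsing I(1) by blast
  qed
  have F: "first_weight J e \<rho> b = e {b, c}" unfolding first_weight_def fb by simp
  have L: "last_weight J e \<rho> b \<le> e {a, b}"
  proof -
    have "last_weight J e \<rho> b \<le> (\<Sum>I\<in>{{a, b}}. e I)" unfolding last_weight_def first_weight_def
      by (rule sum_mono2[OF _ lb]) auto
    then show ?thesis by simp
  qed
  have La: "last_weight J e \<rho> a = 0" unfolding last_weight_def first_weight_def la by simp
  \<comment> \<open>If \<open>e {b, c}\<close> exceeds \<open>N\<close>, boosting is not admissible,
    but then the open weight at \<open>b\<close> already exceeds \<open>lam b\<close>.\<close>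
  define B where "B = (if e {b, c} \<le> N then {b} else {})"
  have "deficit J e lam \<rho> B a \<le> K"
    using lam_le_weight[OF m(1)] J(2) unfolding deficit_def La B_def by simp
  moreover have "deficit J e lam \<rho> B b \<le> K"
    using lam_le_weight[OF m(2)] lam_le[OF m(2)] last_add_first_le[OF inj m(2)] L J(5) F
    unfolding deficit_def B_def by auto
  moreover have "deficit J e lam \<rho> B c \<le> N" using lam_le[OF m(3)] unfolding deficit_def by simp
  moreover have "(\<Sum>j\<in>J. deficit J e lam \<rho> B j) = deficit J e lam \<rho> B a + deficit J e lam \<rho> B b + deficit J e lam \<rho> B c"
    unfolding J(1) using J by simp
  ultimately have "(\<Sum>j\<in>J. deficit J e lam \<rho> B j) \<le> N + 2 * K" by linarith
  moreover have "\<forall>j\<in>B. (\<forall>I\<in>first_types J \<rho> j. e I \<le> N) \<and> card (first_types J \<rho> j) \<le> 1"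
    unfolding B_def using fb by auto
  moreover have "B \<subseteq> J" using m by (simp add: B_def)
  ultimately show ?thesis using inj by blast
qed

end

section \<open>Summation over the cells\<close>

text \<open>Bounds one Fourier coefficient of the count in a window of length at most
  \<open>2 ^ N\<close>: the first factor comes from a geometric sum, the second from a normalised
  Ramanujan sum.\<close>

definition fourier_weight :: "nat \<Rightarrow> nat set \<Rightarrow> int \<Rightarrow> real" where
  "fourier_weight N S b = min (2 ^ N) (real (\<Prod>S) / \<bar>real_of_int b\<bar>) / real (\<Prod>{p \<in> S. \<not> int p dvd b})"

definition weighted_count :: "nat \<Rightarrow> nat set \<Rightarrow> nat set \<Rightarrow> real" where
  "weighted_count N S J = (\<Sum>b\<in>zero_sums S J. \<Prod>j\<in>J. fourier_weight N S (b j))"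

text \<open>For a set of primes, the sum of the reciprocals of the divisors of
  \<open>\<Prod>S\<close>.\<close>

definition divisor_mass :: "nat set \<Rightarrow> real" where
  "divisor_mass S = (\<Prod>p\<in>S. 1 + 1 / real p)"

lemma fourier_weight_nonneg: "0 \<le> fourier_weight N S b"
  unfolding fourier_weight_def by (intro divide_nonneg_nonneg min.boundedI of_nat_0_le_iff zero_le_power) simp_all

lemma divisor_mass_eq:
  assumes "finite S"
  shows "divisor_mass S = (\<Sum>Y\<in>Pow S. 1 / real (\<Prod>Y))"
proof -
  have "divisor_mass S = (\<Sum>Y\<in>Pow S. (\<Prod>p\<in>Y. 1 / real p) * (\<Prod>p\<in>S - Y. 1))"
    unfolding divisor_mass_def using prod_add[OF assms, of "\<lambda>p. 1 / real p" "\<lambda>p. 1"] by (simp add: add.commute)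
  then show ?thesis by (simp add: prod_dividef)
qed

lemma divisor_mass_ge_1: "finite S \<Longrightarrow> 1 \<le> divisor_mass S"
  unfolding divisor_mass_def by (rule prod_ge_1) simp

lemma sum_dyadic_mass_le:
  assumes "finite S"
  shows "(\<Sum>e\<le>E. dyadic_mass S e) \<le> divisor_mass S"
proof -
  have disj: "dyadic S i \<inter> dyadic S j = {}" if "i \<noteq> j" for i j
  proof (rule ccontr)
    assume "dyadic S i \<inter> dyadic S j \<noteq> {}"
    then obtain n :: nat where n: "2 ^ i \<le> n" "n < 2 ^ (i + 1)" "2 ^ j \<le> n" "n < 2 ^ (j + 1)" by (auto simp: dyadic_def)
    then have "(2::nat) ^ i < 2 ^ (j + 1)" "(2::nat) ^ j < 2 ^ (i + 1)" by linarith+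
    then have "i < j + 1" "j < i + 1" by (simp_all only: power_strict_increasing_iff[of "2::nat"] one_less_numeral_iff semiring_norm)
    then show False using that by simp
  qed
  have "(\<Sum>e\<le>E. dyadic_mass S e) = (\<Sum>Y\<in>(\<Union>e\<le>E. dyadic S e). 1 / real (\<Prod>Y))"
    unfolding dyadic_mass_def
    by (rule sum.UNION_disjoint[symmetric]) (use disj finite_dyadic[OF assms] in auto)
  also have "\<dots> \<le> (\<Sum>Y\<in>Pow S. 1 / real (\<Prod>Y))"
    by (rule sum_mono2) (use assms in \<open>auto simp: dyadic_def simp del: of_nat_prod\<close>)
  finally show ?thesis using divisor_mass_eq[OF assms] by simp
qed

lemma sum_cell_mass_le:
  assumes "finite S"
  shows "(\<Sum>e\<le>E. cell_mass N S e) \<le> divisor_mass S + real N + 1"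
proof -
  have "(\<Sum>e\<le>E. if e \<le> N then 1 else (0::real)) = real (card ({..E} \<inter> {e. e \<le> N}))"
    by (simp add: sum.If_cases)
  also have "\<dots> \<le> real (card {..N})" by (intro of_nat_mono card_mono) auto
  finally show ?thesis using sum_dyadic_mass_le[OF assms, of E] unfolding cell_mass_def by (simp add: sum.distrib)
qed

section \<open>Inequalities between the exponents of a nonempty cell, and its total weight\<close>

context dyadic_cell begin

lemma radical_eq:
  assumes "b \<in> A" "j \<in> J"
  shows "{p \<in> S. \<not> int p dvd b j} = {p \<in> S. ptype J b p \<in> {I \<in> types J. j \<in> I}}"
proof -
  have "j \<in> ptype J b p \<longleftrightarrow> \<not> int p dvd b j" for p using assms(2) by (simp add: ptype_def)
  moreover have "ptype J b p \<in> types J" if "p \<in> S" "j \<in> ptype J b p" for p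
    using ptype_cases[OF assms(1) that(1)] that(2) by blast
  ultimately show ?thesis by blast
qed

text \<open>In absolute value a nonzero residue is at least \<open>\<Prod>S\<close> divided by its
  reduced denominator.\<close>

lemma lam_le_weight:
  assumes "A \<noteq> {}" "j \<in> J"
  shows "lam j \<le> weight J e j + K"
proof -
  obtain b where b: "b \<in> A" using assms(1) by blast
  define V where "V = {p \<in> S. ptype J b p \<in> {I \<in> types J. j \<in> I}}"
  have bj: "b j \<noteq> 0" using A b assms(2) unfolding zero_sums_def nonzero_residues_def by (auto simp: PiE_iff)
  have "\<Prod>V \<le> 2 ^ (weight J e j + K)" unfolding V_def weight_def by (rule prod_family_le[OF b]) auto
  then have "int (\<Prod>S) \<le> \<bar>b j\<bar> * 2 ^ (weight J e j + K)"
    by (rule spacing_of_dvd[OF fin(1) primes _ bj, rotated -1])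
      (use radical_eq[OF b assms(2)] in \<open>auto simp: V_def\<close>)
  then have "\<bar>b j\<bar> * 2 ^ lam j \<le> \<bar>b j\<bar> * 2 ^ (weight J e j + K)" using lam[OF b assms(2)] by linarith
  then have "(2::int) ^ lam j \<le> 2 ^ (weight J e j + K)" using bj by simp
  then show ?thesis by (rule power_le_imp_le_exp[rotated]) simp
qed

text \<open>The subsum over \<open>T\<close> is nonzero by irreducibility and divisible by every
  prime whose type avoids \<open>T\<close> or lies inside it. If its summands are small, the
  remaining primes must therefore have a large product. The second \<open>K\<close> absorbs the
  number of summands.\<close>

lemma le_cut_weight:
  assumes A0: "A \<noteq> {}" and irr: "\<And>b. b \<in> A \<Longrightarrow> \<not> int (\<Prod>S) dvd (\<Sum>i\<in>T. b i)"
    and T: "T \<subseteq> J" and m: "\<And>j. j \<in> T \<Longrightarrow> m \<le> lam j"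
  shows "m \<le> cut_weight J e T + 2 * K"
proof -
  obtain b where b: "b \<in> A" using A0 by blast
  define x where "x = (\<Sum>i\<in>T. b i)"
  have x0: "x \<noteq> 0" using irr[OF b] unfolding x_def by auto
  define F where "F = {I \<in> types J. I \<inter> T \<noteq> {} \<and> \<not> I \<subseteq> T}"
  define V where "V = {p \<in> S. ptype J b p \<in> F}"
  have V: "\<Prod>V \<le> 2 ^ (cut_weight J e T + K)"
    unfolding V_def cut_weight_def F_def by (rule prod_family_le[OF b]) auto
  have 1: "int (\<Prod>S) \<le> \<bar>x\<bar> * 2 ^ (cut_weight J e T + K)"
  proof (rule spacing_of_dvd[OF fin(1) primes _ x0 _ V])
    fix p assume p: "p \<in> S - V"
    then have "ptype J b p \<notin> F" "p \<in> S" by (auto simp: V_def)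
    then have "ptype J b p \<inter> T = {} \<or> ptype J b p \<subseteq> T" using ptype_cases[OF b] unfolding F_def by blast
    then show "int p dvd x"
    proof
      assume "ptype J b p \<inter> T = {}"
      then show ?thesis unfolding x_def using T by (intro dvd_sum) (auto simp: ptype_def)
    next
      assume "ptype J b p \<subseteq> T"
      then show ?thesis unfolding x_def using dvd_partial_sum[OF b _ _ T] p by blast
    qed
  qed (auto simp: V_def)
  have "\<bar>x\<bar> * 2 ^ m \<le> (\<Sum>i\<in>T. \<bar>b i\<bar>) * 2 ^ m" unfolding x_def by (intro mult_right_mono sum_abs) auto
  also have "\<dots> = (\<Sum>i\<in>T. \<bar>b i\<bar> * 2 ^ m)" by (rule sum_distrib_right)
  also have "\<dots> \<le> (\<Sum>i\<in>T. int (\<Prod>S))"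
  proof (rule sum_mono)
    fix i assume i: "i \<in> T"
    have "\<bar>b i\<bar> * 2 ^ m \<le> \<bar>b i\<bar> * 2 ^ lam i" using m[OF i] by (intro mult_left_mono power_increasing) auto
    also have "\<dots> \<le> int (\<Prod>S)" using lam[OF b] i T by blast
    finally show "\<bar>b i\<bar> * 2 ^ m \<le> int (\<Prod>S)" .
  qed
  also have "\<dots> = int (card T) * int (\<Prod>S)" by simp
  also have "\<dots> \<le> 2 ^ K * int (\<Prod>S)"
  proof (rule mult_right_mono)
    have "card T \<le> card J" using T fin(2) card_mono by blast
    also have "\<dots> \<le> K" by (meson less_exp less_imp_le)
    also have "\<dots> \<le> 2 ^ K" by (meson less_exp less_imp_le)
    finally have "int (card T) \<le> int (2 ^ K)" by linarith
    then show "int (card T) \<le> 2 ^ K" by simp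
  qed (simp del: of_nat_prod)
  also have "\<dots> \<le> 2 ^ K * (\<bar>x\<bar> * 2 ^ (cut_weight J e T + K))" by (rule mult_left_mono[OF 1]) simp
  also have "\<dots> = \<bar>x\<bar> * 2 ^ (cut_weight J e T + 2 * K)" by (simp add: power_add mult_2)
  finally have "(2::int) ^ m \<le> 2 ^ (cut_weight J e T + 2 * K)" using x0 by simp
  then show ?thesis by (rule power_le_imp_le_exp[rotated]) simp
qed

lemma prod_fourier_weight_le:
  assumes b: "b \<in> A" and up: "\<And>j. j \<in> J \<Longrightarrow> min (2 ^ N) (real (\<Prod>S) / \<bar>real_of_int (b j)\<bar>) \<le> 2 ^ (lam j + 1)"
  shows "(\<Prod>j\<in>J. fourier_weight N S (b j)) * 2 ^ (\<Sum>j\<in>J. weight J e j) \<le> 2 ^ card J * 2 ^ (\<Sum>j\<in>J. lam j)"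
proof -
  have "(\<Prod>j\<in>J. fourier_weight N S (b j) * 2 ^ weight J e j) \<le> (\<Prod>j\<in>J. 2 * 2 ^ lam j)"
  proof (rule prod_mono)
    fix j assume j: "j \<in> J"
    define r where "r = real (\<Prod>{p \<in> S. \<not> int p dvd b j})"
    have "2 ^ weight J e j \<le> \<Prod>{p \<in> S. \<not> int p dvd b j}"
      unfolding radical_eq[OF b j] weight_def by (rule prod_family_ge[OF b]) auto
    then have "real (2 ^ weight J e j) \<le> r" unfolding r_def by (simp only: of_nat_le_iff)
    then have r: "2 ^ weight J e j \<le> r" by simp
    have r0: "0 < r" by (rule less_le_trans[OF _ r]) simp
    have "fourier_weight N S (b j) * 2 ^ weight J e j \<le> fourier_weight N S (b j) * r" by (rule mult_left_mono[OF r fourier_weight_nonneg])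
    also have "\<dots> = min (2 ^ N) (real (\<Prod>S) / \<bar>real_of_int (b j)\<bar>)"
      unfolding fourier_weight_def r_def[symmetric] using r0 by simp
    also have "\<dots> \<le> 2 * 2 ^ lam j" using up[OF j] by simp
    finally show "0 \<le> fourier_weight N S (b j) * 2 ^ weight J e j \<and> fourier_weight N S (b j) * 2 ^ weight J e j \<le> 2 * 2 ^ lam j"
      using fourier_weight_nonneg by simp
  qed
  then show ?thesis by (simp add: prod.distrib power_sum)
qed

theorem sum_fourier_weight_cell_le:
  fixes T :: real
  assumes inj: "inj_on \<rho> J" and T1: "1 \<le> T"
    and B: "\<And>j. j \<in> J \<inter> B \<Longrightarrow> \<forall>I\<in>first_types J \<rho> j. e I \<le> N"
    and T: "\<And>j U. j \<in> J \<inter> B \<Longrightarrow> U \<subseteq> S \<Longrightarrow> \<Prod>U \<le> 2 ^ (first_weight J e \<rho> j + K) \<Longrightarrow> real (card (first_types J \<rho> j)) ^ card U \<le> T"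
    and up: "\<And>b j. b \<in> A \<Longrightarrow> j \<in> J \<Longrightarrow> min (2 ^ N) (real (\<Prod>S) / \<bar>real_of_int (b j)\<bar>) \<le> 2 ^ (lam j + 1)"
  shows "(\<Sum>b\<in>A. \<Prod>j\<in>J. fourier_weight N S (b j)) \<le> 2 ^ card J * (2 ^ (4 * K + 2) * T) ^ card J *
    2 ^ (\<Sum>j\<in>J. deficit J e lam \<rho> B j) * (\<Prod>I\<in>types J. cell_mass N S (e I))"
proof -
  define w where "w = (2::real) ^ (\<Sum>j\<in>J. weight J e j)"
  have w0: "0 < w" by (simp add: w_def)
  have "(\<Sum>b\<in>A. \<Prod>j\<in>J. fourier_weight N S (b j)) * w = (\<Sum>b\<in>A. (\<Prod>j\<in>J. fourier_weight N S (b j)) * w)" by (rule sum_distrib_right)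
  also have "\<dots> \<le> (\<Sum>b\<in>A. 2 ^ card J * 2 ^ (\<Sum>j\<in>J. lam j))"
    unfolding w_def by (intro sum_mono prod_fourier_weight_le up)
  also have "\<dots> = 2 ^ card J * (real (card A) * 2 ^ (\<Sum>j\<in>J. lam j))" by simp
  also have "\<dots> \<le> 2 ^ card J * ((2 ^ (4 * K + 2) * T) ^ card J *
    2 ^ (\<Sum>j\<in>J. deficit J e lam \<rho> B j) * 2 ^ (\<Sum>j\<in>J. weight J e j) * (\<Prod>I\<in>types J. cell_mass N S (e I)))"
    by (intro mult_left_mono card_cell_le inj T1 B T) auto
  also have "\<dots> = (2 ^ card J * (2 ^ (4 * K + 2) * T) ^ card J *
    2 ^ (\<Sum>j\<in>J. deficit J e lam \<rho> B j) * (\<Prod>I\<in>types J. cell_mass N S (e I))) * w"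
    unfolding w_def by simp
  finally show ?thesis using w0 by (simp only: mult_le_cancel_right_pos)
qed

end

text \<open>Unspecified at \<open>0\<close>.\<close>

definition floor_log2 :: "nat \<Rightarrow> nat" where
  "floor_log2 n = (SOME e. 2 ^ e \<le> n \<and> n < 2 ^ (e + 1))"

lemma floor_log2:
  assumes "1 \<le> n"
  shows "2 ^ floor_log2 n \<le> n \<and> n < 2 ^ (floor_log2 n + 1)"
  unfolding floor_log2_def by (rule someI_ex) (use ex_power_ivl1[of 2 n] assms in auto)

text \<open>Cells are indexed by pairs \<open>(e, lam)\<close>. The bound for a cell factorises over
  the types, so summing over \<open>e\<close> gives a product of sums of cell masses, and the number
  of choices of \<open>lam\<close> is only a power of \<open>N + 1\<close>.\<close>

lemma sum_fourier_weight_by_cells: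
  fixes D :: real
  assumes fin: "finite S" "finite J" and primes: "\<forall>p\<in>S. prime p" and Z: "Z \<subseteq> zero_sums S J" and D: "0 \<le> D"
    and cell: "\<And>A e lam. dyadic_cell S J A e lam \<Longrightarrow> A \<subseteq> Z \<Longrightarrow> A \<noteq> {} \<Longrightarrow> (\<forall>j\<in>J. lam j \<le> N) \<Longrightarrow>
      \<exists>\<rho> B T. inj_on \<rho> J \<and> (1::real) \<le> T \<and>
        (\<forall>j\<in>J \<inter> B. (\<forall>I\<in>first_types J \<rho> j. e I \<le> N) \<and>
          (\<forall>U\<subseteq>S. \<Prod>U \<le> 2 ^ (first_weight J e \<rho> j + 2 ^ card J) \<longrightarrow> real (card (first_types J \<rho> j)) ^ card U \<le> T)) \<and>
        T ^ card J * 2 ^ (\<Sum>j\<in>J. deficit J e lam \<rho> B j) \<le> D"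
  shows "(\<Sum>b\<in>Z. \<Prod>j\<in>J. fourier_weight N S (b j)) \<le>
    (2 ^ (4 * 2 ^ card J + 3)) ^ card J * D * ((real N + 1) ^ card J * (divisor_mass S + real N + 1) ^ card (types J))"
proof -
  define q where "q = \<Prod>S"
  have q0: "0 < q" unfolding q_def using primes fin by (intro prod_pos) (auto intro: prime_gt_0_nat)
  define ex where "ex = (\<lambda>b. restrict (\<lambda>I. floor_log2 (ptype_prod S J b I)) (types J))"
  \<comment> \<open>Where the cap \<open>N\<close> is active, the term \<open>2 ^ N\<close> of the
    Fourier weight gives the upper bound; elsewhere q / |b_j| does.\<close>
  define la where "la = (\<lambda>b::nat \<Rightarrow> int. restrict (\<lambda>j. min N (floor_log2 (q div nat \<bar>b j\<bar>))) J)"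
  \<comment> \<open>The generous range for the exponents costs nothing: cell masses over any range
    add up to at most \<open>divisor_mass S + real N + 1\<close>.\<close>
  define X where "X = (types J \<rightarrow>\<^sub>E {..q}) \<times> (J \<rightarrow>\<^sub>E {..N})"
  have finZ: "finite Z" using Z finite_zero_sums[OF fin(2)] finite_subset by blast
  have finX: "finite X" unfolding X_def using finite_types[OF fin(2)] fin by (intro finite_cartesian_product finite_PiE) auto
  have pos: "1 \<le> ptype_prod S J b I" for b I
  proof -
    have "0 < ptype_prod S J b I" unfolding ptype_prod_def using primes fin by (intro prod_pos) (auto intro: prime_gt_0_nat)
    then show ?thesis by simp
  qed
  have le_q: "floor_log2 (ptype_prod S J b I) \<le> q" for b I
  proof -
    have "ptype_prod S J b I dvd q" unfolding ptype_prod_def q_def by (rule prod_dvd_prod_subset) (use fin in auto)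
    then have "ptype_prod S J b I \<le> q" using q0 by (rule dvd_imp_le)
    then have "2 ^ floor_log2 (ptype_prod S J b I) \<le> q" using floor_log2[OF pos[of b I]] by linarith
    then show ?thesis by (meson less_exp less_imp_le order_trans)
  qed
  have q1: "1 \<le> q div nat \<bar>b j\<bar>" "0 < nat \<bar>b j\<bar>" if "b \<in> Z" "j \<in> J" for b j
  proof -
    have bj: "b j \<in> nonzero_residues S" using Z that unfolding zero_sums_def by auto
    then show 0: "0 < nat \<bar>b j\<bar>" by (simp add: nonzero_residues_def)
    have "2 * \<bar>b j\<bar> \<le> int q" using bj unfolding nonzero_residues_def q_def by simp
    then have "nat \<bar>b j\<bar> \<le> q" by linarith
    then show "1 \<le> q div nat \<bar>b j\<bar>" using 0 by (simp add: div_greater_zero_iff Suc_le_eq)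
  qed
  have img: "(\<lambda>b. (ex b, la b)) ` Z \<subseteq> X" unfolding X_def ex_def la_def using le_q by auto
  define c where "c = (2 ^ (4 * 2 ^ card J + 3)) ^ card J * D"
  have c0: "0 \<le> c" unfolding c_def using D by simp
  have k0: "0 \<le> cell_mass N S n" for n unfolding cell_mass_def using dyadic_mass_nonneg by auto
  have each: "(\<Sum>b\<in>{b \<in> Z. (ex b, la b) = x}. \<Prod>j\<in>J. fourier_weight N S (b j)) \<le> c * (\<Prod>I\<in>types J. cell_mass N S (fst x I))" for x
  proof -
    obtain e lam where x: "x = (e, lam)" by fastforce
    define A where "A = {b \<in> Z. (ex b, la b) = x}"
    have A: "b \<in> Z" "ex b = e" "la b = lam" if "b \<in> A" for b using that by (auto simp: A_def x)
    show ?thesis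
    proof (cases "A = {}")
      case True
      have "0 \<le> c * (\<Prod>I\<in>types J. cell_mass N S (fst x I))" by (intro mult_nonneg_nonneg c0 prod_nonneg k0)
      then show ?thesis unfolding A_def[symmetric] True by simp
    next
      case False
      have lamv: "lam j = min N (floor_log2 (q div nat \<bar>b j\<bar>))" if "b \<in> A" "j \<in> J" for b j
        using A(3)[OF that(1)] that(2) unfolding la_def by (metis (no_types, lifting) restrict_apply')
      have ev: "e I = floor_log2 (ptype_prod S J b I)" if "b \<in> A" "I \<in> types J" for b I
        using A(2)[OF that(1)] that(2) unfolding ex_def by (metis (no_types, lifting) restrict_apply')
      have dc: "dyadic_cell S J A e lam"
      proof
        show "A \<subseteq> zero_sums S J" using A Z by blast
        fix b assume b: "b \<in> A"
        show "2 ^ e I \<le> ptype_prod S J b I \<and> ptype_prod S J b I < 2 ^ (e I + 1)" if "I \<in> types J" for I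
          using floor_log2[OF pos] ev[OF b that] by simp
        fix j assume j: "j \<in> J"
        have "lam j \<le> floor_log2 (q div nat \<bar>b j\<bar>)" using lamv[OF b j] by simp
        then have "(2::nat) ^ lam j \<le> 2 ^ floor_log2 (q div nat \<bar>b j\<bar>)" by (rule power_increasing) simp
        then have "2 ^ lam j \<le> q div nat \<bar>b j\<bar>" using floor_log2[OF q1(1)[OF A(1)[OF b] j]] by linarith
        then have "nat \<bar>b j\<bar> * 2 ^ lam j \<le> nat \<bar>b j\<bar> * (q div nat \<bar>b j\<bar>)" by (rule mult_left_mono) simp
        also have "\<dots> \<le> q" by simp
        finally have "int (nat \<bar>b j\<bar> * 2 ^ lam j) \<le> int q" by linarith
        then show "\<bar>b j\<bar> * 2 ^ lam j \<le> int (\<Prod>S)" unfolding q_def[symmetric] by simp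
      qed (use fin primes in auto)
      have lamN: "\<forall>j\<in>J. lam j \<le> N" using False lamv by fastforce
      have up: "min (2 ^ N) (real (\<Prod>S) / \<bar>real_of_int (b j)\<bar>) \<le> 2 ^ (lam j + 1)" if b: "b \<in> A" and j: "j \<in> J" for b j
      proof (cases "lam j = N")
        case True
        have "(2::real) ^ N \<le> 2 ^ (lam j + 1)" unfolding True by (rule power_increasing) auto
        then show ?thesis by simp
      next
        case False
        then have l: "lam j = floor_log2 (q div nat \<bar>b j\<bar>)" using lamv[OF b j] by linarith
        have n0: "0 < nat \<bar>b j\<bar>" using q1(2)[OF A(1)[OF b] j] .
        have "q div nat \<bar>b j\<bar> < 2 ^ (lam j + 1)" using floor_log2[OF q1(1)[OF A(1)[OF b] j]] l by simp
        then have "q < 2 ^ (lam j + 1) * nat \<bar>b j\<bar>" using n0 by (simp add: less_mult_imp_div_less div_less_iff_less_mult)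
        then have "real q < real (2 ^ (lam j + 1) * nat \<bar>b j\<bar>)" by linarith
        then have "real q < 2 ^ (lam j + 1) * \<bar>real_of_int (b j)\<bar>" by simp
        moreover have "0 < \<bar>real_of_int (b j)\<bar>" using n0 by simp
        ultimately have "real q / \<bar>real_of_int (b j)\<bar> \<le> 2 ^ (lam j + 1)" by (simp add: divide_le_eq mult.commute)
        then show ?thesis unfolding q_def by (rule min.coboundedI2)
      qed
      have AZ: "A \<subseteq> Z" using A by blast
      obtain \<rho> B T where o: "inj_on \<rho> J" "(1::real) \<le> T"
        "\<forall>j\<in>J \<inter> B. (\<forall>I\<in>first_types J \<rho> j. e I \<le> N) \<and>
          (\<forall>U\<subseteq>S. \<Prod>U \<le> 2 ^ (first_weight J e \<rho> j + 2 ^ card J) \<longrightarrow> real (card (first_types J \<rho> j)) ^ card U \<le> T)"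
        "T ^ card J * 2 ^ (\<Sum>j\<in>J. deficit J e lam \<rho> B j) \<le> D"
        using cell[OF dc AZ False lamN] by (elim exE conjE) (rule that)
      have "(\<Sum>b\<in>A. \<Prod>j\<in>J. fourier_weight N S (b j)) \<le> 2 ^ card J * (2 ^ (4 * 2 ^ card J + 2) * T) ^ card J *
        2 ^ (\<Sum>j\<in>J. deficit J e lam \<rho> B j) * (\<Prod>I\<in>types J. cell_mass N S (e I))"
      proof (rule dyadic_cell.sum_fourier_weight_cell_le[OF dc o(1,2)])
        fix j assume "j \<in> J \<inter> B"
        note o3 = bspec[OF o(3) this]
        show "\<forall>I\<in>first_types J \<rho> j. e I \<le> N" by (rule conjunct1[OF o3])
        fix U assume "U \<subseteq> S" "\<Prod>U \<le> 2 ^ (first_weight J e \<rho> j + 2 ^ card J)"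
        then show "real (card (first_types J \<rho> j)) ^ card U \<le> T" using conjunct2[OF o3] by simp
      next
        fix b j assume "b \<in> A" "j \<in> J"
        then show "min (2 ^ N) (real (\<Prod>S) / \<bar>real_of_int (b j)\<bar>) \<le> 2 ^ (lam j + 1)" by (rule up)
      qed
      also have "2 ^ card J * (2 ^ (4 * 2 ^ card J + 2) * T) ^ card J = (2 ^ (4 * 2 ^ card J + 3)) ^ card J * T ^ card J"
      proof -
        have "2 * (2 ^ (4 * 2 ^ card J + 2) * T) = 2 ^ (4 * 2 ^ card J + 3) * T" by (simp add: numeral_3_eq_3)
        then show ?thesis by (metis power_mult_distrib)
      qed
      also have "(2 ^ (4 * 2 ^ card J + 3)) ^ card J * T ^ card J * 2 ^ (\<Sum>j\<in>J. deficit J e lam \<rho> B j) * (\<Prod>I\<in>types J. cell_mass N S (e I))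
        = (2 ^ (4 * 2 ^ card J + 3)) ^ card J * (T ^ card J * 2 ^ (\<Sum>j\<in>J. deficit J e lam \<rho> B j)) * (\<Prod>I\<in>types J. cell_mass N S (e I))"
        by (simp only: mult.assoc)
      also have "\<dots> \<le> c * (\<Prod>I\<in>types J. cell_mass N S (e I))"
        unfolding c_def by (intro mult_right_mono mult_left_mono o(4) prod_nonneg k0) auto
      finally show ?thesis unfolding A_def x by simp
    qed
  qed
  have "(\<Sum>b\<in>Z. \<Prod>j\<in>J. fourier_weight N S (b j)) = (\<Sum>x\<in>X. \<Sum>b\<in>{b \<in> Z. (ex b, la b) = x}. \<Prod>j\<in>J. fourier_weight N S (b j))"
    by (rule sum.group[OF finZ finX img, symmetric])
  also have "\<dots> \<le> (\<Sum>x\<in>X. c * (\<Prod>I\<in>types J. cell_mass N S (fst x I)))" by (rule sum_mono) (rule each)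
  also have "\<dots> = c * (\<Sum>e\<in>types J \<rightarrow>\<^sub>E {..q}. \<Sum>lam\<in>J \<rightarrow>\<^sub>E {..N}. \<Prod>I\<in>types J. cell_mass N S (e I))"
    unfolding X_def sum_distrib_left sum.cartesian_product by (simp only: case_prod_unfold)
  also have "\<dots> = c * ((real N + 1) ^ card J * (\<Sum>e\<in>types J \<rightarrow>\<^sub>E {..q}. \<Prod>I\<in>types J. cell_mass N S (e I)))"
    using fin by (simp add: card_PiE sum_distrib_left prod_constant add.commute)
  also have "(\<Sum>e\<in>types J \<rightarrow>\<^sub>E {..q}. \<Prod>I\<in>types J. cell_mass N S (e I)) = (\<Prod>I\<in>types J. \<Sum>n\<le>q. cell_mass N S n)"
    by (rule prod_sum_PiE[symmetric]) (use finite_types[OF fin(2)] in auto)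
  also have "\<dots> \<le> (\<Prod>I\<in>types J. divisor_mass S + real N + 1)"
    by (rule prod_mono) (simp add: sum_cell_mass_le[OF fin(1)] sum_nonneg k0)
  also have "\<dots> = (divisor_mass S + real N + 1) ^ card (types J)" by simp
  finally have "(\<Sum>b\<in>Z. \<Prod>j\<in>J. fourier_weight N S (b j)) \<le>
    c * ((real N + 1) ^ card J * (divisor_mass S + real N + 1) ^ card (types J))"
    using c0 by (simp add: mult_left_mono)
  then show ?thesis unfolding c_def .
qed

text \<open>The divisor bound: each prime of size at least \<open>D ^ M\<close> pays for its own
  factor, and fewer than \<open>D ^ M\<close> primes are smaller. For large \<open>M\<close> the
  number \<open>D ^ card U\<close> of distributions is thus at most a small power of
  \<open>\<Prod>U\<close>, up to a constant.\<close>

lemma card_primes_power_le: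
  fixes D M :: nat
  assumes "1 \<le> D"
  shows "\<exists>C::nat. 1 \<le> C \<and> (\<forall>U. finite U \<longrightarrow> (\<forall>p\<in>U. prime p) \<longrightarrow> D ^ (M * card U) \<le> C * \<Prod>U)"
proof (intro exI[of _ "(D ^ M) ^ (D ^ M)"] conjI allI impI)
  show "1 \<le> (D ^ M) ^ (D ^ M)" using assms by simp
  fix U :: "nat set" assume U: "finite U" "\<forall>p\<in>U. prime p"
  define P where "P = D ^ M"
  have P1: "1 \<le> P" using assms by (simp add: P_def)
  define V where "V = {p \<in> U. p < P}"
  have fV: "finite V" "V \<subseteq> U" using U by (auto simp: V_def)
  have "card V \<le> card {..<P}" by (rule card_mono) (auto simp: V_def)
  then have cV: "card V \<le> P" by simp
  have "P ^ card (U - V) = (\<Prod>p\<in>U - V. P)" by simp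
  also have "\<dots> \<le> \<Prod>(U - V)" by (rule prod_mono) (auto simp: V_def)
  also have "\<dots> \<le> \<Prod>U"
  proof (rule dvd_imp_le)
    show "\<Prod>(U - V) dvd \<Prod>U" by (rule prod_dvd_prod_subset) (use U in auto)
    show "0 < \<Prod>U" using U by (intro prod_pos) (auto intro: prime_gt_0_nat)
  qed
  finally have 1: "P ^ card (U - V) \<le> \<Prod>U" .
  have "card U = card V + card (U - V)"
    using card_Diff_subset[OF fV] card_mono[OF U(1) fV(2)] by simp
  then have "D ^ (M * card U) = P ^ card V * P ^ card (U - V)" unfolding P_def by (simp add: power_mult power_add)
  also have "\<dots> \<le> P ^ P * \<Prod>U" by (rule mult_mono[OF power_increasing[OF cV P1] 1]) auto
  finally show "D ^ (M * card U) \<le> (D ^ M) ^ (D ^ M) * \<Prod>U" unfolding P_def .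
qed

section \<open>The weighted count, by induction on the number of indices\<close>

lemma weighted_count_nonneg: "0 \<le> weighted_count N S J"
  unfolding weighted_count_def by (intro sum_nonneg prod_nonneg fourier_weight_nonneg)

text \<open>If the subsum over \<open>T\<close> vanishes modulo \<open>\<Prod>S\<close>, so does the
  complementary one, and a tuple is determined by its restrictions to both parts.\<close>

lemma weighted_count_split:
  assumes fin: "finite S" "finite J" and T: "T \<subseteq> J"
  shows "(\<Sum>b\<in>{b \<in> zero_sums S J. int (\<Prod>S) dvd (\<Sum>i\<in>T. b i)}. \<Prod>j\<in>J. fourier_weight N S (b j))
    \<le> weighted_count N S T * weighted_count N S (J - T)"
proof -
  define X where "X = {b \<in> zero_sums S J. int (\<Prod>S) dvd (\<Sum>i\<in>T. b i)}"
  define f where "f = (\<lambda>b::nat \<Rightarrow> int. (restrict b T, restrict b (J - T)))"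
  define g where "g = (\<lambda>(u, v). (\<Prod>j\<in>T. fourier_weight N S (u j)) * (\<Prod>j\<in>J - T. fourier_weight N S (v j)))"
  have finT: "finite T" "finite (J - T)" using fin T finite_subset by auto
  have sumJ: "(\<Sum>j\<in>J. b j) = (\<Sum>i\<in>J - T. b i) + (\<Sum>i\<in>T. b i)" for b :: "nat \<Rightarrow> int"
    by (rule sum.subset_diff[OF T fin(2)])
  have prodJ: "(\<Prod>j\<in>J. fourier_weight N S (b j)) = (\<Prod>j\<in>J - T. fourier_weight N S (b j)) * (\<Prod>j\<in>T. fourier_weight N S (b j))" for b
    by (rule prod.subset_diff[OF T fin(2)])
  have inj: "inj_on f X"
  proof (rule inj_onI)
    fix x y assume xy: "x \<in> X" "y \<in> X" "f x = f y"
    have "restrict x T = restrict y T" "restrict x (J - T) = restrict y (J - T)" using xy(3) by (simp_all add: f_def)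
    then have "x i = y i" if "i \<in> J" for i using that by (metis DiffI restrict_apply')
    moreover have "x \<in> extensional J" "y \<in> extensional J" using xy by (auto simp: X_def zero_sums_def PiE_def)
    ultimately show "x = y" by (metis extensionalityI)
  qed
  have img: "f ` X \<subseteq> zero_sums S T \<times> zero_sums S (J - T)"
  proof
    fix y assume "y \<in> f ` X"
    then obtain b where b: "b \<in> X" "y = f b" by auto
    have 1: "int (\<Prod>S) dvd (\<Sum>i\<in>T. b i)" "int (\<Prod>S) dvd (\<Sum>i\<in>J. b i)" "b \<in> J \<rightarrow>\<^sub>E nonzero_residues S"
      using b(1) unfolding X_def zero_sums_def by auto
    then have "int (\<Prod>S) dvd (\<Sum>i\<in>J - T. b i)" unfolding sumJ by (simp only: dvd_add_left_iff)
    then show "y \<in> zero_sums S T \<times> zero_sums S (J - T)"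
      using 1 T unfolding b(2) f_def zero_sums_def by (auto simp: restrict_PiE_iff PiE_iff)
  qed
  have "(\<Sum>b\<in>X. \<Prod>j\<in>J. fourier_weight N S (b j)) = (\<Sum>b\<in>X. g (f b))"
    by (rule sum.cong) (simp_all add: prodJ f_def g_def mult.commute)
  also have "\<dots> = sum g (f ` X)" by (simp add: sum.reindex[OF inj])
  also have "\<dots> \<le> sum g (zero_sums S T \<times> zero_sums S (J - T))"
  proof (rule sum_mono2[OF _ img])
    show "finite (zero_sums S T \<times> zero_sums S (J - T))" using finite_zero_sums finT by blast
    show "0 \<le> g x" for x unfolding g_def by (auto split: prod.splits intro!: mult_nonneg_nonneg prod_nonneg fourier_weight_nonneg)
  qed
  also have "\<dots> = weighted_count N S T * weighted_count N S (J - T)"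
    unfolding weighted_count_def sum_product sum.cartesian_product g_def ..
  finally show ?thesis unfolding X_def .
qed

lemma cell_exponents_of_cell:
  assumes "dyadic_cell S J A e lam" "A \<noteq> {}" "\<forall>j\<in>J. lam j \<le> N"
  shows "cell_exponents J e lam N (2 ^ card J)"
proof
  show "finite J" using dyadic_cell.fin(2)[OF assms(1)] .
  show "lam j \<le> weight J e j + 2 ^ card J" if "j \<in> J" for j by (rule dyadic_cell.lam_le_weight[OF assms(1,2) that])
  show "lam j \<le> N" if "j \<in> J" for j using assms(3) that by blast
qed

text \<open>Collects the quantities that are bounded by a power of \<open>log h\<close> once the
  primes are small.\<close>

definition log_size :: "nat \<Rightarrow> nat set \<Rightarrow> real" where
  "log_size N S = real N + 1 + divisor_mass S"

lemma log_size_ge_1: "finite S \<Longrightarrow> 1 \<le> log_size N S"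
  unfolding log_size_def using divisor_mass_ge_1[of S] by simp

lemma sum_fourier_weight_le_of_cells:
  fixes c :: real
  assumes fin: "finite S" "finite J" and primes: "\<forall>p\<in>S. prime p" and Z: "Z \<subseteq> zero_sums S J" and c: "0 \<le> c"
    and cell: "\<And>A e lam. dyadic_cell S J A e lam \<Longrightarrow> A \<subseteq> Z \<Longrightarrow> A \<noteq> {} \<Longrightarrow> (\<forall>j\<in>J. lam j \<le> N) \<Longrightarrow>
      \<exists>\<rho> B T. inj_on \<rho> J \<and> (1::real) \<le> T \<and>
        (\<forall>j\<in>J \<inter> B. (\<forall>I\<in>first_types J \<rho> j. e I \<le> N) \<and>
          (\<forall>U\<subseteq>S. \<Prod>U \<le> 2 ^ (first_weight J e \<rho> j + 2 ^ card J) \<longrightarrow> real (card (first_types J \<rho> j)) ^ card U \<le> T)) \<and>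
        T ^ card J * 2 ^ (\<Sum>j\<in>J. deficit J e lam \<rho> B j) \<le> c * 2 ^ (N * (card J div 2))"
  shows "(\<Sum>b\<in>Z. \<Prod>j\<in>J. fourier_weight N S (b j)) \<le>
    (2 ^ (4 * 2 ^ card J + 3)) ^ card J * c * log_size N S ^ (card J + 2 ^ card J) * 2 ^ (N * (card J div 2))"
proof -
  define L where "L = log_size N S"
  have L1: "1 \<le> L" unfolding L_def by (rule log_size_ge_1[OF fin(1)])
  have "(\<Sum>b\<in>Z. \<Prod>j\<in>J. fourier_weight N S (b j)) \<le> (2 ^ (4 * 2 ^ card J + 3)) ^ card J * (c * 2 ^ (N * (card J div 2))) *
    ((real N + 1) ^ card J * (divisor_mass S + real N + 1) ^ card (types J))"
    by (rule sum_fourier_weight_by_cells[OF fin primes Z _ cell]) (use c in auto)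
  also have "\<dots> \<le> (2 ^ (4 * 2 ^ card J + 3)) ^ card J * (c * 2 ^ (N * (card J div 2))) * (L ^ card J * L ^ (2 ^ card J))"
  proof (intro mult_left_mono mult_mono)
    show "(real N + 1) ^ card J \<le> L ^ card J"
      using divisor_mass_ge_1[OF fin(1)] by (intro power_mono) (auto simp: L_def log_size_def)
    have "(divisor_mass S + real N + 1) ^ card (types J) = L ^ card (types J)" by (simp add: L_def log_size_def add_ac)
    also have "\<dots> \<le> L ^ (2 ^ card J)" by (rule power_increasing[OF card_types_le[OF fin(2)] L1])
    finally show "(divisor_mass S + real N + 1) ^ card (types J) \<le> L ^ (2 ^ card J)" .
  qed (use L1 c divisor_mass_ge_1[OF fin(1)] in auto)
  finally show ?thesis unfolding L_def by (simp add: power_add mult_ac)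
qed

lemma weighted_count_even:
  assumes "finite S" "finite J" "\<forall>p\<in>S. prime p" "even (card J)"
  shows "weighted_count N S J \<le> (2 ^ (4 * 2 ^ card J + 3)) ^ card J * 2 ^ ((card J div 2) * 2 ^ card J) *
    log_size N S ^ (card J + 2 ^ card J) * 2 ^ (N * (card J div 2))"
  unfolding weighted_count_def
proof (rule sum_fourier_weight_le_of_cells[OF assms(1-3)])
  fix A e lam assume dc: "dyadic_cell S J A e lam" "A \<noteq> {}" "\<forall>j\<in>J. lam j \<le> N"
  interpret cell_exponents J e lam N "2 ^ card J" by (rule cell_exponents_of_cell[OF dc])
  obtain \<rho> where \<rho>: "inj_on \<rho> J" "2 * (\<Sum>j\<in>J. deficit J e lam \<rho> {} j) \<le> card J * (N + 2 ^ card J)"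
    using exists_order_half by blast
  obtain m where m: "card J = 2 * m" using assms(4) by (elim evenE)
  have "(\<Sum>j\<in>J. deficit J e lam \<rho> {} j) \<le> m * 2 ^ card J + N * m" using \<rho>(2) unfolding m by (simp add: algebra_simps)
  then have "(2::real) ^ (\<Sum>j\<in>J. deficit J e lam \<rho> {} j) \<le> 2 ^ (m * 2 ^ card J + N * m)" by (rule power_increasing) simp
  then have "1 ^ card J * (2::real) ^ (\<Sum>j\<in>J. deficit J e lam \<rho> {} j) \<le> 2 ^ ((card J div 2) * 2 ^ card J) * 2 ^ (N * (card J div 2))"
    by (simp add: m power_add)
  then show "\<exists>\<rho> B T. inj_on \<rho> J \<and> (1::real) \<le> T \<and>
        (\<forall>j\<in>J \<inter> B. (\<forall>I\<in>first_types J \<rho> j. e I \<le> N) \<and>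
          (\<forall>U\<subseteq>S. \<Prod>U \<le> 2 ^ (first_weight J e \<rho> j + 2 ^ card J) \<longrightarrow> real (card (first_types J \<rho> j)) ^ card U \<le> T)) \<and>
        T ^ card J * 2 ^ (\<Sum>j\<in>J. deficit J e lam \<rho> B j) \<le> 2 ^ ((card J div 2) * 2 ^ card J) * 2 ^ (N * (card J div 2))"
    using \<rho>(1) by (intro exI[of _ \<rho>] exI[of _ "{}"] exI[of _ 1]) auto
qed auto

lemma weighted_count_three:
  assumes "finite S" "finite J" "\<forall>p\<in>S. prime p" "card J = 3"
  shows "weighted_count N S J \<le> (2 ^ (4 * 2 ^ card J + 3)) ^ card J * 2 ^ (2 * 2 ^ card J) *
    log_size N S ^ (card J + 2 ^ card J) * 2 ^ (N * (card J div 2))"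
  unfolding weighted_count_def
proof (rule sum_fourier_weight_le_of_cells[OF assms(1-3)])
  fix A e lam assume dc: "dyadic_cell S J A e lam" "A \<noteq> {}" "\<forall>j\<in>J. lam j \<le> N"
  interpret cell_exponents J e lam N "2 ^ card J" by (rule cell_exponents_of_cell[OF dc])
  obtain \<rho> B where \<rho>: "inj_on \<rho> J" "B \<subseteq> J" "(\<Sum>j\<in>J. deficit J e lam \<rho> B j) \<le> N + 2 * 2 ^ card J"
    "\<And>j. j \<in> B \<Longrightarrow> (\<forall>I\<in>first_types J \<rho> j. e I \<le> N) \<and> card (first_types J \<rho> j) \<le> 1"
    using exists_order_three[OF assms(4)] by blast
  have "(2::real) ^ (\<Sum>j\<in>J. deficit J e lam \<rho> B j) \<le> 2 ^ (N + 2 * 2 ^ card J)" by (rule power_increasing[OF \<rho>(3)]) simp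
  then have "1 ^ card J * (2::real) ^ (\<Sum>j\<in>J. deficit J e lam \<rho> B j) \<le> 2 ^ (2 * 2 ^ card J) * 2 ^ (N * (card J div 2))"
    by (simp add: assms(4) power_add)
  moreover have "real (card (first_types J \<rho> j)) ^ n \<le> 1" if "j \<in> J \<inter> B" for j n
    using \<rho>(4)[of j] that by (intro power_le_one) auto
  ultimately show "\<exists>\<rho> B T. inj_on \<rho> J \<and> (1::real) \<le> T \<and>
        (\<forall>j\<in>J \<inter> B. (\<forall>I\<in>first_types J \<rho> j. e I \<le> N) \<and>
          (\<forall>U\<subseteq>S. \<Prod>U \<le> 2 ^ (first_weight J e \<rho> j + 2 ^ card J) \<longrightarrow> real (card (first_types J \<rho> j)) ^ card U \<le> T)) \<and>
        T ^ card J * 2 ^ (\<Sum>j\<in>J. deficit J e lam \<rho> B j) \<le> 2 ^ (2 * 2 ^ card J) * 2 ^ (N * (card J div 2))"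
    using \<rho> by (intro exI[of _ \<rho>] exI[of _ B] exI[of _ 1]) blast
qed auto

definition irreducible_sums :: "nat set \<Rightarrow> nat set \<Rightarrow> (nat \<Rightarrow> int) set" where
  "irreducible_sums S J = {b \<in> zero_sums S J. \<forall>T. T \<subseteq> J \<longrightarrow> T \<noteq> {} \<longrightarrow> T \<noteq> J \<longrightarrow> \<not> int (\<Prod>S) dvd (\<Sum>i\<in>T. b i)}"

lemma sum_irreducible_le:
  assumes k: "odd k" "5 \<le> k"
  shows "\<exists>C A. 0 \<le> C \<and> (\<forall>S J N. finite S \<longrightarrow> (\<forall>p\<in>S. prime p) \<longrightarrow> card J = k \<longrightarrow>
    (\<Sum>b\<in>irreducible_sums S J. \<Prod>j\<in>J. fourier_weight N S (b j)) \<le> C * log_size N S ^ A * 2 ^ (N * (k div 2)))"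
proof -
  define K :: nat where "K = 2 ^ k"
  \<comment> \<open>With this \<open>Q\<close>, \<open>s = N div Q\<close> is an admissible saving.
    Division by a further \<open>k\<close> gives \<open>t\<close>, the exponent granted to the
    divisor function at each index, so that \<open>k * t \<le> s\<close>.\<close>
  define Q where "Q = 12 * K * k"
  \<comment> \<open>At most \<open>K\<close> types, each of exponent at most \<open>N\<close>, begin
    at a boosted index, so their primes have product at most \<open>2 ^ (t * M)\<close>; taking
    \<open>M\<close>-th roots leaves \<open>2 ^ t\<close>. The factor 4 makes room for
    \<open>t + 1\<close> and constants.\<close>
  define M where "M = 4 * K * (Q * k)"
  \<comment> \<open>From \<open>N0\<close> on, \<open>t\<close> and hence \<open>s\<close> is at
    least \<open>2 * K\<close>, the loss in the cut condition.\<close>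
  define N0 where "N0 = 2 * K * (Q * k)"
  have K1: "1 \<le> K" by (simp add: K_def)
  have Qk: "0 < Q" "0 < Q * k" using K1 k unfolding Q_def by auto
  have M1: "0 < M" unfolding M_def using K1 Qk by simp
  obtain C1 :: nat where C1: "1 \<le> C1" "\<And>U. finite U \<Longrightarrow> \<forall>p\<in>U. prime p \<Longrightarrow> K ^ (M * card U) \<le> C1 * \<Prod>U"
    using card_primes_power_le[OF K1, of M] by blast
  define c where "c = real C1 ^ k * 2 ^ (k * (N0 + K))"
  have c0: "0 \<le> c" by (simp add: c_def)
  show ?thesis
  proof (intro exI[of _ "(2 ^ (4 * 2 ^ k + 3)) ^ k * c"] exI[of _ "k + 2 ^ k"] conjI allI impI)
    show "0 \<le> (2 ^ (4 * 2 ^ k + 3)) ^ k * c" using c0 by simp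
    fix S J :: "nat set" and N :: nat assume S: "finite S" "\<forall>p\<in>S. prime p" and J: "card J = k"
    have finJ: "finite J" using J k by (metis card.infinite not_numeral_le_zero)
    have "(\<Sum>b\<in>irreducible_sums S J. \<Prod>j\<in>J. fourier_weight N S (b j)) \<le> (2 ^ (4 * 2 ^ card J + 3)) ^ card J * c *
      log_size N S ^ (card J + 2 ^ card J) * 2 ^ (N * (card J div 2))"
    proof (rule sum_fourier_weight_le_of_cells[OF S(1) finJ S(2) _ c0])
      show "irreducible_sums S J \<subseteq> zero_sums S J" by (auto simp: irreducible_sums_def)
      fix A e lam assume dc: "dyadic_cell S J A e lam" and AZ: "A \<subseteq> irreducible_sums S J" and A0: "A \<noteq> {}"
        and lam: "\<forall>j\<in>J. lam j \<le> N"
      interpret cell_exponents J e lam N "2 ^ card J" by (rule cell_exponents_of_cell[OF dc A0 lam])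
      show "\<exists>\<rho> B T. inj_on \<rho> J \<and> (1::real) \<le> T \<and>
        (\<forall>j\<in>J \<inter> B. (\<forall>I\<in>first_types J \<rho> j. e I \<le> N) \<and>
          (\<forall>U\<subseteq>S. \<Prod>U \<le> 2 ^ (first_weight J e \<rho> j + 2 ^ card J) \<longrightarrow> real (card (first_types J \<rho> j)) ^ card U \<le> T)) \<and>
        T ^ card J * 2 ^ (\<Sum>j\<in>J. deficit J e lam \<rho> B j) \<le> c * 2 ^ (N * (card J div 2))"
      proof (cases "N < N0")
        \<comment> \<open>For bounded \<open>N\<close> the unboosted order is enough; its whole
          deficit goes into the constant.\<close>
        case True
        obtain \<rho> where \<rho>: "inj_on \<rho> J" "2 * (\<Sum>j\<in>J. deficit J e lam \<rho> {} j) \<le> card J * (N + 2 ^ card J)"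
          using exists_order_half by blast
        have "(\<Sum>j\<in>J. deficit J e lam \<rho> {} j) \<le> k * (N + K)" using \<rho>(2) unfolding J K_def by linarith
        also have "\<dots> \<le> k * (N0 + K)" using True by simp
        finally have "(2::real) ^ (\<Sum>j\<in>J. deficit J e lam \<rho> {} j) \<le> 2 ^ (k * (N0 + K))" by (rule power_increasing) simp
        also have "\<dots> = 1 * 2 ^ (k * (N0 + K)) * 1" by simp
        also have "\<dots> \<le> c * 2 ^ (N * (card J div 2))"
          unfolding c_def using C1(1) by (intro mult_mono) (auto intro: one_le_power)
        finally have "1 ^ card J * (2::real) ^ (\<Sum>j\<in>J. deficit J e lam \<rho> {} j) \<le> c * 2 ^ (N * (card J div 2))" by simp
        then show ?thesis using \<rho>(1) by (intro exI[of _ \<rho>] exI[of _ "{}"] exI[of _ 1]) auto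
      next
        case False
        define s where "s = N div Q"
        define t where "t = N div (Q * k)"
        have tN: "N < Q * k * (t + 1)" unfolding t_def using dividend_less_times_div[OF Qk(2), of N] by simp
        have t2K: "2 * K \<le> t" unfolding t_def using False Qk(2) by (simp add: less_eq_div_iff_mult_less_eq N0_def)
        have st: "k * t \<le> s" unfolding t_def s_def by (simp add: div_mult2_eq)
        have ts: "t \<le> k * t" using k by simp
        have s1: "1 \<le> s" "2 * K \<le> s" using t2K ts st K1 by linarith+
        have s2: "12 * 2 ^ card J * card J * s \<le> N"
          unfolding J K_def[symmetric] Q_def[symmetric] s_def by simp
        have cut: "m \<le> cut_weight J e T + s"
          if T: "T \<subseteq> J" "T \<noteq> {}" "T \<noteq> J" and m: "\<And>j. j \<in> T \<Longrightarrow> m \<le> lam j" for T m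
        proof -
          have "\<not> int (\<Prod>S) dvd (\<Sum>i\<in>T. b i)" if "b \<in> A" for b using AZ that T unfolding irreducible_sums_def by blast
          then have "m \<le> cut_weight J e T + 2 * 2 ^ card J" by (rule dyadic_cell.le_cut_weight[OF dc A0 _ T(1) m])
          then show ?thesis using s1(2) unfolding K_def J by linarith
        qed
        obtain \<rho> where \<rho>: "inj_on \<rho> J" "(\<Sum>j\<in>J. boosted_deficit J e lam \<rho> j) + s \<le> (card J div 2) * N + card J * 2 ^ card J"
          using exists_order_irreducible[OF _ _ s1(1) s2 cut] k J by blast
        define B where "B = {i. \<forall>I\<in>first_types J \<rho> i. e I \<le> N}"
        define T where "T = real C1 * 2 ^ t"
        have "(\<Sum>j\<in>J. deficit J e lam \<rho> B j) \<le> (\<Sum>j\<in>J. boosted_deficit J e lam \<rho> j)"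
          unfolding B_def by (intro sum_mono deficit_boost_le \<rho>(1))
        then have def: "k * t + (\<Sum>j\<in>J. deficit J e lam \<rho> B j) \<le> k * K + N * (k div 2)"
          using \<rho>(2) st unfolding J K_def[symmetric] by (simp add: mult.commute)
        have "1 * 1 \<le> T" unfolding T_def by (rule mult_mono) (use C1(1) in auto)
        then have T1: "1 \<le> T" by simp
        have "T ^ card J * 2 ^ (\<Sum>j\<in>J. deficit J e lam \<rho> B j) = real C1 ^ k * 2 ^ (k * t + (\<Sum>j\<in>J. deficit J e lam \<rho> B j))"
          unfolding T_def J by (simp add: power_mult_distrib power_add power_mult[symmetric] mult.commute)
        also have "\<dots> \<le> real C1 ^ k * 2 ^ (k * (N0 + K) + N * (k div 2))"
        proof (intro mult_left_mono power_increasing)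
          show "k * t + (\<Sum>j\<in>J. deficit J e lam \<rho> B j) \<le> k * (N0 + K) + N * (k div 2)"
            using def by (simp add: distrib_left)
        qed auto
        also have "\<dots> = c * 2 ^ (N * (card J div 2))" unfolding c_def J by (simp add: power_add)
        finally have Dle: "T ^ card J * 2 ^ (\<Sum>j\<in>J. deficit J e lam \<rho> B j) \<le> c * 2 ^ (N * (card J div 2))" .
        have Tle: "real (card (first_types J \<rho> j)) ^ card U \<le> T"
          if j: "j \<in> J \<inter> B" and U: "U \<subseteq> S" "\<Prod>U \<le> 2 ^ (first_weight J e \<rho> j + 2 ^ card J)" for j U
        proof -
          have ft: "first_types J \<rho> j \<subseteq> types J" by (auto simp: first_types_def)
          have cf: "card (first_types J \<rho> j) \<le> K"
            using card_mono[OF finite_types[OF finJ] ft] card_types_le[OF finJ] unfolding K_def J by linarith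
          have "first_weight J e \<rho> j \<le> (\<Sum>I\<in>first_types J \<rho> j. N)"
            unfolding first_weight_def by (rule sum_mono) (use j in \<open>auto simp: B_def\<close>)
          also have "\<dots> \<le> K * N" using cf by simp
          finally have "first_weight J e \<rho> j + 2 ^ card J \<le> K * N + K" unfolding J K_def by simp
          also have "\<dots> \<le> K * (Q * k * (t + 1))" using mult_left_mono[of "N + 1" "Q * k * (t + 1)" K] tN by (simp only: distrib_left mult_1_right)
          also have "\<dots> \<le> K * (Q * k * (4 * t))" using t2K K1 by (intro mult_left_mono) auto
          also have "\<dots> = t * M" unfolding M_def by (simp add: ac_simps)
          finally have "(2::nat) ^ (first_weight J e \<rho> j + 2 ^ card J) \<le> 2 ^ (t * M)" by (rule power_increasing) simp
          then have PU: "\<Prod>U \<le> 2 ^ (t * M)" using U(2) by linarith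
          have "(K ^ card U) ^ M = K ^ (M * card U)" by (simp add: power_mult[symmetric] mult.commute)
          also have "\<dots> \<le> C1 * \<Prod>U" using C1(2)[of U] U(1) S finite_subset by blast
          also have "\<dots> \<le> C1 ^ M * 2 ^ (t * M)"
            by (rule mult_mono[OF _ PU]) (use self_le_power[OF C1(1) M1] in simp_all)
          also have "\<dots> = (C1 * 2 ^ t) ^ M" by (simp add: power_mult_distrib power_mult)
          finally have "K ^ card U \<le> C1 * 2 ^ t" using M1 by (simp add: power_mono_iff)
          then have "real (K ^ card U) \<le> real (C1 * 2 ^ t)" by (simp only: of_nat_le_iff)
          moreover have "real (card (first_types J \<rho> j)) ^ card U \<le> real K ^ card U" using cf by (intro power_mono) auto
          ultimately show ?thesis unfolding T_def by simp
        qed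
        have "\<forall>j\<in>J \<inter> B. (\<forall>I\<in>first_types J \<rho> j. e I \<le> N) \<and>
          (\<forall>U\<subseteq>S. \<Prod>U \<le> 2 ^ (first_weight J e \<rho> j + 2 ^ card J) \<longrightarrow> real (card (first_types J \<rho> j)) ^ card U \<le> T)"
        proof (intro ballI conjI allI impI)
          fix j I assume "j \<in> J \<inter> B" "I \<in> first_types J \<rho> j"
          then show "e I \<le> N" by (simp add: B_def)
        next
          fix j U assume "j \<in> J \<inter> B" "U \<subseteq> S" "\<Prod>U \<le> 2 ^ (first_weight J e \<rho> j + 2 ^ card J)"
          then show "real (card (first_types J \<rho> j)) ^ card U \<le> T" by (rule Tle)
        qed
        then show ?thesis using \<rho>(1) T1 Dle by blast
      qed
    qed
    then show "(\<Sum>b\<in>irreducible_sums S J. \<Prod>j\<in>J. fourier_weight N S (b j))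
      \<le> (2 ^ (4 * 2 ^ k + 3)) ^ k * c * log_size N S ^ (k + 2 ^ k) * 2 ^ (N * (k div 2))" unfolding J .
  qed
qed

lemma sum_UNION_le:
  fixes f :: "'a \<Rightarrow> real"
  assumes "finite I" "\<And>i. finite (A i)" "\<And>x. 0 \<le> f x"
  shows "sum f (\<Union>i\<in>I. A i) \<le> (\<Sum>i\<in>I. sum f (A i))"
  using assms(1)
proof (induction I rule: finite_induct)
  case (insert i I)
  have "sum f (A i \<union> (\<Union>i\<in>I. A i)) + sum f (A i \<inter> (\<Union>i\<in>I. A i)) = sum f (A i) + sum f (\<Union>i\<in>I. A i)"
    by (rule sum.union_inter) (use insert assms(2) in auto)
  moreover have "0 \<le> sum f (A i \<inter> (\<Union>i\<in>I. A i))" using assms(3) by (intro sum_nonneg)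
  ultimately show ?case using insert by simp
qed simp

lemma weighted_count_one:
  assumes "finite S" "\<forall>p\<in>S. prime p" "card J = 1"
  shows "weighted_count N S J = 0"
proof -
  obtain j where J: "J = {j}" using assms(3) card_1_singletonE by blast
  have "zero_sums S J = {}"
  proof (rule ccontr)
    assume "zero_sums S J \<noteq> {}"
    then obtain b where b: "b j \<in> nonzero_residues S" "int (\<Prod>S) dvd b j" unfolding zero_sums_def J by auto
    have "0 < \<Prod>S" using assms(1,2) by (intro prod_pos) (auto intro: prime_gt_0_nat)
    moreover have "b j \<noteq> 0" "2 * \<bar>b j\<bar> \<le> int (\<Prod>S)" using b(1) by (simp_all add: nonzero_residues_def)
    moreover have "\<bar>int (\<Prod>S)\<bar> \<le> \<bar>b j\<bar>" by (rule dvd_imp_le_int[OF _ b(2)]) fact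
    ultimately show False by linarith
  qed
  then show ?thesis unfolding weighted_count_def by simp
qed

text \<open>Induction because, for odd \<open>k\<close> from 5 on, tuples with a vanishing proper
  subsum escape the cut condition. They split into two shorter tuples, and halves rounded down are
  superadditive, so the product of the two smaller bounds stays within the exponent.\<close>

theorem weighted_count_bound:
  "\<exists>C A. 0 \<le> C \<and> (\<forall>S J N. finite S \<longrightarrow> (\<forall>p\<in>S. prime p) \<longrightarrow> finite J \<longrightarrow> card J = k \<longrightarrow>
    weighted_count N S J \<le> C * log_size N S ^ A * 2 ^ (N * (k div 2)))"
proof (induction k rule: less_induct)
  case (less k)
  consider "even k" | "k = 1" | "k = 3" | "odd k" "5 \<le> k"
  proof -
    have "k = 1 \<or> k = 3 \<or> 5 \<le> k" if "odd k" using that by presburger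
    then show thesis using that by blast
  qed
  then show ?case
  proof cases
    case 1
    then show ?thesis using weighted_count_even
      by (intro exI[of _ "(2 ^ (4 * 2 ^ k + 3)) ^ k * 2 ^ ((k div 2) * 2 ^ k)"] exI[of _ "k + 2 ^ k"]) auto
  next
    case 2
    then show ?thesis using weighted_count_one by (intro exI[of _ 0]) auto
  next
    case 3
    then show ?thesis using weighted_count_three
      by (intro exI[of _ "(2 ^ (4 * 2 ^ k + 3)) ^ k * 2 ^ (2 * 2 ^ k)"] exI[of _ "k + 2 ^ k"]) auto
  next
    case 4
    obtain C0 A0 where C0: "\<And>i. i < k \<Longrightarrow> (0::real) \<le> C0 i \<and> (\<forall>S J N. finite S \<longrightarrow> (\<forall>p\<in>S. prime p) \<longrightarrow> finite J \<longrightarrow> card J = i \<longrightarrow>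
      weighted_count N S J \<le> C0 i * log_size N S ^ A0 i * 2 ^ (N * (i div 2)))"
      using less by metis
    define C1 where "C1 = (\<Sum>i<k. C0 i)"
    define A1 where "A1 = (\<Sum>i<k. A0 i)"
    have C1: "0 \<le> C1" unfolding C1_def using C0 by (intro sum_nonneg) auto
    have small: "weighted_count N S J \<le> C1 * log_size N S ^ A1 * 2 ^ (N * (card J div 2))"
      if "finite S" "\<forall>p\<in>S. prime p" "finite J" "card J < k" for S J N
    proof -
      have L: "1 \<le> log_size N S" by (rule log_size_ge_1[OF that(1)])
      have le: "C0 (card J) \<le> C1" "A0 (card J) \<le> A1"
        unfolding C1_def A1_def using that(4) C0 by (auto intro!: member_le_sum)
      have "weighted_count N S J \<le> C0 (card J) * log_size N S ^ A0 (card J) * 2 ^ (N * (card J div 2))"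
        using C0[OF that(4)] that by blast
      also have "\<dots> \<le> C1 * log_size N S ^ A1 * 2 ^ (N * (card J div 2))"
        by (intro mult_right_mono mult_mono le power_increasing L) (use L C1 in auto)
      finally show ?thesis .
    qed
    obtain C2 A2 where C2: "0 \<le> C2" "\<And>S J N. finite S \<Longrightarrow> \<forall>p\<in>S. prime p \<Longrightarrow> card J = k \<Longrightarrow>
      (\<Sum>b\<in>irreducible_sums S J. \<Prod>j\<in>J. fourier_weight N S (b j)) \<le> C2 * log_size N S ^ A2 * 2 ^ (N * (k div 2))"
      using sum_irreducible_le[OF 4] by blast
    show ?thesis
    proof (intro exI[of _ "C2 + 2 ^ k * (C1 * C1)"] exI[of _ "A2 + 2 * A1"] conjI allI impI)
      show "0 \<le> C2 + 2 ^ k * (C1 * C1)" using C1 C2(1) by simp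
      fix S J N assume S: "finite S" "\<forall>p\<in>S. prime (p::nat)" and J: "finite (J::nat set)" "card J = k"
      define L where "L = log_size N S"
      have L: "1 \<le> L" unfolding L_def by (rule log_size_ge_1[OF S(1)])
      define w where "w = (\<lambda>b. \<Prod>j\<in>J. fourier_weight N S (b j))"
      have w0: "0 \<le> w b" for b unfolding w_def by (intro prod_nonneg fourier_weight_nonneg)
      define TT where "TT = Pow J - {{}, J}"
      define Y where "Y = (\<lambda>T. {b \<in> zero_sums S J. int (\<Prod>S) dvd (\<Sum>i\<in>T. b i)})"
      have fin: "finite (zero_sums S J)" by (rule finite_zero_sums[OF J(1)])
      have fTT: "finite TT" using J by (simp add: TT_def)
      have sub: "zero_sums S J \<subseteq> irreducible_sums S J \<union> (\<Union>T\<in>TT. Y T)"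
        unfolding irreducible_sums_def TT_def Y_def by auto
      have fU: "finite (irreducible_sums S J)" "\<And>T. finite (Y T)"
        using fin by (simp_all add: irreducible_sums_def Y_def)
      have "weighted_count N S J \<le> sum w (irreducible_sums S J \<union> (\<Union>T\<in>TT. Y T))"
        unfolding weighted_count_def w_def[symmetric] using fU fTT w0 sub by (intro sum_mono2) auto
      also have "\<dots> \<le> sum w (irreducible_sums S J) + sum w (\<Union>T\<in>TT. Y T)"
        using sum_Un[of "irreducible_sums S J" "\<Union>T\<in>TT. Y T" w] sum_nonneg[of "irreducible_sums S J \<inter> (\<Union>T\<in>TT. Y T)" w] w0 fU fTT by auto
      also have "\<dots> \<le> sum w (irreducible_sums S J) + (\<Sum>T\<in>TT. sum w (Y T))"
        by (intro add_left_mono sum_UNION_le) (use fTT fU w0 in auto)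
      also have "\<dots> \<le> C2 * L ^ A2 * 2 ^ (N * (k div 2)) + (\<Sum>T\<in>TT. C1 * C1 * L ^ (2 * A1) * 2 ^ (N * (k div 2)))"
      proof (intro add_mono sum_mono)
        show "sum w (irreducible_sums S J) \<le> C2 * L ^ A2 * 2 ^ (N * (k div 2))"
          unfolding w_def L_def by (rule C2(2)[OF S J(2)])
        fix T assume "T \<in> TT"
        then have T: "T \<subseteq> J" "T \<noteq> {}" "T \<noteq> J" by (auto simp: TT_def)
        have fT: "finite T" "finite (J - T)" using T J finite_subset by auto
        have cc: "card T + card (J - T) = k" using card_Diff_subset[OF fT(1) T(1)] card_mono[OF J(1) T(1)] J(2) by simp
        have "0 < card T" "0 < card (J - T)" using fT T by (auto simp: card_gt_0_iff)
        then have c: "card T < k" "card (J - T) < k" using cc by auto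
        have "sum w (Y T) \<le> weighted_count N S T * weighted_count N S (J - T)"
          unfolding w_def Y_def by (rule weighted_count_split[OF S(1) J(1) T(1)])
        also have "\<dots> \<le> (C1 * L ^ A1 * 2 ^ (N * (card T div 2))) * (C1 * L ^ A1 * 2 ^ (N * (card (J - T) div 2)))"
          unfolding L_def by (intro mult_mono small S fT c weighted_count_nonneg mult_nonneg_nonneg C1)
            (use log_size_ge_1[OF S(1), of N] in auto)
        also have "\<dots> = C1 * C1 * L ^ (2 * A1) * 2 ^ (N * (card T div 2) + N * (card (J - T) div 2))"
          by (simp add: power_add mult_2)
        also have "\<dots> \<le> C1 * C1 * L ^ (2 * A1) * 2 ^ (N * (k div 2))"
        proof (intro mult_left_mono power_increasing)
          have "card T div 2 + card (J - T) div 2 \<le> k div 2" using cc by linarith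
          then have "N * (card T div 2 + card (J - T) div 2) \<le> N * (k div 2)" by (rule mult_le_mono2)
          then show "N * (card T div 2) + N * (card (J - T) div 2) \<le> N * (k div 2)" by (simp add: distrib_left)
        qed (use C1 L in auto)
        finally show "sum w (Y T) \<le> C1 * C1 * L ^ (2 * A1) * 2 ^ (N * (k div 2))" .
      qed
      also have "\<dots> = C2 * L ^ A2 * 2 ^ (N * (k div 2)) + real (card TT) * (C1 * C1 * L ^ (2 * A1) * 2 ^ (N * (k div 2)))" by simp
      also have "\<dots> \<le> C2 * L ^ (A2 + 2 * A1) * 2 ^ (N * (k div 2)) + 2 ^ k * (C1 * C1 * L ^ (A2 + 2 * A1) * 2 ^ (N * (k div 2)))"
      proof (intro add_mono mult_mono power_increasing mult_left_mono mult_right_mono L)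
        have "card TT \<le> card (Pow J)" using J(1) unfolding TT_def by (intro card_mono) auto
        then have "real (card TT) \<le> real (2 ^ k)" using J by (simp add: card_Pow)
        then show "real (card TT) \<le> 2 ^ k" by simp
      qed (use C1 C2 L in auto)
      also have "\<dots> = (C2 + 2 ^ k * (C1 * C1)) * L ^ (A2 + 2 * A1) * 2 ^ (N * (k div 2))" by (simp add: algebra_simps)
      finally show "weighted_count N S J \<le> (C2 + 2 ^ k * (C1 * C1)) * log_size N S ^ (A2 + 2 * A1) * 2 ^ (N * (k div 2))"
        unfolding L_def .
    qed
  qed
qed

section \<open>The Fourier expansion\<close>

definition unit_root :: "nat \<Rightarrow> int \<Rightarrow> complex" where
  "unit_root q x = cis (2 * pi * (real_of_int x / real q))"

lemma unit_root_add: "unit_root q (x + y) = unit_root q x * unit_root q y"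
  unfolding unit_root_def cis_mult by (simp add: add_divide_distrib distrib_left)

lemma unit_root_0 [simp]: "unit_root q 0 = 1"
  by (simp add: unit_root_def)

lemma norm_unit_root [simp]: "norm (unit_root q x) = 1"
  by (simp add: unit_root_def)

lemma unit_root_mult_nat: "unit_root q (b * int n) = unit_root q b ^ n"
  by (induction n) (simp_all add: distrib_left unit_root_add)

lemma unit_root_eq_1_iff:
  assumes "0 < q"
  shows "unit_root q x = 1 \<longleftrightarrow> int q dvd x"
proof
  assume "unit_root q x = 1"
  then have "cos (2 * pi * (real_of_int x / real q)) = 1" by (simp add: unit_root_def complex_eq_iff)
  then obtain n :: int where "2 * pi * (real_of_int x / real q) = real_of_int n * 2 * pi"
    using cos_one_2pi_int by blast
  then have "real_of_int x = real_of_int (n * int q)" using assms by (simp add: field_simps)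
  then have "x = n * int q" by (simp only: of_int_eq_iff)
  then show "int q dvd x" by simp
next
  assume "int q dvd x"
  then obtain n where "x = int q * n" by blast
  then have "2 * pi * (real_of_int x / real q) = 2 * pi * real_of_int n" using assms by simp
  then show "unit_root q x = 1" by (simp add: unit_root_def cis.ctr complex_eq_iff sin_int_2pin cos_int_2pin)
qed

lemma unit_root_cong: "0 < q \<Longrightarrow> int q dvd x - y \<Longrightarrow> unit_root q x = unit_root q y"
  using unit_root_add[of q "x - y" y] unit_root_eq_1_iff[of q "x - y"] by simp

lemma sum_unit_root:
  assumes "0 < q"
  shows "(\<Sum>n<q. unit_root q (b * int n)) = (if int q dvd b then of_nat q else 0)"
proof (cases "int q dvd b")
  case True
  then show ?thesis using unit_root_eq_1_iff[OF assms, of b] by (simp add: unit_root_mult_nat)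
next
  case False
  have "unit_root q b \<noteq> 1" using False unit_root_eq_1_iff[OF assms] by blast
  moreover have "unit_root q b ^ q = 1"
    unfolding unit_root_mult_nat[symmetric] by (subst unit_root_eq_1_iff[OF assms]) simp
  ultimately show ?thesis using False by (simp add: unit_root_mult_nat geometric_sum)
qed

lemma sum_unit_root_1:
  assumes "0 < q"
  shows "(\<Sum>n=1..q. unit_root q (b * int n)) = (if int q dvd b then of_nat q else 0)"
proof -
  have "unit_root q (b * int q) = 1" by (subst unit_root_eq_1_iff[OF assms]) simp
  then have "(\<Sum>n<Suc q. unit_root q (b * int n)) = (\<Sum>n<q. unit_root q (b * int n)) + 1" by simp
  moreover have "(\<Sum>n<Suc q. unit_root q (b * int n)) = 1 + (\<Sum>n=1..q. unit_root q (b * int n))"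
  proof -
    have "{..<Suc q} = insert 0 {1..q}" by auto
    then show ?thesis by simp
  qed
  ultimately show ?thesis using sum_unit_root[OF assms, of b] by simp
qed

text \<open>One representative for each class, unlike \<open>nonzero_residues\<close>, which
  contains both signs of q/2 when the modulus is even.\<close>

definition centred :: "nat \<Rightarrow> int set" where
  "centred q = (\<lambda>b. if 2 * int b \<le> int q then int b else int b - int q) ` {..<q}"

lemma sum_centred:
  assumes "0 < q"
  shows "(\<Sum>b\<in>centred q. unit_root q (b * x)) = (if int q dvd x then of_nat q else 0)"
proof -
  have inj: "inj_on (\<lambda>b. if 2 * int b \<le> int q then int b else int b - int q) {..<q}"
    by (auto simp: inj_on_def split: if_splits)
  have "(\<Sum>b\<in>centred q. unit_root q (b * x)) = (\<Sum>b<q. unit_root q ((if 2 * int b \<le> int q then int b else int b - int q) * x))"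
    unfolding centred_def sum.reindex[OF inj] comp_def ..
  also have "\<dots> = (\<Sum>b<q. unit_root q (x * int b))"
    by (rule sum.cong[OF refl], rule unit_root_cong[OF assms]) (auto simp: algebra_simps)
  finally show ?thesis using sum_unit_root[OF assms] by simp
qed

lemma finite_centred: "finite (centred q)"
  by (simp add: centred_def)

lemma centred_bound: "b \<in> centred q \<Longrightarrow> 2 * \<bar>b\<bar> \<le> int q"
  by (auto simp: centred_def split: if_splits)

lemma zero_in_centred: "0 < q \<Longrightarrow> 0 \<in> centred q"
  unfolding centred_def by (rule image_eqI[of _ _ 0]) auto

lemma fourier_inversion:
  fixes f :: "int \<Rightarrow> complex"
  assumes q: "0 < q" and per: "\<And>m n. int q dvd m - n \<Longrightarrow> f m = f n"
  shows "f m = (\<Sum>b\<in>centred q. (\<Sum>n<q. f (int n) * unit_root q (- b * int n)) / of_nat q * unit_root q (b * m))"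
proof -
  have "(\<Sum>b\<in>centred q. (\<Sum>n<q. f (int n) * unit_root q (- b * int n)) / of_nat q * unit_root q (b * m))
    = (\<Sum>b\<in>centred q. \<Sum>n<q. f (int n) / of_nat q * unit_root q (b * (m - int n)))"
  proof (rule sum.cong[OF refl])
    fix b
    have "unit_root q (b * (m - int n)) = unit_root q (- b * int n) * unit_root q (b * m)" for n
      unfolding unit_root_add[symmetric] by (simp add: algebra_simps)
    then show "(\<Sum>n<q. f (int n) * unit_root q (- b * int n)) / of_nat q * unit_root q (b * m)
      = (\<Sum>n<q. f (int n) / of_nat q * unit_root q (b * (m - int n)))"
      unfolding sum_divide_distrib sum_distrib_right by (intro sum.cong refl) simp
  qed
  also have "\<dots> = (\<Sum>n<q. f (int n) / of_nat q * (\<Sum>b\<in>centred q. unit_root q (b * (m - int n))))"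
    by (subst sum.swap) (simp add: sum_distrib_left)
  also have "\<dots> = (\<Sum>n<q. if n = nat (m mod int q) then f m else 0)"
  proof (rule sum.cong[OF refl])
    fix n assume n: "n \<in> {..<q}"
    have eq: "int q dvd m - int n \<longleftrightarrow> n = nat (m mod int q)"
    proof -
      have "int q dvd m - int n \<longleftrightarrow> m mod int q = int n mod int q" by (simp add: mod_eq_dvd_iff)
      also have "\<dots> \<longleftrightarrow> n = nat (m mod int q)" using n q by auto
      finally show ?thesis .
    qed
    show "f (int n) / of_nat q * (\<Sum>b\<in>centred q. unit_root q (b * (m - int n))) = (if n = nat (m mod int q) then f m else 0)"
      unfolding sum_centred[OF q] using eq per[of m "int n"] q by auto
  qed
  also have "\<dots> = f m"
  proof -
    have "nat (m mod int q) < q" using q by (simp add: nat_less_iff)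
    then show ?thesis by simp
  qed
  finally show ?thesis by simp
qed

lemma pi_ge_3: "3 \<le> pi"
  using sin_x_le_x[of "pi / 6"] by (simp add: sin_30)

text \<open>The norm is 2 |sin x| with x = pi b / q. A crude sine bound suffices: for |x| at most 2
  the cubic Taylor estimate gives |sin x| \<ge> |x| / 3, and pi / 3 is at least 1.\<close>

lemma norm_unit_root_minus_1_ge:
  assumes "0 < q" "2 * \<bar>b\<bar> \<le> int q"
  shows "2 * (\<bar>real_of_int b\<bar> / real q) \<le> norm (unit_root q b - 1)"
proof -
  define x where "x = pi * (real_of_int b / real q)"
  have b: "2 * \<bar>real_of_int b\<bar> \<le> real q" using assms(2) by linarith
  then have ax: "\<bar>x\<bar> = pi * (\<bar>real_of_int b\<bar> / real q)" by (simp add: x_def abs_mult)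
  have "\<bar>real_of_int b\<bar> / real q \<le> 1 / 2" using b assms(1) by (simp add: field_simps)
  then have "\<bar>x\<bar> \<le> pi * (1 / 2)" unfolding ax by (intro mult_left_mono) auto
  then have x2: "\<bar>x\<bar> \<le> 2" using pi_less_4 by linarith
  have "\<bar>sin x - (\<Sum>m<3. sin_coeff m * x ^ m)\<bar> \<le> inverse (fact 3) * \<bar>x\<bar> ^ 3" by (rule Maclaurin_sin_bound)
  then have s: "\<bar>sin x - x\<bar> \<le> \<bar>x\<bar> ^ 3 / 6"
    by (simp add: sin_coeff_def numeral_3_eq_3 fact_numeral)
  have "\<bar>x\<bar> ^ 3 = \<bar>x\<bar> * (\<bar>x\<bar> * \<bar>x\<bar>)" by (simp add: numeral_3_eq_3)
  also have "\<dots> \<le> \<bar>x\<bar> * (2 * 2)" by (intro mult_left_mono mult_mono x2) auto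
  finally have "\<bar>x\<bar> ^ 3 / 6 \<le> 2 / 3 * \<bar>x\<bar>" by simp
  then have "\<bar>x\<bar> / 3 \<le> \<bar>sin x\<bar>" using s by linarith
  moreover have "\<bar>real_of_int b\<bar> / real q \<le> \<bar>x\<bar> / 3"
    unfolding ax using mult_right_mono[of 3 pi "\<bar>real_of_int b\<bar> / real q"] pi_ge_3 by simp
  ultimately have "2 * (\<bar>real_of_int b\<bar> / real q) \<le> 2 * \<bar>sin x\<bar>" by linarith
  also have "\<dots> = norm (unit_root q b - 1)"
  proof -
    have "unit_root q b - 1 = cis x * (cis x - cis (- x))"
      unfolding unit_root_def right_diff_distrib cis_mult by (simp add: x_def mult.assoc)
    also have "cis x - cis (- x) = Complex 0 (2 * sin x)" by (simp add: complex_eq_iff)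
    finally have "norm (unit_root q b - 1) = norm (cis x) * norm (Complex 0 (2 * sin x))" by (simp only: norm_mult)
    then show ?thesis by (simp add: complex_norm real_sqrt_mult)
  qed
  finally show ?thesis .
qed

lemma norm_sum_unit_root_le:
  assumes "0 < q" "2 * \<bar>b\<bar> \<le> int q" "b \<noteq> 0"
  shows "norm (\<Sum>i<h. unit_root q (b * int i)) \<le> min (real h) (real q / \<bar>real_of_int b\<bar>)"
proof -
  have "norm (\<Sum>i<h. unit_root q (b * int i)) \<le> (\<Sum>i<h. norm (unit_root q (b * int i)))" by (rule norm_sum)
  then have 1: "norm (\<Sum>i<h. unit_root q (b * int i)) \<le> real h" by simp
  define d where "d = norm (unit_root q b - 1)"
  have d: "2 * (\<bar>real_of_int b\<bar> / real q) \<le> d" unfolding d_def by (rule norm_unit_root_minus_1_ge[OF assms(1,2)])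
  have b0: "0 < \<bar>real_of_int b\<bar> / real q" using assms by simp
  then have d0: "0 < d" using d by linarith
  then have ne: "unit_root q b \<noteq> 1" by (auto simp: d_def)
  have "norm (\<Sum>i<h. unit_root q (b * int i)) = norm (unit_root q b ^ h - 1) / d"
    unfolding unit_root_mult_nat d_def by (simp add: geometric_sum[OF ne] norm_divide)
  also have "\<dots> \<le> 2 / d"
  proof (rule divide_right_mono)
    have "norm (unit_root q b ^ h - 1) \<le> norm (unit_root q b ^ h) + norm (1::complex)" by (rule norm_triangle_ineq4)
    then show "norm (unit_root q b ^ h - 1) \<le> 2" by (simp add: norm_power)
  qed (use d0 in simp)
  also have "\<dots> \<le> 2 / (2 * (\<bar>real_of_int b\<bar> / real q))" by (intro divide_left_mono[OF d] mult_pos_pos d0 b0) simp_all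
  also have "\<dots> = real q / \<bar>real_of_int b\<bar>" by simp
  finally show ?thesis using 1 by simp
qed

section \<open>Fourier coefficients of the coprimality indicator\<close>

definition coprime_indicator :: "nat set \<Rightarrow> int \<Rightarrow> complex" where
  "coprime_indicator S m = (\<Prod>p\<in>S. 1 - of_bool (int p dvd m))"

definition coprime_density :: "nat set \<Rightarrow> real" where
  "coprime_density S = (\<Prod>p\<in>S. 1 - 1 / real p)"

lemma dvd_int_prod_primes_iff:
  assumes "finite V" "\<forall>p\<in>V. prime p"
  shows "int (\<Prod>V) dvd x \<longleftrightarrow> (\<forall>p\<in>V. int p dvd x)"
proof
  assume d: "int (\<Prod>V) dvd x"
  show "\<forall>p\<in>V. int p dvd x"
  proof
    fix p assume "p \<in> V"
    then have "int p dvd int (\<Prod>V)" using dvd_prodI[OF assms(1), of p "\<lambda>x. x"] by (simp only: of_nat_dvd_iff)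
    then show "int p dvd x" using d dvd_trans by blast
  qed
qed (use prod_primes_dvd[OF assms] in blast)

lemma coprime_prod_primes_iff:
  assumes "finite S" "\<forall>p\<in>S. prime p"
  shows "gcd m (int (\<Prod>S)) = 1 \<longleftrightarrow> (\<forall>p\<in>S. \<not> int p dvd m)"
proof -
  have "coprime m (int (\<Prod>S)) \<longleftrightarrow> (\<forall>p\<in>S. coprime m (int p))"
    using assms(1) by (induction S rule: finite_induct) simp_all
  also have "\<dots> \<longleftrightarrow> (\<forall>p\<in>S. \<not> int p dvd m)"
  proof (rule ball_cong[OF refl])
    fix p assume "p \<in> S"
    then have p: "prime (int p)" using assms(2) by simp
    show "coprime m (int p) \<longleftrightarrow> \<not> int p dvd m"
    proof
      assume "coprime m (int p)"
      then show "\<not> int p dvd m" using coprime_common_divisor[of m "int p" "int p"] not_prime_unit[of "int p"] p dvd_refl by metis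
    next
      assume "\<not> int p dvd m"
      then show "coprime m (int p)" using prime_imp_coprime[OF p] coprime_commute by blast
    qed
  qed
  finally show ?thesis by (simp only: coprime_iff_gcd_eq_1)
qed

lemma coprime_indicator_eq:
  assumes "finite S" "\<forall>p\<in>S. prime p"
  shows "coprime_indicator S m = of_bool (gcd m (int (\<Prod>S)) = 1)"
proof (cases "\<forall>p\<in>S. \<not> int p dvd m")
  case True
  then show ?thesis unfolding coprime_indicator_def using coprime_prod_primes_iff[OF assms, of m] by simp
next
  case False
  then have "coprime_indicator S m = 0" unfolding coprime_indicator_def using assms(1) by (intro prod_zero) auto
  then show ?thesis using coprime_prod_primes_iff[OF assms, of m] False by simp
qed

text \<open>Expanding the indicator by inclusion--exclusion, the multiples of \<open>\<Prod>D\<close> contribute a complete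
  exponential sum modulo the product of the other primes.\<close>

lemma coprime_indicator_transform:
  assumes fin: "finite S" and primes: "\<forall>p\<in>S. prime p"
  shows "(\<Sum>n<\<Prod>S. coprime_indicator S (int n) * unit_root (\<Prod>S) (- b * int n))
    = (\<Prod>p\<in>S. (if int p dvd b then of_nat p else 0) - 1)"
proof -
  define q where "q = \<Prod>S"
  have q0: "0 < q" unfolding q_def using primes fin by (intro prod_pos) (auto intro: prime_gt_0_nat)
  have ind: "coprime_indicator S m = (\<Sum>D\<in>Pow S. (- 1) ^ card D * of_bool (int (\<Prod>D) dvd m))" for m
  proof -
    have "coprime_indicator S m = (\<Prod>p\<in>S. - of_bool (int p dvd m) + 1)" unfolding coprime_indicator_def by simp
    also have "\<dots> = (\<Sum>D\<in>Pow S. (\<Prod>p\<in>D. - of_bool (int p dvd m)) * (\<Prod>p\<in>S - D. 1))"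
      by (rule prod_add[OF fin])
    also have "\<dots> = (\<Sum>D\<in>Pow S. (- 1) ^ card D * of_bool (int (\<Prod>D) dvd m))"
    proof (rule sum.cong[OF refl])
      fix D assume "D \<in> Pow S"
      then have D: "finite D" "\<forall>p\<in>D. prime p" using fin primes finite_subset by auto
      have "(\<Prod>p\<in>D. of_bool (int p dvd m)) = (of_bool (\<forall>p\<in>D. int p dvd m) :: complex)"
        using D(1) by (induction D rule: finite_induct) auto
      moreover have "(\<Prod>p\<in>D. - of_bool (int p dvd m)) = (\<Prod>p\<in>D. (- 1) * (of_bool (int p dvd m) :: complex))" by simp
      ultimately show "(\<Prod>p\<in>D. - of_bool (int p dvd m)) * (\<Prod>p\<in>S - D. 1) = (- 1) ^ card D * (of_bool (int (\<Prod>D) dvd m) :: complex)"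
        unfolding prod.distrib dvd_int_prod_primes_iff[OF D] by simp
    qed
    finally show ?thesis .
  qed
  have inner: "(\<Sum>n<q. of_bool (int (\<Prod>D) dvd int n) * unit_root q (- b * int n))
    = (\<Prod>p\<in>S - D. if int p dvd b then of_nat p else 0)" if D: "D \<in> Pow S" for D
  proof -
    define d where "d = \<Prod>D"
    define r where "r = \<Prod>(S - D)"
    have fD: "finite (S - D)" "\<forall>p\<in>S - D. prime p" using fin primes by auto
    have "D \<subseteq> S" using D by blast
    then have qrd: "q = r * d" unfolding q_def r_def d_def using fin by (intro prod.subset_diff)
    have d0: "0 < d" "0 < r" using q0 unfolding qrd by auto
    have inj: "inj_on (\<lambda>n. d * n) {..<r}" using d0 by (auto simp: inj_on_def)
    have "(\<Sum>n<q. of_bool (int d dvd int n) * unit_root q (- b * int n)) = (\<Sum>n\<in>{n \<in> {..<q}. d dvd n}. unit_root q (- b * int n))"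
      by (intro sum.mono_neutral_cong_right) auto
    also have "{n \<in> {..<q}. d dvd n} = (\<lambda>n. d * n) ` {..<r}"
      using d0 by (auto simp: qrd mult.commute elim!: dvdE)
    also have "(\<Sum>n\<in>(\<lambda>n. d * n) ` {..<r}. unit_root q (- b * int n)) = (\<Sum>n<r. unit_root q (- b * int (d * n)))"
      by (simp add: sum.reindex[OF inj])
    also have "\<dots> = (\<Sum>n<r. unit_root r (- b * int n))"
    proof (rule sum.cong[OF refl])
      fix n
      have "real_of_int (- b * int (d * n)) / real q = real_of_int (- b * int n) / real r"
        unfolding qrd using d0 by simp
      then show "unit_root q (- b * int (d * n)) = unit_root r (- b * int n)" unfolding unit_root_def by (rule arg_cong)
    qed
    also have "\<dots> = (if int r dvd b then of_nat r else 0)" using sum_unit_root[OF d0(2), of "- b"] by simp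
    also have "\<dots> = (\<Prod>p\<in>S - D. if int p dvd b then of_nat p else 0)"
    proof (cases "\<forall>p\<in>S - D. int p dvd b")
      case True
      then show ?thesis unfolding r_def dvd_int_prod_primes_iff[OF fD] by simp
    next
      case False
      then have "(\<Prod>p\<in>S - D. if int p dvd b then of_nat p else 0) = (0::complex)" using fD(1) by (intro prod_zero) auto
      then show ?thesis unfolding r_def dvd_int_prod_primes_iff[OF fD] by (simp only: False if_False)
    qed
    finally show ?thesis unfolding d_def .
  qed
  have "(\<Sum>n<q. coprime_indicator S (int n) * unit_root q (- b * int n))
    = (\<Sum>D\<in>Pow S. (- 1) ^ card D * (\<Sum>n<q. of_bool (int (\<Prod>D) dvd int n) * unit_root q (- b * int n)))"
    unfolding ind sum_distrib_right sum_distrib_left by (subst sum.swap) (simp add: mult.assoc)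
  also have "\<dots> = (\<Sum>D\<in>Pow S. (- 1) ^ card D * (\<Prod>p\<in>S - D. if int p dvd b then of_nat p else 0))"
    by (intro sum.cong refl) (simp only: inner)
  also have "\<dots> = (\<Sum>D\<in>Pow S. (\<Prod>p\<in>D. - 1) * (\<Prod>p\<in>S - D. if int p dvd b then of_nat p else 0))" by simp
  also have "\<dots> = (\<Prod>p\<in>S. - 1 + (if int p dvd b then of_nat p else 0))" by (rule prod_add[OF fin, symmetric])
  finally show ?thesis unfolding q_def by (simp add: add.commute)
qed

text \<open>For a set of primes this is the Ramanujan sum modulo \<open>\<Prod>S\<close> at
  \<open>b\<close>, divided by the modulus.\<close>

definition indicator_coeff :: "nat set \<Rightarrow> int \<Rightarrow> complex" where
  "indicator_coeff S b = (\<Prod>p\<in>S. (if int p dvd b then of_nat p else 0) - 1) / of_nat (\<Prod>S)"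

lemma indicator_coeff_0:
  assumes "finite S" "\<forall>p\<in>S. prime p"
  shows "indicator_coeff S 0 = of_real (coprime_density S)"
proof -
  have "indicator_coeff S 0 = (\<Prod>p\<in>S. (of_nat p - 1) / of_nat p)"
    unfolding indicator_coeff_def by (simp add: prod_dividef)
  also have "\<dots> = (\<Prod>p\<in>S. of_real (1 - 1 / real p))"
    by (rule prod.cong[OF refl]) (use assms(2) prime_gt_0_nat in \<open>auto simp: diff_divide_distrib\<close>)
  finally show ?thesis by (simp add: coprime_density_def)
qed

lemma norm_indicator_coeff_le:
  assumes fin: "finite S" and primes: "\<forall>p\<in>S. prime p"
  shows "norm (indicator_coeff S b) \<le> 1 / real (\<Prod>{p \<in> S. \<not> int p dvd b})"
proof -
  have n: "norm ((if int p dvd b then of_nat p else 0) - 1 :: complex) \<le> (if int p dvd b then real p else 1)" if "p \<in> S" for p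
  proof -
    have "1 \<le> real p" using primes that prime_ge_1_nat by auto
    then have "norm (of_nat p - 1 :: complex) = real p - 1"
      using norm_of_real[of "real p - 1", where 'a = complex] by simp
    then show ?thesis by simp
  qed
  have "norm (\<Prod>p\<in>S. (if int p dvd b then of_nat p else 0) - 1 :: complex) \<le> (\<Prod>p\<in>S. if int p dvd b then real p else 1)"
    unfolding prod_norm[symmetric] by (rule prod_mono) (use n in auto)
  also have "\<dots> = real (\<Prod>{p \<in> S. int p dvd b})"
    using fin by (simp add: prod.If_cases Int_def)
  finally have 1: "norm (\<Prod>p\<in>S. (if int p dvd b then of_nat p else 0) - 1 :: complex) \<le> real (\<Prod>{p \<in> S. int p dvd b})" .
  have split: "\<Prod>S = \<Prod>{p \<in> S. \<not> int p dvd b} * \<Prod>{p \<in> S. int p dvd b}"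
  proof -
    have "S - {p \<in> S. int p dvd b} = {p \<in> S. \<not> int p dvd b}" by auto
    then show ?thesis using prod.subset_diff[of "{p \<in> S. int p dvd b}" S "\<lambda>x. x"] fin by simp
  qed
  have pos: "0 < \<Prod>{p \<in> S. int p dvd b}" "0 < \<Prod>{p \<in> S. \<not> int p dvd b}"
    using primes by (auto intro!: prod_pos intro: prime_gt_0_nat)
  have "norm (indicator_coeff S b) = norm (\<Prod>p\<in>S. (if int p dvd b then of_nat p else 0) - 1 :: complex) / real (\<Prod>S)"
    unfolding indicator_coeff_def norm_divide by (simp only: norm_of_nat)
  also have "\<dots> \<le> real (\<Prod>{p \<in> S. int p dvd b}) / real (\<Prod>S)" by (rule divide_right_mono[OF 1]) (simp del: of_nat_prod)
  also have "\<dots> = 1 / real (\<Prod>{p \<in> S. \<not> int p dvd b})"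
    unfolding split of_nat_mult using pos by (simp del: of_nat_prod)
  finally show ?thesis .
qed

lemma coprime_indicator_fourier:
  assumes fin: "finite S" and primes: "\<forall>p\<in>S. prime p"
  shows "coprime_indicator S m = (\<Sum>b\<in>centred (\<Prod>S). indicator_coeff S b * unit_root (\<Prod>S) (b * m))"
proof -
  have q0: "0 < \<Prod>S" using primes fin by (intro prod_pos) (auto intro: prime_gt_0_nat)
  have per: "coprime_indicator S x = coprime_indicator S y" if "int (\<Prod>S) dvd x - y" for x y
  proof -
    have "int p dvd x \<longleftrightarrow> int p dvd y" if "p \<in> S" for p
      using \<open>int (\<Prod>S) dvd x - y\<close> that unfolding dvd_int_prod_primes_iff[OF assms]
      by (metis dvd_diff_commute dvd_add_right_iff diff_add_cancel)
    then show ?thesis unfolding coprime_indicator_def by simp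
  qed
  show ?thesis
    using fourier_inversion[OF q0, of "coprime_indicator S" m] per
    unfolding coprime_indicator_transform[OF assms] indicator_coeff_def by blast
qed

section \<open>From window moments to the weighted count\<close>

definition window_deviation :: "nat set \<Rightarrow> nat \<Rightarrow> nat \<Rightarrow> real" where
  "window_deviation S h n =
    real (card {m::int. int n \<le> m \<and> m < int n + int h \<and> gcd m (int (\<Prod>S)) = 1}) - coprime_density S * real h"

text \<open>The frequency 0 contributes exactly the mean \<open>coprime_density S * real h\<close>,
  so subtracting the mean removes that frequency.\<close>

lemma window_deviation_fourier:
  assumes fin: "finite S" and primes: "\<forall>p\<in>S. prime p"
  shows "of_real (window_deviation S h n) =
    (\<Sum>b\<in>centred (\<Prod>S) - {0}. indicator_coeff S b * (\<Sum>i<h. unit_root (\<Prod>S) (b * int i)) * unit_root (\<Prod>S) (b * int n))"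
proof -
  define q where "q = \<Prod>S"
  have q0: "0 < q" unfolding q_def using primes fin by (intro prod_pos) (auto intro: prime_gt_0_nat)
  define X where "X = {m::int. int n \<le> m \<and> m < int n + int h \<and> gcd m (int q) = 1}"
  have inj: "inj_on (\<lambda>i. int n + int i) A" for A by (auto simp: inj_on_def)
  have "X = (\<lambda>i. int n + int i) ` {i \<in> {..<h}. gcd (int n + int i) (int q) = 1}"
  proof
    show "X \<subseteq> (\<lambda>i. int n + int i) ` {i \<in> {..<h}. gcd (int n + int i) (int q) = 1}"
    proof
      fix m assume "m \<in> X"
      then show "m \<in> (\<lambda>i. int n + int i) ` {i \<in> {..<h}. gcd (int n + int i) (int q) = 1}"
        by (intro image_eqI[of _ _ "nat (m - int n)"]) (auto simp: X_def)
    qed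
  qed (auto simp: X_def)
  then have "card X = card {i \<in> {..<h}. gcd (int n + int i) (int q) = 1}" by (simp add: card_image[OF inj])
  also have "of_nat \<dots> = (\<Sum>i<h. of_bool (gcd (int n + int i) (int q) = 1) :: complex)"
    by (simp add: of_bool_def sum.If_cases Int_def)
  also have "\<dots> = (\<Sum>i<h. coprime_indicator S (int n + int i))"
    unfolding q_def by (simp only: coprime_indicator_eq[OF assms])
  also have "\<dots> = (\<Sum>i<h. \<Sum>b\<in>centred q. indicator_coeff S b * unit_root q (b * int i) * unit_root q (b * int n))"
    unfolding coprime_indicator_fourier[OF assms] q_def
    by (intro sum.cong refl) (simp add: distrib_left unit_root_add mult_ac)
  also have "\<dots> = (\<Sum>b\<in>centred q. indicator_coeff S b * (\<Sum>i<h. unit_root q (b * int i)) * unit_root q (b * int n))"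
    by (subst sum.swap) (simp add: sum_distrib_left sum_distrib_right)
  also have "\<dots> = of_real (coprime_density S * real h) +
    (\<Sum>b\<in>centred q - {0}. indicator_coeff S b * (\<Sum>i<h. unit_root q (b * int i)) * unit_root q (b * int n))"
    by (subst sum.remove[OF finite_centred zero_in_centred[OF q0]]) (simp add: indicator_coeff_0[OF assms])
  finally show ?thesis unfolding window_deviation_def X_def q_def by simp
qed

text \<open>The power is multiplied out and summed over a full period, which kills every tuple of
  frequencies whose sum is not divisible by \<open>\<Prod>S\<close>. Only then are absolute values
  taken.\<close>

theorem window_moment_le:
  assumes fin: "finite S" and primes: "\<forall>p\<in>S. prime p" and J: "finite J" and h: "h \<le> 2 ^ N"
  shows "\<bar>\<Sum>n=1..\<Prod>S. window_deviation S h n ^ card J\<bar> \<le> real (\<Prod>S) * weighted_count N S J"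
proof -
  define q where "q = \<Prod>S"
  have q0: "0 < q" unfolding q_def using primes fin by (intro prod_pos) (auto intro: prime_gt_0_nat)
  define a where "a = (\<lambda>b. indicator_coeff S b * (\<Sum>i<h. unit_root q (b * int i)))"
  define R where "R = centred q - {0}"
  have finR: "finite R" using finite_centred by (simp add: R_def)
  have R: "R \<subseteq> nonzero_residues S" using centred_bound unfolding R_def nonzero_residues_def q_def by (auto simp del: of_nat_prod)
  have a: "norm (a b) \<le> fourier_weight N S b" if "b \<in> R" for b
  proof -
    have b: "b \<noteq> 0" "2 * \<bar>b\<bar> \<le> int q" using that centred_bound by (auto simp: R_def)
    have "norm (a b) \<le> (1 / real (\<Prod>{p \<in> S. \<not> int p dvd b})) * min (real h) (real q / \<bar>real_of_int b\<bar>)"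
      unfolding a_def norm_mult
      by (intro mult_mono norm_indicator_coeff_le assms norm_sum_unit_root_le q0 b) (simp_all del: of_nat_prod)
    also have "\<dots> \<le> (1 / real (\<Prod>{p \<in> S. \<not> int p dvd b})) * min (2 ^ N) (real q / \<bar>real_of_int b\<bar>)"
    proof (intro mult_left_mono min.mono order_refl)
      have "real h \<le> real (2 ^ N)" using h by (simp only: of_nat_le_iff)
      then show "real h \<le> 2 ^ N" by simp
    qed (simp del: of_nat_prod)
    finally show ?thesis unfolding fourier_weight_def q_def by (simp del: of_nat_prod)
  qed
  have "of_real (\<Sum>n=1..q. window_deviation S h n ^ card J) = (\<Sum>n=1..q. (\<Sum>b\<in>R. a b * unit_root q (b * int n)) ^ card J)"
    unfolding of_real_sum of_real_power window_deviation_fourier[OF fin primes] a_def q_def R_def ..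
  also have "\<dots> = (\<Sum>n=1..q. \<Sum>b\<in>J \<rightarrow>\<^sub>E R. (\<Prod>j\<in>J. a (b j)) * unit_root q ((\<Sum>j\<in>J. b j) * int n))"
  proof (rule sum.cong[OF refl])
    fix n
    have ur: "(\<Prod>j\<in>J. unit_root q (b j * int n)) = unit_root q ((\<Sum>j\<in>J. b j) * int n)" for b
      using J by (induction J rule: finite_induct) (simp_all add: unit_root_add distrib_right)
    have "(\<Sum>b\<in>R. a b * unit_root q (b * int n)) ^ card J = (\<Prod>j\<in>J. \<Sum>b\<in>R. a b * unit_root q (b * int n))" by simp
    also have "\<dots> = (\<Sum>b\<in>J \<rightarrow>\<^sub>E R. \<Prod>j\<in>J. a (b j) * unit_root q (b j * int n))"
      by (rule prod_sum_PiE) (use J finR in auto)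
    finally show "(\<Sum>b\<in>R. a b * unit_root q (b * int n)) ^ card J
      = (\<Sum>b\<in>J \<rightarrow>\<^sub>E R. (\<Prod>j\<in>J. a (b j)) * unit_root q ((\<Sum>j\<in>J. b j) * int n))"
      unfolding prod.distrib ur .
  qed
  also have "\<dots> = (\<Sum>b\<in>J \<rightarrow>\<^sub>E R. (\<Prod>j\<in>J. a (b j)) * (\<Sum>n=1..q. unit_root q ((\<Sum>j\<in>J. b j) * int n)))"
    by (subst sum.swap) (simp only: sum_distrib_left)
  also have "\<dots> = (\<Sum>b\<in>J \<rightarrow>\<^sub>E R. if int q dvd (\<Sum>j\<in>J. b j) then of_nat q * (\<Prod>j\<in>J. a (b j)) else 0)"
    unfolding sum_unit_root_1[OF q0] by (intro sum.cong refl) simp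
  also have "\<dots> = (\<Sum>b\<in>{b \<in> J \<rightarrow>\<^sub>E R. int q dvd (\<Sum>j\<in>J. b j)}. of_nat q * (\<Prod>j\<in>J. a (b j)))"
    by (intro sum.mono_neutral_cong_right finite_PiE J finR) auto
  finally have eq: "of_real (\<Sum>n=1..q. window_deviation S h n ^ card J)
    = (\<Sum>b\<in>{b \<in> J \<rightarrow>\<^sub>E R. int q dvd (\<Sum>j\<in>J. b j)}. of_nat q * (\<Prod>j\<in>J. a (b j)))" .
  have "\<bar>\<Sum>n=1..q. window_deviation S h n ^ card J\<bar> = norm (of_real (\<Sum>n=1..q. window_deviation S h n ^ card J) :: complex)"
    by (simp only: norm_of_real)
  also have "\<dots> \<le> (\<Sum>b\<in>{b \<in> J \<rightarrow>\<^sub>E R. int q dvd (\<Sum>j\<in>J. b j)}. norm (of_nat q * (\<Prod>j\<in>J. a (b j))))"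
    unfolding eq by (rule norm_sum)
  also have "\<dots> \<le> (\<Sum>b\<in>{b \<in> J \<rightarrow>\<^sub>E R. int q dvd (\<Sum>j\<in>J. b j)}. real q * (\<Prod>j\<in>J. fourier_weight N S (b j)))"
  proof (rule sum_mono)
    fix b assume b: "b \<in> {b \<in> J \<rightarrow>\<^sub>E R. int q dvd (\<Sum>j\<in>J. b j)}"
    show "norm (of_nat q * (\<Prod>j\<in>J. a (b j))) \<le> real q * (\<Prod>j\<in>J. fourier_weight N S (b j))"
      unfolding norm_mult norm_of_nat prod_norm[symmetric]
      by (intro mult_left_mono prod_mono) (use a b in auto)
  qed
  also have "\<dots> \<le> (\<Sum>b\<in>zero_sums S J. real q * (\<Prod>j\<in>J. fourier_weight N S (b j)))"
  proof (rule sum_mono2[OF finite_zero_sums[OF J]])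
    show "{b \<in> J \<rightarrow>\<^sub>E R. int q dvd (\<Sum>j\<in>J. b j)} \<subseteq> zero_sums S J"
      unfolding zero_sums_def q_def using PiE_mono[of J "\<lambda>_. R" "\<lambda>_. nonzero_residues S"] R by blast
  qed (intro mult_nonneg_nonneg prod_nonneg fourier_weight_nonneg of_nat_0_le_iff)
  finally show ?thesis unfolding weighted_count_def q_def[symmetric] by (simp only: sum_distrib_left)
qed

section \<open>Mertens' upper bound\<close>

lemma central_binomial_le: "(2 * n) choose n \<le> 4 ^ n"
proof -
  have "(2 * n) choose n \<le> (\<Sum>i\<le>2 * n. (2 * n) choose i)" by (rule member_le_sum) auto
  also have "\<dots> = 2 ^ (2 * n)" by (rule choose_row_sum)
  also have "\<dots> = 4 ^ n" by (simp add: power_mult)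
  finally show ?thesis .
qed

lemma prime_dvd_central_binomial:
  assumes "prime p" "n < p" "p \<le> 2 * n"
  shows "p dvd ((2 * n) choose n)"
proof -
  have "fact (2 * n) = fact n * fact n * ((2 * n) choose n)"
    using binomial_fact_lemma[of n "2 * n"] by simp
  moreover have "p dvd fact (2 * n)" using assms by (simp add: prime_dvd_fact_iff)
  moreover have "\<not> p dvd fact n" using assms by (simp add: prime_dvd_fact_iff)
  ultimately show ?thesis using assms(1) by (metis prime_dvd_mult_iff)
qed

text \<open>Chebyshev's argument: all these primes divide the middle binomial coefficient of row
  \<open>2 ^ (m + 1)\<close>, which is at most \<open>4 ^ (2 ^ m)\<close>.\<close>

lemma card_dyadic_primes_le:
  fixes S :: "nat set"
  assumes "finite S" "\<forall>p\<in>S. prime p \<and> 2 ^ m < p \<and> p \<le> 2 ^ (m + 1)"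
  shows "m * card S \<le> 2 ^ (m + 1)"
proof -
  define n :: nat where "n = 2 ^ m"
  have "int (\<Prod>S) dvd int ((2 * n) choose n)"
  proof (rule prod_primes_dvd[OF assms(1)])
    fix p assume p: "p \<in> S"
    then have "p dvd ((2 * n) choose n)" using assms(2) by (intro prime_dvd_central_binomial) (auto simp: n_def)
    then show "int p dvd int ((2 * n) choose n)" by (simp only: of_nat_dvd_iff)
  qed (use assms in auto)
  then have "\<Prod>S dvd ((2 * n) choose n)" by (simp only: of_nat_dvd_iff)
  then have le: "\<Prod>S \<le> (2 * n) choose n" by (rule dvd_imp_le) simp
  have "2 ^ (m * card S) = (\<Prod>p\<in>S. 2 ^ m :: nat)" by (simp add: power_mult)
  also have "\<dots> \<le> \<Prod>S" by (rule prod_mono) (use assms(2) in \<open>auto intro: less_imp_le\<close>)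
  also have "\<dots> \<le> 4 ^ n" using le central_binomial_le[of n] by linarith
  also have "(4::nat) ^ n = 2 ^ (2 * n)" by (simp add: power_mult)
  finally have "m * card S \<le> 2 * n" by (rule power_le_imp_le_exp[rotated]) simp
  then show ?thesis by (simp add: n_def)
qed

text \<open>At most 2 * 2^m / m primes, each with a factor at least exp (-2 / 2^m), give exp (-4 /
  m). The exponent 8 comes from exp (1 / (2 m)) \<le> 1 + 1 / m; the form m / (m + 1) is chosen to
  telescope.\<close>

lemma dyadic_density_ge:
  fixes S :: "nat set"
  assumes "finite S" "\<forall>p\<in>S. prime p \<and> 2 ^ m < p \<and> p \<le> 2 ^ (m + 1)" "1 \<le> m"
  shows "(real m / real (m + 1)) ^ 8 \<le> coprime_density S"
proof -
  define x where "x = 1 / (2::real) ^ m"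
  have "(2::real) ^ 1 \<le> 2 ^ m" by (rule power_increasing[OF assms(3)]) simp
  then have x: "0 < x" "x \<le> 1 / 2" by (simp_all add: x_def field_simps)
  have ex: "exp (- (2 * x)) \<le> 1 - x"
  proof -
    have "1 \<le> (1 + 2 * x) * (1 - x)" using mult_left_mono[OF x(2), of x] x(1) by (simp add: algebra_simps)
    also have "\<dots> \<le> exp (2 * x) * (1 - x)" by (intro mult_right_mono exp_ge_add_one_self) (use x in auto)
    finally show ?thesis by (simp add: exp_minus field_simps)
  qed
  have "real (m * card S) \<le> real (2 ^ (m + 1))" using card_dyadic_primes_le[OF assms(1,2)] by (simp only: of_nat_le_iff)
  then have mc: "real m * real (card S) \<le> 2 * 2 ^ m" by simp
  have c: "2 * x * real (card S) \<le> 4 / real m"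
    using mc assms(3) by (simp add: x_def field_simps)
  define y where "y = 1 / (2 * real m)"
  have y: "0 \<le> y" "y \<le> 1" using assms(3) by (simp_all add: y_def field_simps)
  have "exp y \<le> 1 + y + y\<^sup>2" by (rule exp_bound[OF y])
  also have "y\<^sup>2 \<le> y" using mult_left_mono[OF y(2) y(1)] by (simp add: power2_eq_square)
  finally have "exp y \<le> real (m + 1) / real m" using assms(3) by (simp add: y_def field_simps)
  then have "exp y ^ 8 \<le> (real (m + 1) / real m) ^ 8" by (rule power_mono) simp
  moreover have "exp y ^ 8 = exp (4 / real m)"
    unfolding exp_of_nat_mult[symmetric] using assms(3) by (simp add: y_def)
  ultimately have e8: "exp (4 / real m) \<le> (real (m + 1) / real m) ^ 8" by simp
  have "(real m / real (m + 1)) ^ 8 = 1 / (real (m + 1) / real m) ^ 8" by (simp add: power_divide)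
  also have "\<dots> \<le> 1 / exp (4 / real m)" by (rule divide_left_mono[OF e8]) (use assms(3) in auto)
  also have "\<dots> = exp (- (4 / real m))" by (simp add: exp_minus field_simps)
  also have "\<dots> \<le> exp (real (card S) * (- (2 * x)))" using c by (simp add: mult.commute)
  also have "\<dots> = exp (- (2 * x)) ^ card S" by (rule exp_of_nat_mult)
  also have "\<dots> \<le> (1 - x) ^ card S" by (rule power_mono[OF ex]) simp
  also have "\<dots> = (\<Prod>p\<in>S. 1 - x)" by simp
  also have "\<dots> \<le> coprime_density S"
    unfolding coprime_density_def
  proof (rule prod_mono)
    fix p assume "p \<in> S"
    then have "2 ^ m \<le> p" using assms(2) less_imp_le by blast
    then have "real (2 ^ m) \<le> real p" by (simp only: of_nat_le_iff)
    then have "1 / real p \<le> x" unfolding x_def by (intro frac_le) simp_all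
    then show "0 \<le> 1 - x \<and> 1 - x \<le> 1 - 1 / real p" using x by simp
  qed
  finally show ?thesis .
qed

text \<open>The dyadic factors telescope, starting from the prime 2. The exponent is far from the
  true order 1, but this only changes the power of \<open>log h\<close> that is lost.\<close>

theorem coprime_density_ge:
  assumes "1 \<le> m" "\<forall>p\<in>S. prime p \<and> p \<le> 2 ^ m"
  shows "1 / (2 * real m ^ 8) \<le> coprime_density S"
  using assms
proof (induction m arbitrary: S rule: nat_induct_at_least)
  case base
  have "S \<subseteq> {2}"
  proof
    fix p assume "p \<in> S"
    then have "p \<le> 2 ^ 1" "2 \<le> p" using base prime_ge_2_nat by blast+
    then show "p \<in> {2}" by simp
  qed
  then show ?case by (auto simp: coprime_density_def subset_singleton_iff)
next
  case (Suc m)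
  have fin: "finite S" by (rule finite_subset[of _ "{..2 ^ Suc m}"]) (use Suc in auto)
  define S1 where "S1 = {p \<in> S. p \<le> 2 ^ m}"
  define S2 where "S2 = {p \<in> S. 2 ^ m < p}"
  have 1: "1 / (2 * real m ^ 8) \<le> coprime_density S1" by (rule Suc.IH) (use Suc in \<open>auto simp: S1_def\<close>)
  have 2: "(real m / real (m + 1)) ^ 8 \<le> coprime_density S2"
    by (rule dyadic_density_ge) (use Suc fin in \<open>auto simp: S2_def\<close>)
  have "1 / (2 * real (Suc m) ^ 8) = 1 / (2 * real m ^ 8) * (real m / real (m + 1)) ^ 8"
    using Suc.hyps by (simp add: power_divide)
  also have "\<dots> \<le> coprime_density S1 * coprime_density S2"
    by (rule mult_mono[OF 1 2]) (auto intro: order_trans[OF _ 1])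
  also have "\<dots> = coprime_density (S1 \<union> S2)"
    unfolding coprime_density_def by (rule prod.union_disjoint[symmetric]) (use fin in \<open>auto simp: S1_def S2_def\<close>)
  also have "S1 \<union> S2 = S" by (auto simp: S1_def S2_def)
  finally show ?case .
qed

lemma divisor_mass_le:
  assumes "\<forall>p\<in>S. prime p"
  shows "divisor_mass S * coprime_density S \<le> 1"
proof -
  have "divisor_mass S * coprime_density S = (\<Prod>p\<in>S. (1 + 1 / real p) * (1 - 1 / real p))"
    unfolding divisor_mass_def coprime_density_def by (simp add: prod.distrib)
  also have "\<dots> \<le> 1"
  proof (rule prod_le_1)
    fix p assume "p \<in> S"
    then have "1 \<le> p" using assms prime_ge_1_nat by blast
    then have x: "0 \<le> 1 / real p" "1 / real p \<le> 1" by simp_all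
    have "(1 + 1 / real p) * (1 - 1 / real p) = 1 - (1 / real p) * (1 / real p)" by (simp add: algebra_simps)
    moreover have "0 \<le> (1 + 1 / real p) * (1 - 1 / real p)" using x by (intro mult_nonneg_nonneg) auto
    ultimately show "0 \<le> (1 + 1 / real p) * (1 - 1 / real p) \<and> (1 + 1 / real p) * (1 - 1 / real p) \<le> 1"
      using mult_nonneg_nonneg[OF x(1) x(1)] by linarith
  qed
  finally show ?thesis .
qed

section \<open>Large primes\<close>

definition window_count :: "nat set \<Rightarrow> nat \<Rightarrow> nat \<Rightarrow> nat" where
  "window_count S h n = card {i \<in> {..<h}. \<forall>p\<in>S. \<not> p dvd n + i}"

lemma window_count_le: "window_count S h n \<le> h"
proof -
  have "window_count S h n \<le> card {..<h}" unfolding window_count_def by (intro card_mono) auto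
  then show ?thesis by simp
qed

lemma card_coprime_window:
  assumes "\<And>m. gcd m (int q) = 1 \<longleftrightarrow> (\<forall>p\<in>S. \<not> int p dvd m)"
  shows "card {m::int. int n \<le> m \<and> m < int n + int h \<and> gcd m (int q) = 1} = window_count S h n"
proof -
  have inj: "inj_on (\<lambda>i. int n + int i) A" for A by (auto simp: inj_on_def)
  have dvd: "int p dvd int n + int i \<longleftrightarrow> p dvd n + i" for p i
    by (simp only: of_nat_add[symmetric] of_nat_dvd_iff)
  define X where "X = {m::int. int n \<le> m \<and> m < int n + int h \<and> gcd m (int q) = 1}"
  define Y where "Y = {i \<in> {..<h}. \<forall>p\<in>S. \<not> p dvd n + i}"
  have mem: "m \<in> X \<longleftrightarrow> int n \<le> m \<and> m < int n + int h \<and> (\<forall>p\<in>S. \<not> int p dvd m)" for m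
    unfolding X_def mem_Collect_eq assms ..
  have Y: "int n + int i \<in> X \<longleftrightarrow> i \<in> Y" for i
    unfolding mem dvd Y_def by auto
  have "X = (\<lambda>i. int n + int i) ` Y"
  proof
    show "X \<subseteq> (\<lambda>i. int n + int i) ` Y"
    proof
      fix m assume m: "m \<in> X"
      then have "int n \<le> m" by (simp only: mem)
      then obtain i where i: "m = int n + int i" using zle_iff_zadd by blast
      then show "m \<in> (\<lambda>i. int n + int i) ` Y" using m Y by blast
    qed
    show "(\<lambda>i. int n + int i) ` Y \<subseteq> X" using Y by blast
  qed
  then have "card X = card Y" by (simp only: card_image[OF inj])
  then show ?thesis unfolding X_def Y_def window_count_def .
qed

lemma window_deviation_eq:
  assumes "finite S" "\<forall>p\<in>S. prime p"
  shows "window_deviation S h n = real (window_count S h n) - coprime_density S * real h"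
  unfolding window_deviation_def card_coprime_window[OF coprime_prod_primes_iff[OF assms]] ..

lemma window_count_periodic:
  assumes "\<forall>p\<in>S. p dvd q"
  shows "window_count S h (n + q) = window_count S h n"
proof -
  have "p dvd n + q + i \<longleftrightarrow> p dvd n + i" if "p \<in> S" for p i
    using assms that by (metis add.assoc add.commute dvd_add_right_iff)
  then show ?thesis unfolding window_count_def by metis
qed

lemma sum_period_shift:
  fixes f :: "nat \<Rightarrow> 'a :: comm_monoid_add"
  assumes "f q = f 0"
  shows "(\<Sum>n=1..q. f n) = (\<Sum>n<q. f n)"
proof (cases q)
  case (Suc r)
  have "{1..q} = insert q {1..<q}" "{..<q} = insert 0 {1..<q}" using Suc by auto
  then show ?thesis using assms by simp
qed simp

lemma sum_periodic_blocks:
  fixes f :: "nat \<Rightarrow> real"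
  assumes "\<And>n. f (n + r) = f n"
  shows "(\<Sum>n<t * r. f n) = real t * (\<Sum>n<r. f n)"
proof (induction t)
  case (Suc t)
  have per: "f (n + t * r) = f n" for n t
  proof (induction t)
    case (Suc t)
    then show ?case using assms[of "n + t * r"] by (simp add: add_ac)
  qed simp
  have "(\<Sum>n<Suc t * r. f n) = (\<Sum>n<t * r. f n) + (\<Sum>n\<in>{t * r..<Suc t * r}. f n)"
    by (simp add: lessThan_atLeast0 sum.atLeastLessThan_concat)
  also have "(\<Sum>n\<in>{t * r..<Suc t * r}. f n) = (\<Sum>n<r. f (n + t * r))"
    using sum.shift_bounds_nat_ivl[of f 0 "t * r" r] by (simp add: lessThan_atLeast0 add.commute)
  finally show ?case using Suc by (simp add: per distrib_right)
qed simp

lemma sum_mult_coprime_periods: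
  fixes f g :: "nat \<Rightarrow> real"
  assumes "coprime r p" "0 < r" "0 < p" "\<And>n. f n = f (n mod r)" "\<And>n. g n = g (n mod p)"
  shows "(\<Sum>n<r * p. f n * g n) = (\<Sum>n<r. f n) * (\<Sum>n<p. g n)"
proof -
  define \<phi> where "\<phi> = (\<lambda>n. (n mod r, n mod p))"
  have inj: "inj_on \<phi> {..<r * p}"
  proof (rule inj_onI)
    fix x y assume xy: "x \<in> {..<r * p}" "y \<in> {..<r * p}" "\<phi> x = \<phi> y"
    then have "[x = y] (mod r)" "[x = y] (mod p)" by (simp_all add: \<phi>_def cong_def)
    then have "[x = y] (mod r * p)" using assms(1) by (intro coprime_cong_mult_nat)
    then show "x = y" using xy by (simp add: cong_def)
  qed
  have sub: "\<phi> ` {..<r * p} \<subseteq> {..<r} \<times> {..<p}" using assms by (auto simp: \<phi>_def)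
  have "\<phi> ` {..<r * p} = {..<r} \<times> {..<p}"
    by (rule card_subset_eq[OF _ sub]) (simp_all add: card_image[OF inj] card_cartesian_product)
  then have "(\<Sum>(a, b)\<in>{..<r} \<times> {..<p}. f a * g b) = (\<Sum>x\<in>\<phi> ` {..<r * p}. case x of (a, b) \<Rightarrow> f a * g b)" by simp
  also have "\<dots> = (\<Sum>n<r * p. f (n mod r) * g (n mod p))" unfolding sum.reindex[OF inj] by (simp add: \<phi>_def comp_def)
  also have "\<dots> = (\<Sum>n<r * p. f n * g n)" by (intro sum.cong refl) (metis assms(4,5))
  finally show ?thesis by (simp add: sum_product sum.cartesian_product)
qed

definition avoiding :: "nat set \<Rightarrow> nat set \<Rightarrow> nat \<Rightarrow> real" where
  "avoiding S T n = of_bool (\<forall>t\<in>T. \<forall>p\<in>S. \<not> p dvd n + t)"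

lemma avoiding_mod:
  assumes "\<forall>p\<in>S. p dvd q"
  shows "avoiding S T n = avoiding S T (n mod q)"
proof -
  have "p dvd n + t \<longleftrightarrow> p dvd n mod q + t" if "p \<in> S" for p t
  proof -
    have "p dvd q" using assms that by blast
    then have "n mod q mod p = n mod p" by (rule mod_mod_cancel)
    then have "(n mod q + t) mod p = (n + t) mod p" by (metis mod_add_left_eq)
    then show ?thesis by (simp add: dvd_eq_mod_eq_0)
  qed
  then show ?thesis unfolding avoiding_def by auto
qed

text \<open>Since \<open>h \<le> p\<close>, the negatives of the elements of \<open>T\<close> lie in
  distinct classes modulo \<open>p\<close>, and each excludes one \<open>n\<close>.\<close>

lemma sum_avoiding_prime:
  assumes "prime p" "T \<subseteq> {..<h}" "h \<le> p"
  shows "(\<Sum>n<p. avoiding {p} T n) = real p - real (card T)"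
proof -
  have p0: "0 < p" using assms(1) prime_gt_0_nat by blast
  define f where "f = (\<lambda>t. if t = 0 then 0 else p - t)"
  have lt: "t < p" if "t \<in> T" for t using that assms by auto
  have inj: "inj_on f T"
  proof (rule inj_onI)
    fix x y assume "x \<in> T" "y \<in> T" "f x = f y"
    then show "x = y" using lt[of x] lt[of y] by (auto simp: f_def split: if_splits)
  qed
  have eq: "{n \<in> {..<p}. \<exists>t\<in>T. p dvd n + t} = f ` T"
  proof
    show "{n \<in> {..<p}. \<exists>t\<in>T. p dvd n + t} \<subseteq> f ` T"
    proof
      fix n assume "n \<in> {n \<in> {..<p}. \<exists>t\<in>T. p dvd n + t}"
      then obtain t where t: "n < p" "t \<in> T" "p dvd n + t" by auto
      obtain c where c: "n + t = p * c" using t(3) by blast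
      have "n + t < p * 2" using t(1) lt[OF t(2)] by simp
      then have "c < 2" using c by simp
      then have "n + t = 0 \<or> n + t = p" using c by (cases c) auto
      then have "n = f t" using t(1) lt[OF t(2)] by (auto simp: f_def)
      then show "n \<in> f ` T" using t(2) by blast
    qed
    show "f ` T \<subseteq> {n \<in> {..<p}. \<exists>t\<in>T. p dvd n + t}"
    proof
      fix n assume "n \<in> f ` T"
      then obtain t where t: "t \<in> T" "n = f t" by blast
      have "n < p" "p dvd n + t" using lt[OF t(1)] p0 by (auto simp: t(2) f_def)
      then show "n \<in> {n \<in> {..<p}. \<exists>t\<in>T. p dvd n + t}" using t(1) by blast
    qed
  qed
  have "(\<Sum>n<p. avoiding {p} T n) = real (card {n \<in> {..<p}. \<not> (\<exists>t\<in>T. p dvd n + t)})"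
    unfolding avoiding_def by (simp add: of_bool_def sum.If_cases Int_def)
  also have "{n \<in> {..<p}. \<not> (\<exists>t\<in>T. p dvd n + t)} = {..<p} - f ` T" unfolding eq[symmetric] by auto
  also have "card ({..<p} - f ` T) = p - card T"
    using eq card_image[OF inj] assms(2) finite_subset[of T "{..<h}"] by (subst card_Diff_subset) auto
  also have "real (p - card T) = real p - real (card T)"
  proof -
    have "card T \<le> card {..<h}" using assms(2) by (intro card_mono) auto
    then show ?thesis using assms(3) by (simp add: of_nat_diff)
  qed
  finally show ?thesis .
qed

lemma sum_avoiding_large_primes:
  assumes fin: "finite S1" "finite S2" and pr: "\<forall>p\<in>S1 \<union> S2. prime p" and disj: "S1 \<inter> S2 = {}"
    and large: "\<forall>p\<in>S2. h \<le> p" and T: "T \<subseteq> {..<h}"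
  shows "(\<Sum>n<\<Prod>(S1 \<union> S2). avoiding (S1 \<union> S2) T n)
    = (\<Prod>p\<in>S2. real p - real (card T)) * (\<Sum>n<\<Prod>S1. avoiding S1 T n)"
  using fin(2) pr disj large
proof (induction S2 rule: finite_induct)
  case (insert p S2)
  define S where "S = S1 \<union> S2"
  have S: "finite S" "\<forall>p\<in>S. prime p" "p \<notin> S" "prime p" using insert fin(1) by (auto simp: S_def)
  have U: "S1 \<union> insert p S2 = insert p S" by (auto simp: S_def)
  have pos: "0 < \<Prod>S" "0 < p" using S prime_gt_0_nat by (auto intro!: prod_pos)
  have cop: "coprime (\<Prod>S) p"
  proof (rule prod_coprime_left)
    fix r assume "r \<in> S"
    then have "r \<noteq> p" "prime r" "prime p" using S by auto
    then show "coprime r p" using primes_coprime by blast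
  qed
  have "(\<Sum>n<\<Prod>(insert p S). avoiding (insert p S) T n) = (\<Sum>n<\<Prod>S * p. avoiding S T n * avoiding {p} T n)"
    using S by (intro sum.cong) (auto simp: avoiding_def mult.commute)
  also have "\<dots> = (\<Sum>n<\<Prod>S. avoiding S T n) * (\<Sum>n<p. avoiding {p} T n)"
  proof (rule sum_mult_coprime_periods[OF cop pos])
    show "avoiding S T n = avoiding S T (n mod \<Prod>S)" for n
      by (rule avoiding_mod) (use dvd_prodI[OF S(1), of _ "\<lambda>x. x"] in auto)
    show "avoiding {p} T n = avoiding {p} T (n mod p)" for n by (rule avoiding_mod) simp
  qed
  also have "(\<Sum>n<p. avoiding {p} T n) = real p - real (card T)"
    by (rule sum_avoiding_prime[OF S(4) T]) (use insert in auto)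
  finally show ?case unfolding U using insert by (simp add: S_def)
qed simp

lemma window_count_choose:
  "real (window_count S h n choose i) = (\<Sum>T\<in>{T. T \<subseteq> {..<h} \<and> card T = i}. avoiding S T n)"
proof -
  define A where "A = {i \<in> {..<h}. \<forall>p\<in>S. \<not> p dvd n + i}"
  have "window_count S h n choose i = card {T. T \<subseteq> A \<and> card T = i}"
    unfolding window_count_def A_def by (rule n_subsets[symmetric]) simp
  also have "{T. T \<subseteq> A \<and> card T = i} = {T \<in> {T. T \<subseteq> {..<h} \<and> card T = i}. \<forall>t\<in>T. \<forall>p\<in>S. \<not> p dvd n + t}"
    by (auto simp: A_def)
  finally show ?thesis
    unfolding avoiding_def by (simp add: of_bool_def sum.If_cases Int_def finite_subset[of _ "Pow {..<h}"] Collect_mono_iff)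
qed

text \<open>A binomial coefficient counts sets of surviving positions, and the number of residues
  modulo a large prime that spare a given set depends only on its size. So factorial moments are
  merely multiplied, unlike powers.\<close>

theorem sum_window_count_choose:
  assumes "finite S1" "finite S2" "\<forall>p\<in>S1 \<union> S2. prime p" "S1 \<inter> S2 = {}" "\<forall>p\<in>S2. h \<le> p"
  shows "(\<Sum>n<\<Prod>(S1 \<union> S2). real (window_count (S1 \<union> S2) h n choose i))
    = (\<Prod>p\<in>S2. real p - real i) * (\<Sum>n<\<Prod>S1. real (window_count S1 h n choose i))"
proof -
  have "(\<Sum>n<\<Prod>(S1 \<union> S2). real (window_count (S1 \<union> S2) h n choose i))
    = (\<Sum>T\<in>{T. T \<subseteq> {..<h} \<and> card T = i}. \<Sum>n<\<Prod>(S1 \<union> S2). avoiding (S1 \<union> S2) T n)"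
    unfolding window_count_choose by (rule sum.swap)
  also have "\<dots> = (\<Sum>T\<in>{T. T \<subseteq> {..<h} \<and> card T = i}. (\<Prod>p\<in>S2. real p - real i) * (\<Sum>n<\<Prod>S1. avoiding S1 T n))"
    by (intro sum.cong refl) (use sum_avoiding_large_primes[OF assms] in auto)
  also have "\<dots> = (\<Prod>p\<in>S2. real p - real i) * (\<Sum>n<\<Prod>S1. real (window_count S1 h n choose i))"
    unfolding window_count_choose sum_distrib_left by (rule sum.swap)
  finally show ?thesis .
qed

section \<open>Powers in terms of binomial coefficients, and binomial thinning\<close>

lemma times_choose: "real x * real (x choose i) = real i * real (x choose i) + real (Suc i) * real (x choose Suc i)"
  using gbinomial_mult_1[of "real x" i] by (simp only: binomial_gbinomial)

text \<open>The coefficients of \<open>(x - \<mu>) ^ k\<close> in the basis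
  \<open>x choose i\<close>; the recursion is multiplication by \<open>x - \<mu>\<close> through
  \<open>times_choose\<close>.\<close>

fun shifted_power_coeff :: "real \<Rightarrow> nat \<Rightarrow> nat \<Rightarrow> real" where
  "shifted_power_coeff \<mu> 0 i = of_bool (i = 0)"
| "shifted_power_coeff \<mu> (Suc k) i = real i * shifted_power_coeff \<mu> k (i - 1) + (real i - \<mu>) * shifted_power_coeff \<mu> k i"

lemma shifted_power_coeff_eq_0: "k < i \<Longrightarrow> shifted_power_coeff \<mu> k i = 0"
  by (induction k arbitrary: i) auto

lemma shifted_power_eq: "(real x - \<mu>) ^ k = (\<Sum>i\<le>k. shifted_power_coeff \<mu> k i * real (x choose i))"
proof (induction k)
  case (Suc k)
  let ?c = "shifted_power_coeff \<mu> k"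
  have "(real x - \<mu>) ^ Suc k = (\<Sum>i\<le>k. ?c i * ((real x - \<mu>) * real (x choose i)))"
    unfolding power_Suc Suc sum_distrib_left by (intro sum.cong refl) simp
  also have "\<dots> = (\<Sum>i\<le>k. real (Suc i) * ?c i * real (x choose Suc i) + (real i - \<mu>) * ?c i * real (x choose i))"
    by (intro sum.cong refl) (simp only: left_diff_distrib times_choose, simp add: algebra_simps)
  also have "\<dots> = (\<Sum>i\<le>k. real (Suc i) * ?c i * real (x choose Suc i)) + (\<Sum>i\<le>k. (real i - \<mu>) * ?c i * real (x choose i))"
    by (rule sum.distrib)
  also have "(\<Sum>i\<le>k. real (Suc i) * ?c i * real (x choose Suc i)) = (\<Sum>i\<le>Suc k. real i * ?c (i - 1) * real (x choose i))"
    by (simp add: sum.atMost_Suc_shift del: sum.atMost_Suc)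
  also have "(\<Sum>i\<le>k. (real i - \<mu>) * ?c i * real (x choose i)) = (\<Sum>i\<le>Suc k. (real i - \<mu>) * ?c i * real (x choose i))"
    by (simp add: shifted_power_coeff_eq_0)
  finally show ?case by (simp add: sum.distrib[symmetric] distrib_right del: sum.atMost_Suc)
qed simp

lemma abs_shifted_power_coeff_le:
  assumes "0 \<le> \<mu>"
  shows "\<bar>shifted_power_coeff \<mu> k i\<bar> \<le> real (2 * k + 1) ^ k * (1 + \<mu>) ^ k"
proof (induction k arbitrary: i)
  case (Suc k)
  define B where "B = real (2 * k + 1) ^ k * (1 + \<mu>) ^ k"
  have B0: "0 \<le> B" using assms by (simp add: B_def)
  show ?case
  proof (cases "Suc k < i")
    case True
    then show ?thesis using shifted_power_coeff_eq_0[OF True, of \<mu>] assms by simp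
  next
    case False
    have "\<bar>shifted_power_coeff \<mu> (Suc k) i\<bar> \<le> \<bar>real i * shifted_power_coeff \<mu> k (i - 1)\<bar> + \<bar>(real i - \<mu>) * shifted_power_coeff \<mu> k i\<bar>"
      by simp
    also have "\<dots> \<le> real (Suc k) * B + (real (Suc k) + \<mu>) * B"
      unfolding abs_mult B_def by (intro add_mono mult_mono Suc) (use False assms in auto)
    also have "\<dots> \<le> real (2 * Suc k + 1) * (1 + \<mu>) * B"
    proof -
      have "real (Suc k) + (real (Suc k) + \<mu>) \<le> real (2 * Suc k + 1) * (1 + \<mu>)"
      proof -
        have "n + (n + \<mu>) \<le> (2 * n + 1) * (1 + \<mu>)" if "0 \<le> n" for n
          using mult_nonneg_nonneg[OF that assms] by (simp add: algebra_simps)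
        from this[of "real (Suc k)"] show ?thesis by simp
      qed
      then have "(real (Suc k) + (real (Suc k) + \<mu>)) * B \<le> real (2 * Suc k + 1) * (1 + \<mu>) * B" using B0 by (rule mult_right_mono)
      then show ?thesis by (simp only: distrib_right)
    qed
    also have "\<dots> \<le> real (2 * Suc k + 1) * (1 + \<mu>) * (real (2 * Suc k + 1) ^ k * (1 + \<mu>) ^ k)"
      unfolding B_def using assms by (intro mult_left_mono mult_right_mono power_mono) auto
    finally show ?thesis by (simp add: mult_ac)
  qed
qed simp

text \<open>Expectation with respect to the binomial distribution with parameters \<open>s\<close> and \<open>p\<close>.\<close>

fun binomial_exp :: "real \<Rightarrow> nat \<Rightarrow> (nat \<Rightarrow> real) \<Rightarrow> real" where
  "binomial_exp p 0 F = F 0"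
| "binomial_exp p (Suc s) F = (1 - p) * binomial_exp p s F + p * binomial_exp p s (\<lambda>x. F (Suc x))"

lemma binomial_exp_add: "binomial_exp p s (\<lambda>x. F x + G x) = binomial_exp p s F + binomial_exp p s G"
  by (induction s arbitrary: F G) (simp_all add: algebra_simps)

lemma binomial_exp_cmult: "binomial_exp p s (\<lambda>x. c * F x) = c * binomial_exp p s F"
  by (induction s arbitrary: F) (simp_all add: algebra_simps)

lemma binomial_exp_const: "binomial_exp p s (\<lambda>x. c) = c"
  by (induction s) (simp_all add: algebra_simps)

lemma binomial_exp_sum:
  assumes "finite I"
  shows "binomial_exp p s (\<lambda>x. \<Sum>i\<in>I. F i x) = (\<Sum>i\<in>I. binomial_exp p s (F i))"
  using assms by (induction I rule: finite_induct) (simp_all add: binomial_exp_const binomial_exp_add)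

lemma binomial_exp_choose: "binomial_exp p s (\<lambda>x. real (x choose i)) = p ^ i * real (s choose i)"
proof (induction s arbitrary: i)
  case 0
  then show ?case by (cases i) auto
next
  case (Suc s)
  then show ?case by (cases i) (simp_all add: binomial_exp_const binomial_exp_add algebra_simps)
qed

text \<open>
  The coefficients of the \<open>j\<close>-th central moment of the binomial distribution with respect to \<open>s choose i\<close>; the
  recursion comes from adding one trial. As the first Bernoulli moment vanishes, only \<open>2 i \<le> j\<close> occurs.
\<close>

definition bernoulli_moment :: "real \<Rightarrow> nat \<Rightarrow> real" where
  "bernoulli_moment p l = (1 - p) * (- p) ^ l + p * (1 - p) ^ l"

fun binomial_moment_coeff :: "real \<Rightarrow> nat \<Rightarrow> nat \<Rightarrow> real" where
  "binomial_moment_coeff p j 0 = of_bool (j = 0)"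
| "binomial_moment_coeff p j (Suc i) = (\<Sum>l<j. real (j choose l) * bernoulli_moment p (j - l) * binomial_moment_coeff p l i)"

text \<open>The recursion of \<open>binomial_moment_coeff\<close> with each Bernoulli moment
  replaced by its bound \<open>2 * p\<close> and the powers of \<open>p\<close> split off.\<close>

fun moment_const :: "nat \<Rightarrow> nat \<Rightarrow> real" where
  "moment_const j 0 = 1"
| "moment_const j (Suc i) = (\<Sum>l<j. real (j choose l) * 2 * moment_const l i)"

lemma bernoulli_moment_0: "bernoulli_moment p 0 = 1"
  by (simp add: bernoulli_moment_def)

lemma bernoulli_moment_1: "bernoulli_moment p 1 = 0"
  by (simp add: bernoulli_moment_def algebra_simps)

lemma abs_bernoulli_moment_le:
  assumes "0 \<le> p" "p \<le> 1" "0 < l"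
  shows "\<bar>bernoulli_moment p l\<bar> \<le> 2 * p"
proof -
  have "\<bar>bernoulli_moment p l\<bar> \<le> \<bar>(1 - p) * (- p) ^ l\<bar> + \<bar>p * (1 - p) ^ l\<bar>" unfolding bernoulli_moment_def by simp
  also have "\<bar>(1 - p) * (- p) ^ l\<bar> = (1 - p) * p ^ l" using assms by (simp add: abs_mult power_abs)
  also have "\<bar>p * (1 - p) ^ l\<bar> = p * (1 - p) ^ l" using assms by (simp add: abs_mult power_abs)
  also have "(1 - p) * p ^ l + p * (1 - p) ^ l \<le> 1 * p + p * 1"
  proof (intro add_mono mult_mono)
    show "p ^ l \<le> p" using power_decreasing[of 1 l p] assms by simp
    show "(1 - p) ^ l \<le> 1" using assms by (intro power_le_one) auto
  qed (use assms in auto)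
  finally show ?thesis by simp
qed

lemma binomial_moment_coeff_eq_0: "j < 2 * i \<Longrightarrow> binomial_moment_coeff p j i = 0"
proof (induction i arbitrary: j)
  case (Suc i)
  have "real (j choose l) * bernoulli_moment p (j - l) * binomial_moment_coeff p l i = 0" if l: "l < j" for l
  proof (cases "j - l = 1")
    case True
    then show ?thesis by (simp add: bernoulli_moment_1[simplified])
  next
    case False
    then have "l < 2 * i" using l Suc.prems by presburger
    then show ?thesis using Suc.IH by simp
  qed
  then show ?case unfolding binomial_moment_coeff.simps by (intro sum.neutral) auto
qed simp

lemma moment_const_nonneg: "0 \<le> moment_const j i"
  by (induction i arbitrary: j) (auto intro!: sum_nonneg)

lemma abs_binomial_moment_coeff_le:
  assumes "0 \<le> p" "p \<le> 1"
  shows "\<bar>binomial_moment_coeff p j i\<bar> \<le> moment_const j i * p ^ i"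
proof (induction i arbitrary: j)
  case (Suc i)
  have "\<bar>binomial_moment_coeff p j (Suc i)\<bar> \<le> (\<Sum>l<j. \<bar>real (j choose l) * bernoulli_moment p (j - l) * binomial_moment_coeff p l i\<bar>)"
    unfolding binomial_moment_coeff.simps by (rule sum_abs)
  also have "\<dots> \<le> (\<Sum>l<j. real (j choose l) * (2 * p) * (moment_const l i * p ^ i))"
  proof (rule sum_mono)
    fix l assume "l \<in> {..<j}"
    then show "\<bar>real (j choose l) * bernoulli_moment p (j - l) * binomial_moment_coeff p l i\<bar>
      \<le> real (j choose l) * (2 * p) * (moment_const l i * p ^ i)"
      unfolding abs_mult by (intro mult_mono abs_bernoulli_moment_le assms Suc) (use assms in auto)
  qed
  also have "\<dots> = moment_const j (Suc i) * p ^ Suc i" by (simp add: sum_distrib_left sum_distrib_right mult_ac)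
  finally show ?case .
qed simp

text \<open>One more trial shifts the deviation by \<open>- p\<close> or by \<open>1 - p\<close>.
  The terms of lower degree produce \<open>binomial_moment_coeff p j (Suc i)\<close>, and Pascal's
  rule combines them with the term of degree \<open>j\<close>.\<close>

lemma binomial_central_moment:
  assumes "j \<le> k"
  shows "binomial_exp p s (\<lambda>x. (real x - p * real s) ^ j) = (\<Sum>i\<le>k. binomial_moment_coeff p j i * real (s choose i))"
  using assms
proof (induction s arbitrary: j)
  case 0
  have "(\<Sum>i\<le>k. binomial_moment_coeff p j i * real (0 choose i)) = (\<Sum>i\<le>k. if i = 0 then binomial_moment_coeff p j 0 else 0)"
    by (intro sum.cong refl) (auto simp: binomial_eq_0)
  then show ?case by (simp add: power_0_left)
next
  case (Suc s)
  let ?m = "\<lambda>l. binomial_exp p s (\<lambda>x. (real x - p * real s) ^ l)"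
  have shift: "binomial_exp p s (\<lambda>x. (real x - p * real s + d) ^ j) = (\<Sum>l\<le>j. real (j choose l) * d ^ (j - l) * ?m l)" for d
  proof -
    have "(\<lambda>x. (real x - p * real s + d) ^ j) = (\<lambda>x. \<Sum>l\<le>j. real (j choose l) * d ^ (j - l) * (real x - p * real s) ^ l)"
      by (simp add: binomial_ring mult_ac)
    then show ?thesis by (simp only: binomial_exp_sum[OF finite_atMost] binomial_exp_cmult)
  qed
  have "binomial_exp p (Suc s) (\<lambda>x. (real x - p * real (Suc s)) ^ j)
    = (1 - p) * binomial_exp p s (\<lambda>x. (real x - p * real s + - p) ^ j) + p * binomial_exp p s (\<lambda>x. (real x - p * real s + (1 - p)) ^ j)"
    by (simp add: algebra_simps)
  also have "\<dots> = (\<Sum>l\<le>j. real (j choose l) * bernoulli_moment p (j - l) * ?m l)"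
    unfolding shift sum_distrib_left sum.distrib[symmetric] bernoulli_moment_def
    by (intro sum.cong refl) (simp add: algebra_simps)
  also have "\<dots> = ?m j + (\<Sum>l<j. real (j choose l) * bernoulli_moment p (j - l) * ?m l)"
    by (simp add: lessThan_Suc_atMost[symmetric] bernoulli_moment_0)
  also have "(\<Sum>l<j. real (j choose l) * bernoulli_moment p (j - l) * ?m l)
    = (\<Sum>l<j. \<Sum>i\<le>k. real (j choose l) * bernoulli_moment p (j - l) * binomial_moment_coeff p l i * real (s choose i))"
    by (intro sum.cong refl) (use Suc in \<open>simp add: sum_distrib_left mult_ac\<close>)
  also have "\<dots> = (\<Sum>i\<le>k. binomial_moment_coeff p j (Suc i) * real (s choose i))"
    by (subst sum.swap) (simp add: sum_distrib_right)
  also have "?m j = (\<Sum>i\<le>k. binomial_moment_coeff p j i * real (s choose i))" by (rule Suc.IH[OF Suc.prems])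
  also have "(\<Sum>i\<le>k. binomial_moment_coeff p j i * real (s choose i)) + (\<Sum>i\<le>k. binomial_moment_coeff p j (Suc i) * real (s choose i))
    = (\<Sum>i\<le>k. binomial_moment_coeff p j i * real (Suc s choose i))"
  proof -
    let ?e = "binomial_moment_coeff p j"
    have ext: "(\<Sum>i\<le>k. ?e i * f i) = (\<Sum>i\<le>Suc k. ?e i * f i)" for f :: "nat \<Rightarrow> real"
      using Suc.prems by (simp add: binomial_moment_coeff_eq_0 del: binomial_moment_coeff.simps)
    show ?thesis
      unfolding ext[of "\<lambda>i. real (s choose i)"] ext[of "\<lambda>i. real (Suc s choose i)"]
      by (simp add: sum.atMost_Suc_shift distrib_left sum.distrib del: sum.atMost_Suc binomial_moment_coeff.simps(2))
  qed
  finally show ?case .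
qed

text \<open>The coefficients of \<open>s choose i\<close> in powers of \<open>s - l\<close>, from (i
  + 1) (s choose (i + 1)) = (s - i) (s choose i).\<close>

fun choose_coeff :: "real \<Rightarrow> nat \<Rightarrow> nat \<Rightarrow> real" where
  "choose_coeff l 0 a = of_bool (a = 0)"
| "choose_coeff l (Suc i) a = (of_bool (a \<noteq> 0) * choose_coeff l i (a - 1) + (l - real i) * choose_coeff l i a) / real (Suc i)"

lemma choose_coeff_eq_0: "i < a \<Longrightarrow> choose_coeff l i a = 0"
  by (induction i arbitrary: a) auto

lemma choose_eq: "real (s choose i) = (\<Sum>a\<le>i. choose_coeff l i a * (real s - l) ^ a)"
proof (induction i)
  case (Suc i)
  let ?c = "choose_coeff l i" and ?D = "real s - l"
  have "real (Suc i) * real (s choose Suc i) = (?D + (l - real i)) * real (s choose i)"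
    using times_choose[of s i] by (simp add: algebra_simps)
  also have "\<dots> = (\<Sum>a\<le>i. ?c a * ?D ^ Suc a) + (\<Sum>a\<le>i. (l - real i) * ?c a * ?D ^ a)"
    unfolding Suc distrib_right sum_distrib_left by (simp only: sum.distrib mult_ac power_Suc)
  also have "(\<Sum>a\<le>i. ?c a * ?D ^ Suc a) = (\<Sum>a\<le>Suc i. of_bool (a \<noteq> 0) * ?c (a - 1) * ?D ^ a)"
    by (simp add: sum.atMost_Suc_shift del: sum.atMost_Suc)
  also have "(\<Sum>a\<le>i. (l - real i) * ?c a * ?D ^ a) = (\<Sum>a\<le>Suc i. (l - real i) * ?c a * ?D ^ a)"
    by (simp add: choose_coeff_eq_0)
  also have "(\<Sum>a\<le>Suc i. of_bool (a \<noteq> 0) * ?c (a - 1) * ?D ^ a) + (\<Sum>a\<le>Suc i. (l - real i) * ?c a * ?D ^ a)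
    = real (Suc i) * (\<Sum>a\<le>Suc i. choose_coeff l (Suc i) a * ?D ^ a)"
    unfolding sum.distrib[symmetric] sum_distrib_left
  proof (rule sum.cong[OF refl])
    fix a
    have "real (Suc i) * choose_coeff l (Suc i) a = of_bool (a \<noteq> 0) * ?c (a - 1) + (l - real i) * ?c a"
      unfolding choose_coeff.simps by (rule nonzero_mult_div_cancel_left[of "real (Suc i)", simplified times_divide_eq_right[symmetric]]) simp
    then show "of_bool (a \<noteq> 0) * ?c (a - 1) * ?D ^ a + (l - real i) * ?c a * ?D ^ a
      = real (Suc i) * (choose_coeff l (Suc i) a * ?D ^ a)"
      unfolding mult.assoc[symmetric] by (simp only: distrib_right)
  qed
  finally show ?case by (simp only: mult_cancel_left) simp
qed simp

text \<open>A step of the recursion either raises the degree by one or multiplies by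
  \<open>l - i\<close>, which is at most \<open>(i + 1) * h\<close> in absolute value and is then
  divided by \<open>i + 1\<close>.\<close>

lemma abs_choose_coeff_le:
  assumes "0 \<le> l" "l \<le> h" "1 \<le> h" "a \<le> i"
  shows "\<bar>choose_coeff l i a\<bar> \<le> 2 ^ i * h ^ (i - a)"
  using assms(4)
proof (induction i arbitrary: a)
  case (Suc i)
  have 1: "\<bar>of_bool (a \<noteq> 0) * choose_coeff l i (a - 1)\<bar> \<le> 2 ^ i * h ^ (Suc i - a)"
  proof (cases a)
    case (Suc b)
    then show ?thesis using Suc.IH[of b] Suc.prems by simp
  qed (use assms in simp)
  have 2: "\<bar>(l - real i) * choose_coeff l i a\<bar> \<le> real (Suc i) * (2 ^ i * h ^ (Suc i - a))"
  proof (cases "a \<le> i")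
    case True
    have "real i * 1 \<le> real i * h" using assms(3) by (intro mult_left_mono) auto
    then have "\<bar>l - real i\<bar> \<le> real (Suc i) * h" using assms by (simp add: distrib_right abs_le_iff)
    then have "\<bar>(l - real i) * choose_coeff l i a\<bar> \<le> (real (Suc i) * h) * (2 ^ i * h ^ (i - a))"
      unfolding abs_mult by (intro mult_mono Suc.IH True) (use assms in auto)
    then show ?thesis using True by (simp add: Suc_diff_le mult_ac)
  next
    case False
    then show ?thesis using assms by (simp add: choose_coeff_eq_0)
  qed
  have "\<bar>choose_coeff l (Suc i) a\<bar> \<le> (2 ^ i * h ^ (Suc i - a) + real (Suc i) * (2 ^ i * h ^ (Suc i - a))) / real (Suc i)"
    unfolding choose_coeff.simps abs_divide abs_of_nat
    by (intro divide_right_mono order_trans[OF abs_triangle_ineq] add_mono 1 2) simp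
  also have "\<dots> \<le> (real (Suc i) * (2 ^ i * h ^ (Suc i - a)) + real (Suc i) * (2 ^ i * h ^ (Suc i - a))) / real (Suc i)"
  proof (intro divide_right_mono add_right_mono)
    have "0 \<le> 2 ^ i * h ^ (Suc i - a)" using assms by simp
    then show "2 ^ i * h ^ (Suc i - a) \<le> real (Suc i) * (2 ^ i * h ^ (Suc i - a))"
      using mult_right_mono[of 1 "real (Suc i)" "2 ^ i * h ^ (Suc i - a)"] by simp
  qed simp
  also have "\<dots> = 2 ^ Suc i * h ^ (Suc i - a)"
    by (simp only: add_divide_distrib nonzero_mult_div_cancel_left of_nat_neq_0) simp
  finally show ?case .
qed simp

text \<open>The probability that \<open>i\<close> given elements of a short window avoid all the primes of \<open>S\<close>.\<close>

definition avoid_prob :: "nat set \<Rightarrow> nat \<Rightarrow> real" where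
  "avoid_prob S i = (\<Prod>p\<in>S. 1 - real i / real p)"

section \<open>Avoidance probabilities compared with independent deletion\<close>

lemma sum_inverse_squares_le:
  assumes "finite S" "\<forall>p\<in>S. Y < p" "1 \<le> Y"
  shows "(\<Sum>p\<in>S. 1 / (real p)\<^sup>2) \<le> 1 / real Y"
proof -
  define m where "m = Max (insert Y S)"
  have sub: "S \<subseteq> {Y<..m}" using assms unfolding m_def by auto
  have "(\<Sum>p\<in>S. 1 / (real p)\<^sup>2) \<le> (\<Sum>p\<in>{Y<..m}. 1 / (real p)\<^sup>2)" by (rule sum_mono2[OF _ sub]) auto
  also have "\<dots> \<le> 1 / real Y - 1 / real m"
  proof -
    have "Y \<le> m" using assms by (simp add: m_def)
    then show ?thesis
    proof (induction m rule: dec_induct)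
      case (step m)
      have "{Y<..Suc m} = insert (Suc m) {Y<..m}" using step by auto
      moreover have "1 / (real (Suc m))\<^sup>2 \<le> 1 / real m - 1 / real (Suc m)"
      proof -
        have m: "0 < real m" using step assms(3) by simp
        then have "1 / (real (Suc m))\<^sup>2 \<le> 1 / (real m * real (Suc m))"
          unfolding power2_eq_square by (intro divide_left_mono mult_right_mono mult_pos_pos) auto
        also have "\<dots> = 1 / real m - 1 / real (Suc m)" using m by (simp add: field_simps)
        finally show ?thesis .
      qed
      ultimately have "(\<Sum>p\<in>{Y<..Suc m}. 1 / (real p)\<^sup>2) \<le> 1 / real m - 1 / real (Suc m) + (\<Sum>p\<in>{Y<..m}. 1 / (real p)\<^sup>2)"
        by simp
      then show ?case using step.IH by linarith
    qed simp
  qed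
  finally show ?thesis by (simp add: order_trans)
qed

lemma one_minus_power_le:
  fixes x :: real
  assumes "0 \<le> x" "x \<le> 1"
  shows "(1 - x) ^ i \<le> 1 - real i * x + (real i)\<^sup>2 * x\<^sup>2"
proof (induction i)
  case (Suc i)
  have "(1 - x) ^ Suc i \<le> (1 - x) * (1 - real i * x + (real i)\<^sup>2 * x\<^sup>2)"
    unfolding power_Suc using assms by (intro mult_left_mono Suc) auto
  also have "\<dots> = 1 - real (Suc i) * x + ((real i)\<^sup>2 + real i) * x\<^sup>2 - (real i)\<^sup>2 * (x\<^sup>2 * x)"
    by (simp add: algebra_simps power2_eq_square)
  also have "\<dots> \<le> 1 - real (Suc i) * x + (real (Suc i))\<^sup>2 * x\<^sup>2"
  proof -
    have "((real i)\<^sup>2 + real i) * x\<^sup>2 \<le> (real (Suc i))\<^sup>2 * x\<^sup>2"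
      by (intro mult_right_mono) (simp_all add: power2_eq_square algebra_simps)
    moreover have "0 \<le> (real i)\<^sup>2 * (x\<^sup>2 * x)" using assms by simp
    ultimately show ?thesis by linarith
  qed
  finally show ?case .
qed simp

text \<open>For x = 1/p the factors 1 - i x and (1 - x)^i differ by a relative error of at most 2
  i^2 x^2, as the second is at least 1/2; and the squares of 1/p sum to at most 1/Y. The error is
  kept relative because a factor of the density is required later.\<close>

lemma avoid_prob_close:
  assumes "finite S" "\<forall>p\<in>S. Y < p" "1 \<le> Y" "2 * i \<le> Y"
  shows "\<bar>avoid_prob S i - coprime_density S ^ i\<bar> \<le> coprime_density S ^ i * (2 * (real i)\<^sup>2 / real Y)"
proof -
  have *: "coprime_density S' ^ i * (1 - 2 * (real i)\<^sup>2 * (\<Sum>p\<in>S'. 1 / (real p)\<^sup>2)) \<le> avoid_prob S' i \<and> avoid_prob S' i \<le> coprime_density S' ^ i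
    \<and> 0 \<le> avoid_prob S' i \<and> 0 \<le> coprime_density S' ^ i" if "finite S'" "S' \<subseteq> S" for S'
    using that
  proof (induction S' rule: finite_induct)
    case empty
    then show ?case by (simp add: avoid_prob_def coprime_density_def)
  next
    case (insert p S')
    define x where "x = 1 / real p"
    define s where "s = (\<Sum>p\<in>S'. 1 / (real p)\<^sup>2)"
    define D where "D = coprime_density S' ^ i"
    define E where "E = avoid_prob S' i"
    have IH: "D * (1 - 2 * (real i)\<^sup>2 * s) \<le> E" "E \<le> D" "0 \<le> E" "0 \<le> D"
      using insert.IH insert.prems unfolding D_def E_def s_def by auto
    have p: "Y < p" using insert assms(2) by auto
    then have x: "0 \<le> x" "x \<le> 1" and ix: "real i * x \<le> 1 / 2"
      using assms(3,4) by (simp_all add: x_def field_simps)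
    have up: "1 - real i * x \<le> (1 - x) ^ i"
      using Bernoulli_inequality[of "- x" i] x by simp
    define g where "g = 2 * (real i)\<^sup>2 * x\<^sup>2"
    have g: "0 \<le> g" "g \<le> 1"
    proof -
      have "(real i * x) * (real i * x) \<le> 1 / 2 * (1 / 2)" using ix x by (intro mult_mono) auto
      then show "g \<le> 1" by (simp add: g_def power2_eq_square mult_ac)
      show "0 \<le> g" by (simp add: g_def)
    qed
    have lo: "(1 - x) ^ i * (1 - g) \<le> 1 - real i * x"
    proof -
      have "1 / 2 \<le> (1 - x) ^ i" using up ix by linarith
      then have "1 / 2 * g \<le> (1 - x) ^ i * g" using g(1) by (rule mult_right_mono)
      then have "(1 - x) ^ i * (1 - g) \<le> (1 - x) ^ i - (real i)\<^sup>2 * x\<^sup>2" by (simp add: right_diff_distrib g_def)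
      then show ?thesis using one_minus_power_le[OF x, of i] by linarith
    qed
    have new: "coprime_density (insert p S') ^ i = (1 - x) ^ i * D" "avoid_prob (insert p S') i = (1 - real i * x) * E"
      "(\<Sum>p\<in>insert p S'. 1 / (real p)\<^sup>2) = x\<^sup>2 + s"
      using insert by (simp_all add: coprime_density_def avoid_prob_def x_def s_def D_def E_def power_mult_distrib power_divide)
    have s0: "0 \<le> s" unfolding s_def by (intro sum_nonneg) simp
    have "(1 - x) ^ i * D * (1 - 2 * (real i)\<^sup>2 * (x\<^sup>2 + s)) \<le> (1 - x) ^ i * D * ((1 - g) * (1 - 2 * (real i)\<^sup>2 * s))"
    proof (rule mult_left_mono)
      have "0 \<le> g * (2 * (real i)\<^sup>2 * s)" using g s0 by simp
      then show "1 - 2 * (real i)\<^sup>2 * (x\<^sup>2 + s) \<le> (1 - g) * (1 - 2 * (real i)\<^sup>2 * s)" by (simp add: g_def algebra_simps)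
    qed (use x IH in simp)
    also have "\<dots> = ((1 - x) ^ i * (1 - g)) * (D * (1 - 2 * (real i)\<^sup>2 * s))" by (simp only: mult_ac)
    also have "\<dots> \<le> ((1 - x) ^ i * (1 - g)) * E" by (rule mult_left_mono[OF IH(1)]) (use x g in simp)
    also have "\<dots> \<le> (1 - real i * x) * E" by (rule mult_right_mono[OF lo IH(3)])
    finally have A: "(1 - x) ^ i * D * (1 - 2 * (real i)\<^sup>2 * (x\<^sup>2 + s)) \<le> (1 - real i * x) * E" .
    have B: "(1 - real i * x) * E \<le> (1 - x) ^ i * D" by (rule mult_mono[OF up IH(2)]) (use x IH in auto)
    show ?case unfolding new using A B x IH ix by auto
  qed
  define D where "D = coprime_density S ^ i"
  define s where "s = (\<Sum>p\<in>S. 1 / (real p)\<^sup>2)"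
  have s: "s \<le> 1 / real Y" unfolding s_def by (rule sum_inverse_squares_le[OF assms(1-3)])
  have c: "D * (1 - 2 * (real i)\<^sup>2 * s) \<le> avoid_prob S i" "avoid_prob S i \<le> D" "0 \<le> D"
    using *[OF assms(1)] unfolding D_def s_def by auto
  have "\<bar>avoid_prob S i - D\<bar> \<le> D * (2 * (real i)\<^sup>2 * s)" using c by (simp add: right_diff_distrib)
  also have "\<dots> \<le> D * (2 * (real i)\<^sup>2 * (1 / real Y))" by (intro mult_left_mono s c) simp
  finally show ?thesis unfolding D_def by simp
qed

text \<open>For primes up to \<open>2 ^ (2 * k * (N + 1))\<close> the quantity
  \<open>log_size\<close> is at most polynomial in \<open>N\<close>. All moments up to
  \<open>k\<close> are provided, since the thinned \<open>k\<close>-th moment involves the lower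
  ones.\<close>

lemma small_prime_moments:
  "\<exists>C A. 0 \<le> C \<and> (\<forall>l\<le>k. \<forall>S h N. finite S \<longrightarrow> (\<forall>p\<in>S. prime p \<and> p \<le> 2 ^ (2 * k * (N + 1))) \<longrightarrow> h \<le> 2 ^ N \<longrightarrow> 2 ^ N \<le> 2 * h \<longrightarrow>
    \<bar>\<Sum>n<\<Prod>S. (real (window_count S h n) - coprime_density S * real h) ^ l\<bar>
      \<le> real (\<Prod>S) * (C * (real N + 1) ^ A * real h ^ (l div 2)))" if k: "1 \<le> k"
proof -
  obtain C0 A0 where C0: "\<And>l. (0::real) \<le> C0 l \<and> (\<forall>S J N. finite S \<longrightarrow> (\<forall>p\<in>S. prime p) \<longrightarrow> finite J \<longrightarrow> card J = l \<longrightarrow>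
    weighted_count N S J \<le> C0 l * log_size N S ^ A0 l * 2 ^ (N * (l div 2)))"
    using weighted_count_bound by metis
  define c where "c = 1 + 2 * (2 * real k) ^ 8"
  define A where "A = (\<Sum>l\<le>k. A0 l)"
  define C where "C = (\<Sum>l\<le>k. C0 l) * c ^ A * 2 ^ k"
  have c1: "1 \<le> c" by (simp add: c_def)
  have sumC: "0 \<le> (\<Sum>l\<le>k. C0 l)" using C0 by (intro sum_nonneg) auto
  show ?thesis
  proof (intro exI[of _ C] exI[of _ "8 * A"] conjI allI impI)
    show "0 \<le> C" unfolding C_def using sumC c1 by simp
    fix l :: nat and S :: "nat set" and h N :: nat
    assume l: "l \<le> k" and S: "finite S" "\<forall>p\<in>S. prime p \<and> p \<le> 2 ^ (2 * k * (N + 1))" and h: "h \<le> 2 ^ N" "2 ^ N \<le> 2 * h"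
    have primes: "\<forall>p\<in>S. prime p" using S by blast
    define f where "f = (\<lambda>n. (real (window_count S h n) - coprime_density S * real h) ^ l)"
    define L where "L = log_size N S"
    define m where "m = 2 * k * (N + 1)"
    have "\<forall>p\<in>S. p dvd \<Prod>S" using dvd_prodI[OF S(1), of _ "\<lambda>x. x"] by simp
    from window_count_periodic[OF this, of h 0] have "f (\<Prod>S) = f 0" by (simp add: f_def)
    then have "(\<Sum>n<\<Prod>S. f n) = (\<Sum>n=1..\<Prod>S. f n)" by (rule sum_period_shift[symmetric])
    also have "\<dots> = (\<Sum>n=1..\<Prod>S. window_deviation S h n ^ card {..<l})"
      by (simp add: f_def window_deviation_eq[OF S(1) primes])
    finally have "\<bar>\<Sum>n<\<Prod>S. f n\<bar> \<le> real (\<Prod>S) * weighted_count N S {..<l}"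
      using window_moment_le[OF S(1) primes finite_lessThan h(1), of l] by simp
    also have "\<dots> \<le> real (\<Prod>S) * (C * (real N + 1) ^ (8 * A) * real h ^ (l div 2))"
    proof (rule mult_left_mono)
      have m1: "1 \<le> m" using k by (simp add: m_def)
      have d: "1 / (2 * real m ^ 8) \<le> coprime_density S" by (rule coprime_density_ge[OF m1]) (use S in \<open>simp add: m_def\<close>)
      have dm: "0 \<le> divisor_mass S" using divisor_mass_ge_1[OF S(1)] by simp
      have "divisor_mass S * (1 / (2 * real m ^ 8)) \<le> 1"
        using mult_left_mono[OF d dm] divisor_mass_le[OF primes] by linarith
      then have "divisor_mass S \<le> 2 * real m ^ 8" using m1 by (simp add: field_simps)
      also have "real m = (2 * real k) * (real N + 1)" by (simp add: m_def distrib_left)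
      finally have "L \<le> (real N + 1) + 2 * (2 * real k) ^ 8 * (real N + 1) ^ 8"
        by (simp add: L_def log_size_def power_mult_distrib)
      also have "\<dots> \<le> c * (real N + 1) ^ 8"
        using self_le_power[of "real N + 1" 8] by (simp add: c_def distrib_right)
      finally have L: "L \<le> c * (real N + 1) ^ 8" .
      have L1: "1 \<le> L" unfolding L_def by (rule log_size_ge_1[OF S(1)])
      have "weighted_count N S {..<l} \<le> C0 l * L ^ A0 l * 2 ^ (N * (l div 2))"
        unfolding L_def using C0[of l] S(1) primes by simp
      also have "\<dots> \<le> (\<Sum>l\<le>k. C0 l) * (c ^ A * (real N + 1) ^ (8 * A)) * (2 ^ k * real h ^ (l div 2))"
      proof (intro mult_mono)
        show "C0 l \<le> (\<Sum>l\<le>k. C0 l)" using C0 l by (intro member_le_sum) auto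
        have "A0 l \<le> A" unfolding A_def using l by (intro member_le_sum) auto
        then have "L ^ A0 l \<le> L ^ A" using L1 by (rule power_increasing)
        also have "\<dots> \<le> (c * (real N + 1) ^ 8) ^ A" using L L1 by (intro power_mono) auto
        finally show "L ^ A0 l \<le> c ^ A * (real N + 1) ^ (8 * A)" by (simp add: power_mult_distrib power_mult)
        have "real (2 ^ N) \<le> real (2 * h)" using h(2) by (simp only: of_nat_le_iff)
        then have "(2 ^ N) ^ (l div 2) \<le> (2 * real h) ^ (l div 2)" by (intro power_mono) auto
        also have "\<dots> = 2 ^ (l div 2) * real h ^ (l div 2)" by (rule power_mult_distrib)
        also have "\<dots> \<le> 2 ^ k * real h ^ (l div 2)" using l by (intro mult_right_mono power_increasing) auto
        finally show "2 ^ (N * (l div 2)) \<le> 2 ^ k * real h ^ (l div 2)" by (simp add: power_mult)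
      qed (use sumC c1 L1 in auto)
      finally show "weighted_count N S {..<l} \<le> C * (real N + 1) ^ (8 * A) * real h ^ (l div 2)"
        by (simp add: C_def mult_ac)
    qed (simp del: of_nat_prod)
    finally show "\<bar>\<Sum>n<\<Prod>S. (real (window_count S h n) - coprime_density S * real h) ^ l\<bar>
      \<le> real (\<Prod>S) * (C * (real N + 1) ^ (8 * A) * real h ^ (l div 2))" unfolding f_def .
  qed
qed

text \<open>As \<open>v \<le> u\<close>, the term is at most \<open>(p * h) ^ v\<close>, which for
  positive \<open>v\<close> is at most one of the two extreme powers. For \<open>v = 0\<close> the
  surviving factor \<open>p\<close> is at most \<open>p * h\<close>, hence the condition
  \<open>1 \<le> u\<close>.\<close>

lemma power_mult_le_interpolation:
  fixes p h :: real
  assumes "0 \<le> p" "p \<le> 1" "1 \<le> h" "1 \<le> u" "v \<le> u" "v \<le> K"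
  shows "p ^ u * h ^ v \<le> p * h + (p * h) ^ K"
proof (cases "v = 0")
  case True
  have "p ^ u \<le> p ^ 1" using assms by (intro power_decreasing) auto
  also have "\<dots> \<le> p * h" using mult_left_mono[OF assms(3,1)] by simp
  also have "\<dots> \<le> p * h + (p * h) ^ K" using assms by simp
  finally show ?thesis using True by simp
next
  case False
  have "p ^ u * h ^ v \<le> p ^ v * h ^ v" using assms by (intro mult_right_mono power_decreasing) auto
  also have "\<dots> = (p * h) ^ v" by (rule power_mult_distrib[symmetric])
  also have "\<dots> \<le> p * h + (p * h) ^ K"
  proof (cases "p * h \<le> 1")
    case True
    have "(p * h) ^ v \<le> (p * h) ^ 1" using True False assms by (intro power_decreasing) auto
    moreover have "0 \<le> (p * h) ^ K" using assms by simp
    ultimately show ?thesis by simp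
  next
    case False
    then have "(p * h) ^ v \<le> (p * h) ^ K" using assms by (intro power_increasing) auto
    moreover have "0 \<le> p * h" using assms by simp
    ultimately show ?thesis by simp
  qed
  finally show ?thesis .
qed

definition thinning_const :: "nat \<Rightarrow> real" where
  "thinning_const k = (\<Sum>j\<le>k. \<Sum>i\<le>k. \<Sum>a\<le>i. real (k choose j) * moment_const j i * 2 ^ i)"

lemma thinning_const_nonneg: "0 \<le> thinning_const k"
  unfolding thinning_const_def by (intro sum_nonneg mult_nonneg_nonneg moment_const_nonneg of_nat_0_le_iff zero_le_power) simp_all

text \<open>Given the moments of the window counts \<open>s n\<close> for the small primes, thinning by independent deletion
  with survival probability \<open>p\<close> replaces \<open>h\<close> by \<open>p h\<close> in the bounds.\<close>

lemma thinned_moment_le: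
  fixes s :: "nat \<Rightarrow> nat" and p l B :: real
  assumes k: "odd k" and p: "0 \<le> p" "p \<le> 1" and h: "1 \<le> h" and l: "0 \<le> l" "l \<le> real h" and B: "0 \<le> B"
    and mom: "\<And>r. r \<le> k \<Longrightarrow> \<bar>\<Sum>n<q. (real (s n) - l) ^ r\<bar> \<le> B * real h ^ (r div 2)"
  shows "\<bar>\<Sum>n<q. binomial_exp p (s n) (\<lambda>x. (real x - p * l) ^ k)\<bar>
    \<le> thinning_const k * B * (p * real h + (p * real h) ^ (k div 2))"
proof -
  define W where "W = p * real h + (p * real h) ^ (k div 2)"
  have W0: "0 \<le> W" using p by (simp add: W_def)
  define t where "t = (\<lambda>j i a. real (k choose j) * binomial_moment_coeff p j i * p ^ (k - j) * choose_coeff l i a)"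
  have expand: "binomial_exp p s' (\<lambda>x. (real x - p * l) ^ k) = (\<Sum>j\<le>k. \<Sum>i\<le>k. \<Sum>a\<le>i. t j i a * (real s' - l) ^ (a + (k - j)))" for s'
  proof -
    \<comment> \<open>The deviation splits into the binomial fluctuation around
      \<open>p * s'\<close> and \<open>p\<close> times the deviation of \<open>s'\<close> from
      \<open>l\<close>.\<close>
    have "(\<lambda>x. (real x - p * l) ^ k) = (\<lambda>x. ((real x - p * real s') + p * (real s' - l)) ^ k)" by (simp add: algebra_simps)
    also have "\<dots> = (\<lambda>x. \<Sum>j\<le>k. (real (k choose j) * (p * (real s' - l)) ^ (k - j)) * (real x - p * real s') ^ j)"
      by (simp only: binomial_ring mult_ac)
    finally have "binomial_exp p s' (\<lambda>x. (real x - p * l) ^ k)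
      = (\<Sum>j\<le>k. (real (k choose j) * (p * (real s' - l)) ^ (k - j)) * binomial_exp p s' (\<lambda>x. (real x - p * real s') ^ j))"
      by (simp only: binomial_exp_sum[OF finite_atMost] binomial_exp_cmult)
    also have "\<dots> = (\<Sum>j\<le>k. \<Sum>i\<le>k. \<Sum>a\<le>i. t j i a * (real s' - l) ^ (a + (k - j)))"
    proof (rule sum.cong[OF refl])
      fix j assume "j \<in> {..k}"
      then have j: "j \<le> k" by simp
      show "(real (k choose j) * (p * (real s' - l)) ^ (k - j)) * binomial_exp p s' (\<lambda>x. (real x - p * real s') ^ j)
        = (\<Sum>i\<le>k. \<Sum>a\<le>i. t j i a * (real s' - l) ^ (a + (k - j)))"
        unfolding binomial_central_moment[OF j] choose_eq[of s' _ l] sum_distrib_left t_def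
        by (intro sum.cong refl) (simp only: power_mult_distrib power_add mult_ac)
    qed
    finally show ?thesis .
  qed
  have bd: "\<bar>t j i a * (\<Sum>n<q. (real (s n) - l) ^ (a + (k - j)))\<bar> \<le> real (k choose j) * moment_const j i * 2 ^ i * (B * W)"
    if j: "j \<le> k" and a: "a \<le> i" for j i a
  proof (cases "binomial_moment_coeff p j i = 0")
    case True
    have "0 \<le> real (k choose j) * moment_const j i * 2 ^ i * (B * W)"
      by (intro mult_nonneg_nonneg moment_const_nonneg B W0) auto
    then show ?thesis using True by (simp add: t_def)
  next
    case False
    then have ij: "2 * i \<le> j" using binomial_moment_coeff_eq_0[of j i p] by linarith
    \<comment> \<open>For \<open>i = 0\<close> only \<open>j = 0\<close> has a nonzero coefficient,
      so \<open>i = 0\<close> and \<open>j = k\<close> would force \<open>k = 0\<close>.\<close>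
    have u1: "1 \<le> i + (k - j)"
    proof (rule ccontr)
      assume "\<not> ?thesis"
      then have "i = 0" "j = k" using j by auto
      then show False using False k by (cases k) auto
    qed
    have r: "a + (k - j) \<le> k" using ij a j by linarith
    \<comment> \<open>The total exponent of \<open>h\<close>: \<open>i - a\<close> from
      \<open>choose_coeff\<close>, the rest from the moment of \<open>s\<close>. That it stays
      within \<open>k div 2\<close> rests on \<open>2 * i \<le> j\<close>.\<close>
    define v where "v = (i - a) + (a + (k - j)) div 2"
    define w where "w = (a + (k - j)) div 2"
    have "2 * w \<le> a + (k - j)" by (simp add: w_def)
    moreover have "v + a = i + w" using a by (simp add: v_def w_def)
    moreover have "k - j + j = k" using j by simp
    ultimately have v: "v \<le> i + (k - j)" "2 * v \<le> k" using ij by linarith+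
    from v(2) have "v \<le> k div 2" by simp
    note v = v(1) this
    have "\<bar>t j i a * (\<Sum>n<q. (real (s n) - l) ^ (a + (k - j)))\<bar>
      = real (k choose j) * \<bar>binomial_moment_coeff p j i\<bar> * p ^ (k - j) * \<bar>choose_coeff l i a\<bar> * \<bar>\<Sum>n<q. (real (s n) - l) ^ (a + (k - j))\<bar>"
      unfolding t_def abs_mult using p by (simp add: abs_mult power_abs)
    also have "\<dots> \<le> real (k choose j) * (moment_const j i * p ^ i) * p ^ (k - j) * (2 ^ i * real h ^ (i - a)) * (B * real h ^ ((a + (k - j)) div 2))"
      by (intro mult_mono order_refl abs_binomial_moment_coeff_le abs_choose_coeff_le mom r mult_nonneg_nonneg moment_const_nonneg a)
        (use p l h B in auto)
    also have "\<dots> = real (k choose j) * moment_const j i * 2 ^ i * (B * (p ^ (i + (k - j)) * real h ^ v))"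
      unfolding v_def power_add by (simp only: mult_ac)
    also have "\<dots> \<le> real (k choose j) * moment_const j i * 2 ^ i * (B * W)"
      unfolding W_def
      by (intro mult_left_mono power_mult_le_interpolation p u1 v B mult_nonneg_nonneg moment_const_nonneg) (use h in auto)
    finally show ?thesis .
  qed
  have eq: "(\<Sum>n<q. binomial_exp p (s n) (\<lambda>x. (real x - p * l) ^ k))
    = (\<Sum>j\<le>k. \<Sum>i\<le>k. \<Sum>a\<le>i. t j i a * (\<Sum>n<q. (real (s n) - l) ^ (a + (k - j))))"
  proof -
    have "(\<Sum>n<q. binomial_exp p (s n) (\<lambda>x. (real x - p * l) ^ k))
      = (\<Sum>j\<le>k. \<Sum>n<q. \<Sum>i\<le>k. \<Sum>a\<le>i. t j i a * (real (s n) - l) ^ (a + (k - j)))"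
      unfolding expand by (rule sum.swap)
    also have "\<dots> = (\<Sum>j\<le>k. \<Sum>i\<le>k. \<Sum>n<q. \<Sum>a\<le>i. t j i a * (real (s n) - l) ^ (a + (k - j)))"
      by (rule sum.cong[OF refl], rule sum.swap)
    also have "\<dots> = (\<Sum>j\<le>k. \<Sum>i\<le>k. \<Sum>a\<le>i. \<Sum>n<q. t j i a * (real (s n) - l) ^ (a + (k - j)))"
      by (intro sum.cong[OF refl], rule sum.swap)
    finally show ?thesis unfolding sum_distrib_left .
  qed
  have "\<bar>\<Sum>n<q. binomial_exp p (s n) (\<lambda>x. (real x - p * l) ^ k)\<bar> \<le> (\<Sum>j\<le>k. \<Sum>i\<le>k. \<Sum>a\<le>i. \<bar>t j i a * (\<Sum>n<q. (real (s n) - l) ^ (a + (k - j)))\<bar>)"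
    unfolding eq by (rule order_trans[OF sum_abs], rule sum_mono, rule order_trans[OF sum_abs], rule sum_mono, rule sum_abs)
  also have "\<dots> \<le> (\<Sum>j\<le>k. \<Sum>i\<le>k. \<Sum>a\<le>i. real (k choose j) * moment_const j i * 2 ^ i * (B * W))"
  proof (rule sum_mono, rule sum_mono, rule sum_mono)
    fix j i a assume "j \<in> {..k}" "i \<in> {..k}" "a \<in> {..i}"
    then have ja: "j \<le> k" "a \<le> i" by simp_all
    show "\<bar>t j i a * (\<Sum>n<q. (real (s n) - l) ^ (a + (k - j)))\<bar> \<le> real (k choose j) * moment_const j i * 2 ^ i * (B * W)"
      by (rule bd[OF ja])
  qed
  also have "\<dots> = thinning_const k * B * W"
    unfolding thinning_const_def mult.assoc[of _ B W] sum_distrib_right ..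
  finally show ?thesis unfolding W_def .
qed

section \<open>Small and large primes combined\<close>

lemma choose_le_power: "real (s choose i) \<le> real h ^ i" if "s \<le> h"
proof (cases "i \<le> s")
  case True
  have "real (s choose i) \<le> real (s ^ i)" using binomial_le_pow[OF True] by (simp only: of_nat_le_iff)
  also have "\<dots> \<le> real h ^ i" unfolding of_nat_power using that by (intro power_mono) auto
  finally show ?thesis .
qed (simp add: binomial_eq_0)

text \<open>The factorial moments are those of binomial thinning, except that
  \<open>avoid_prob S2 i\<close> stands in for \<open>p ^ i\<close>. Coefficients and factorial
  moments amount to at most a constant times \<open>h ^ (2 * k)\<close>, which the lower bound for
  \<open>Y\<close> compensates. The error retains a factor \<open>p\<close> so that it stays below
  \<open>p * h\<close>, even when \<open>p\<close> is tiny.\<close>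

lemma large_prime_thinning:
  fixes S1 S2 :: "nat set"
  assumes fin: "finite S1" "finite S2" and pr: "\<forall>p\<in>S1 \<union> S2. prime p" and disj: "S1 \<inter> S2 = {}"
    and h: "1 \<le> h" and Y: "\<forall>p\<in>S2. Y < p" "real h ^ (2 * k) \<le> real Y" "h \<le> Y" "2 * k \<le> Y"
    and \<mu>: "0 \<le> \<mu>" "\<mu> \<le> real h"
  defines "p \<equiv> coprime_density S2"
  shows "\<bar>\<Sum>n<\<Prod>(S1 \<union> S2). (real (window_count (S1 \<union> S2) h n) - \<mu>) ^ k\<bar>
    \<le> real (\<Prod>S2) * \<bar>\<Sum>n<\<Prod>S1. binomial_exp p (window_count S1 h n) (\<lambda>x. (real x - \<mu>) ^ k)\<bar>
      + real (\<Prod>(S1 \<union> S2)) * (real (k + 1) * (real (2 * k + 1) ^ k * 2 ^ k * (2 * (real k)\<^sup>2)) * p)"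
proof -
  define q1 where "q1 = \<Prod>S1"
  define q2 where "q2 = \<Prod>S2"
  have q: "\<Prod>(S1 \<union> S2) = q1 * q2" unfolding q1_def q2_def using fin disj by (simp add: prod.union_disjoint)
  define c where "c = shifted_power_coeff \<mu> k"
  define s where "s = window_count S1 h"
  have p01: "0 \<le> p" "p \<le> 1"
  proof -
    have "0 \<le> 1 - 1 / real r \<and> 1 - 1 / real r \<le> 1" if "r \<in> S2" for r
    proof -
      have "1 \<le> r" using pr that prime_ge_1_nat by blast
      then show ?thesis by simp
    qed
    then show "0 \<le> p" "p \<le> 1" unfolding p_def coprime_density_def by (auto intro!: prod_nonneg prod_le_1)
  qed
  have hp: "\<forall>p\<in>S2. h \<le> p" using Y(1,3) by force
  have Y1: "1 \<le> Y" using h Y(3) by linarith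
  have mid: "(\<Prod>r\<in>S2. real r - real i) = real q2 * avoid_prob S2 i" for i
  proof -
    have "(\<Prod>r\<in>S2. real r - real i) = (\<Prod>r\<in>S2. real r * (1 - real i / real r))"
    proof (rule prod.cong[OF refl])
      fix r assume "r \<in> S2"
      then have "0 < r" using Y(1) by force
      then show "real r - real i = real r * (1 - real i / real r)" by (simp add: field_simps)
    qed
    then show ?thesis by (simp add: prod.distrib q2_def avoid_prob_def)
  qed
  have "(\<Sum>n<q1 * q2. (real (window_count (S1 \<union> S2) h n) - \<mu>) ^ k)
    = (\<Sum>i\<le>k. c i * (\<Sum>n<q1 * q2. real (window_count (S1 \<union> S2) h n choose i)))"
    unfolding shifted_power_eq c_def sum_distrib_left by (rule sum.swap)
  also have "\<dots> = (\<Sum>i\<le>k. c i * (real q2 * avoid_prob S2 i * (\<Sum>n<q1. real (s n choose i))))"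
    using sum_window_count_choose[OF fin pr disj hp] unfolding q mid q1_def[symmetric] s_def by simp
  also have "\<dots> = real q2 * (\<Sum>i\<le>k. c i * p ^ i * (\<Sum>n<q1. real (s n choose i)))
    + real q2 * (\<Sum>i\<le>k. c i * (avoid_prob S2 i - p ^ i) * (\<Sum>n<q1. real (s n choose i)))"
    unfolding sum_distrib_left sum.distrib[symmetric] by (intro sum.cong refl) (simp add: algebra_simps)
  also have "(\<Sum>i\<le>k. c i * p ^ i * (\<Sum>n<q1. real (s n choose i))) = (\<Sum>n<q1. binomial_exp p (s n) (\<lambda>x. (real x - \<mu>) ^ k))"
  proof -
    have "binomial_exp p s' (\<lambda>x. (real x - \<mu>) ^ k) = (\<Sum>i\<le>k. c i * p ^ i * real (s' choose i))" for s'
      unfolding shifted_power_eq c_def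
      by (simp only: binomial_exp_sum[OF finite_atMost] binomial_exp_cmult binomial_exp_choose mult.assoc)
    then show ?thesis unfolding sum_distrib_left by (simp only:) (rule sum.swap)
  qed
  finally have eq: "(\<Sum>n<q1 * q2. (real (window_count (S1 \<union> S2) h n) - \<mu>) ^ k)
    = real q2 * (\<Sum>n<q1. binomial_exp p (s n) (\<lambda>x. (real x - \<mu>) ^ k))
    + real q2 * (\<Sum>i\<le>k. c i * (avoid_prob S2 i - p ^ i) * (\<Sum>n<q1. real (s n choose i)))" .
  define E where "E = real (2 * k + 1) ^ k * 2 ^ k * (2 * (real k)\<^sup>2)"
  have err: "\<bar>\<Sum>i\<le>k. c i * (avoid_prob S2 i - p ^ i) * (\<Sum>n<q1. real (s n choose i))\<bar> \<le> real q1 * (real (k + 1) * E * p)"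
  proof -
    have "\<bar>c i * (avoid_prob S2 i - p ^ i) * (\<Sum>n<q1. real (s n choose i))\<bar> \<le> real q1 * (E * p)" if i: "i \<le> k" for i
    proof (cases "i = 0")
      \<comment> \<open>For \<open>i = 0\<close> no factor \<open>p\<close> could be extracted from
        \<open>p ^ i\<close>, but there the two probabilities agree.\<close>
      case True
      then show ?thesis using p01 by (simp add: avoid_prob_def E_def)
    next
      case False
      have c: "\<bar>c i\<bar> \<le> real (2 * k + 1) ^ k * (2 * real h) ^ k"
      proof -
        have "\<bar>c i\<bar> \<le> real (2 * k + 1) ^ k * (1 + \<mu>) ^ k" unfolding c_def by (rule abs_shifted_power_coeff_le[OF \<mu>(1)])
        also have "\<dots> \<le> real (2 * k + 1) ^ k * (2 * real h) ^ k" using \<mu> h by (intro mult_left_mono power_mono) auto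
        finally show ?thesis .
      qed
      have a: "\<bar>avoid_prob S2 i - p ^ i\<bar> \<le> p * (2 * (real k)\<^sup>2 / real h ^ (2 * k))"
      proof -
        have "\<bar>avoid_prob S2 i - p ^ i\<bar> \<le> p ^ i * (2 * (real i)\<^sup>2 / real Y)"
          unfolding p_def by (rule avoid_prob_close[OF fin(2) Y(1) Y1]) (use Y(4) i in linarith)
        also have "\<dots> \<le> p * (2 * (real k)\<^sup>2 / real h ^ (2 * k))"
        proof (rule mult_mono)
          show "p ^ i \<le> p" using power_decreasing[of 1 i p] False p01 by simp
          have "2 * (real i)\<^sup>2 \<le> 2 * (real k)\<^sup>2" using i by (intro mult_left_mono power_mono) auto
          then show "2 * (real i)\<^sup>2 / real Y \<le> 2 * (real k)\<^sup>2 / real h ^ (2 * k)"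
            by (rule frac_le[rotated]) (use h Y(2) in auto)
        qed (use p01 in auto)
        finally show ?thesis .
      qed
      have ch: "\<bar>\<Sum>n<q1. real (s n choose i)\<bar> \<le> real q1 * real h ^ k"
      proof -
        have "(\<Sum>n<q1. real (s n choose i)) \<le> (\<Sum>n<q1. real h ^ k)"
        proof (rule sum_mono)
          fix n
          have "real (s n choose i) \<le> real h ^ i" unfolding s_def by (rule choose_le_power[OF window_count_le])
          also have "\<dots> \<le> real h ^ k" using i h by (intro power_increasing) auto
          finally show "real (s n choose i) \<le> real h ^ k" .
        qed
        moreover have "0 \<le> (\<Sum>n<q1. real (s n choose i))" by (intro sum_nonneg) simp
        ultimately show ?thesis by simp
      qed
      have "\<bar>c i * (avoid_prob S2 i - p ^ i) * (\<Sum>n<q1. real (s n choose i))\<bar>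
        \<le> (real (2 * k + 1) ^ k * (2 * real h) ^ k) * (p * (2 * (real k)\<^sup>2 / real h ^ (2 * k))) * (real q1 * real h ^ k)"
        unfolding abs_mult by (intro mult_mono c a ch) (use p01 in auto)
      also have "\<dots> = real q1 * (E * p) * (real h ^ k * real h ^ k / real h ^ (2 * k))"
        unfolding E_def power_mult_distrib by (simp only: times_divide_eq_right times_divide_eq_left mult_ac)
      also have "\<dots> = real q1 * (E * p)" using h by (simp add: mult_2 power_add)
      finally show ?thesis .
    qed
    then have "(\<Sum>i\<le>k. \<bar>c i * (avoid_prob S2 i - p ^ i) * (\<Sum>n<q1. real (s n choose i))\<bar>) \<le> (\<Sum>i\<le>k. real q1 * (E * p))"
      by (intro sum_mono) simp
    also have "\<dots> = real q1 * (real (k + 1) * E * p)" by (simp add: algebra_simps)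
    finally show ?thesis by (rule order_trans[OF sum_abs])
  qed
  have "\<bar>\<Sum>n<q1 * q2. (real (window_count (S1 \<union> S2) h n) - \<mu>) ^ k\<bar>
    \<le> real q2 * \<bar>\<Sum>n<q1. binomial_exp p (s n) (\<lambda>x. (real x - \<mu>) ^ k)\<bar>
    + real q2 * \<bar>\<Sum>i\<le>k. c i * (avoid_prob S2 i - p ^ i) * (\<Sum>n<q1. real (s n choose i))\<bar>"
    unfolding eq by (rule order_trans[OF abs_triangle_ineq]) (simp add: abs_mult)
  also have "\<dots> \<le> real q2 * \<bar>\<Sum>n<q1. binomial_exp p (s n) (\<lambda>x. (real x - \<mu>) ^ k)\<bar>
    + real q2 * (real q1 * (real (k + 1) * E * p))"
    by (intro add_left_mono mult_left_mono err) simp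
  finally show ?thesis unfolding q E_def s_def q1_def q2_def by (simp add: mult_ac)
qed

theorem squarefree_moment_bound:
  assumes k: "odd k" "3 \<le> k"
  shows "\<exists>C A. 0 \<le> C \<and> (\<forall>S h N. finite S \<longrightarrow> (\<forall>p\<in>S. prime p) \<longrightarrow> 1 \<le> h \<longrightarrow> h \<le> 2 ^ N \<longrightarrow> 2 ^ N \<le> 2 * h \<longrightarrow>
    \<bar>\<Sum>n<\<Prod>S. (real (window_count S h n) - coprime_density S * real h) ^ k\<bar>
      \<le> real (\<Prod>S) * (C * (real N + 1) ^ A * (coprime_density S * real h + (coprime_density S * real h) ^ (k div 2))))"
proof -
  have k1: "1 \<le> k" using k by simp
  obtain C1 A1 where sm: "0 \<le> C1 \<and> (\<forall>l\<le>k. \<forall>S h N. finite S \<longrightarrow> (\<forall>p\<in>S. prime p \<and> p \<le> 2 ^ (2 * k * (N + 1))) \<longrightarrow>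
    h \<le> 2 ^ N \<longrightarrow> 2 ^ N \<le> 2 * h \<longrightarrow> \<bar>\<Sum>n<\<Prod>S. (real (window_count S h n) - coprime_density S * real h) ^ l\<bar>
      \<le> real (\<Prod>S) * (C1 * (real N + 1) ^ A1 * real h ^ (l div 2)))"
    using small_prime_moments[OF k1] by (elim exE) (rule that)
  note C1 = conjunct1[OF sm] and small = conjunct2[OF sm, rule_format]
  define E where "E = real (k + 1) * (real (2 * k + 1) ^ k * 2 ^ k * (2 * (real k)\<^sup>2))"
  have E0: "0 \<le> E" by (simp add: E_def)
  define g where "g = 2 * (2 * real k) ^ 8"
  define C where "C = (thinning_const k * C1 + E) * g ^ (k div 2)"
  define A where "A = A1 + 8 * (k div 2)"
  have g1: "1 \<le> g"
  proof -
    have "1 ^ 8 \<le> (2 * real k) ^ 8" using k by (intro power_mono) auto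
    then show ?thesis by (simp add: g_def)
  qed
  show ?thesis
  proof (intro exI[of _ C] exI[of _ A] conjI allI impI)
    show "0 \<le> C" unfolding C_def using C1 E0 g1 thinning_const_nonneg[of k] by simp
    fix S :: "nat set" and h N :: nat
    assume S: "finite S" "\<forall>p\<in>S. prime p" and h: "1 \<le> h" "h \<le> 2 ^ N" "2 ^ N \<le> 2 * h"
    \<comment> \<open>This makes \<open>Y\<close> at least \<open>h ^ (2 * k)\<close>,
      \<open>h\<close> and \<open>2 * k\<close>, while its logarithm stays linear in
      \<open>N\<close>.\<close>
    define m where "m = 2 * k * (N + 1)"
    define Y :: nat where "Y = 2 ^ m"
    define S1 where "S1 = {p \<in> S. p \<le> Y}"
    define S2 where "S2 = {p \<in> S. Y < p}"
    have S12: "S1 \<union> S2 = S" "S1 \<inter> S2 = {}" "finite S1" "finite S2" using S by (auto simp: S1_def S2_def)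
    have pr: "\<forall>p\<in>S1 \<union> S2. prime p" using S S12 by simp
    define P1 where "P1 = coprime_density S1"
    define p where "p = coprime_density S2"
    define P where "P = coprime_density S"
    have P: "P = P1 * p"
      unfolding P_def P1_def p_def coprime_density_def S12(1)[symmetric] by (rule prod.union_disjoint) (use S12 in auto)
    have d01: "0 \<le> coprime_density V \<and> coprime_density V \<le> 1" if "V \<subseteq> S" for V
    proof -
      have "0 \<le> 1 - 1 / real r \<and> 1 - 1 / real r \<le> 1" if "r \<in> V" for r
      proof -
        have "1 \<le> r" using S(2) that \<open>V \<subseteq> S\<close> prime_ge_1_nat by blast
        then show ?thesis by simp
      qed
      then show ?thesis unfolding coprime_density_def by (auto intro!: prod_nonneg prod_le_1)
    qed
    have P101: "0 \<le> P1" "P1 \<le> 1" and p01: "0 \<le> p" "p \<le> 1"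
      using d01[of S1] d01[of S2] by (auto simp: P1_def p_def S1_def S2_def)
    define l where "l = P1 * real h"
    have l: "0 \<le> l" "l \<le> real h" using P101 h(1) by (auto simp: l_def mult_left_le_one_le)
    have pl: "p * l = P * real h" by (simp add: l_def P)
    define B where "B = C1 * (real N + 1) ^ A1"
    have B0: "0 \<le> B" using C1 by (simp add: B_def)
    define W where "W = p * real h + (p * real h) ^ (k div 2)"
    have "N \<le> 1 * (N + 1)" by simp
    also have "\<dots> \<le> 2 * k * (N + 1)" by (rule mult_right_mono) (use k in auto)
    finally have Nk1: "N \<le> 2 * k * (N + 1)" .
    have Nk2: "2 * k \<le> 2 * k * (N + 1)" by simp
    have hY: "h \<le> Y"
    proof -
      have "(2::nat) ^ N \<le> 2 ^ m" unfolding m_def by (rule power_increasing[OF Nk1]) simp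
      then show ?thesis using h(2) unfolding Y_def by linarith
    qed
    have kY: "2 * k \<le> Y"
    proof -
      have "2 * k < 2 ^ (2 * k)" by (rule less_exp)
      also have "\<dots> \<le> (2::nat) ^ m" unfolding m_def by (rule power_increasing[OF Nk2]) simp
      finally show ?thesis by (simp add: Y_def)
    qed
    have h2k: "real h ^ (2 * k) \<le> real Y"
    proof -
      have "h ^ (2 * k) \<le> (2 ^ N) ^ (2 * k)" using h(2) by (intro power_mono) auto
      also have "\<dots> = 2 ^ (N * (2 * k))" by (simp add: power_mult)
      also have "\<dots> \<le> Y" unfolding Y_def m_def by (intro power_increasing) auto
      finally have "real (h ^ (2 * k)) \<le> real Y" by (simp only: of_nat_le_iff)
      then show ?thesis by simp
    qed
    have "\<bar>\<Sum>n<\<Prod>S. (real (window_count S h n) - P * real h) ^ k\<bar>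
      \<le> real (\<Prod>S2) * \<bar>\<Sum>n<\<Prod>S1. binomial_exp p (window_count S1 h n) (\<lambda>x. (real x - p * l) ^ k)\<bar>
        + real (\<Prod>S) * (E * p)"
      unfolding E_def p_def pl[unfolded p_def] S12(1)[symmetric]
    proof (rule large_prime_thinning[OF S12(3,4) pr S12(2) h(1) _ h2k hY kY])
      show "\<forall>p\<in>S2. Y < p" by (simp add: S2_def)
      show "0 \<le> P * real h" "P * real h \<le> real h"
        using d01[of S] h(1) by (auto simp: P_def mult_left_le_one_le)
    qed
    also have "\<dots> \<le> real (\<Prod>S2) * (thinning_const k * (real (\<Prod>S1) * B) * W) + real (\<Prod>S) * (E * W)"
    proof (intro add_mono mult_left_mono)
      show "\<bar>\<Sum>n<\<Prod>S1. binomial_exp p (window_count S1 h n) (\<lambda>x. (real x - p * l) ^ k)\<bar> \<le> thinning_const k * (real (\<Prod>S1) * B) * W"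
        unfolding W_def
      proof (rule thinned_moment_le[OF k(1) p01 h(1) l])
        show "0 \<le> real (\<Prod>S1) * B" by (intro mult_nonneg_nonneg B0 of_nat_0_le_iff)
        fix r assume "r \<le> k"
        then have "\<bar>\<Sum>n<\<Prod>S1. (real (window_count S1 h n) - coprime_density S1 * real h) ^ r\<bar>
          \<le> real (\<Prod>S1) * (C1 * (real N + 1) ^ A1 * real h ^ (r div 2))"
          by (rule small[OF _ S12(3) _ h(2,3)]) (use S in \<open>simp_all add: S1_def Y_def m_def\<close>)
        then show "\<bar>\<Sum>n<\<Prod>S1. (real (window_count S1 h n) - l) ^ r\<bar> \<le> real (\<Prod>S1) * B * real h ^ (r div 2)"
          unfolding l_def P1_def B_def by (simp only: mult.assoc)
      qed
      have "p ^ 1 * real h ^ 0 \<le> W" unfolding W_def by (rule power_mult_le_interpolation) (use p01 h in auto)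
      then show "p \<le> W" by simp
    qed (use E0 in \<open>auto simp del: of_nat_prod\<close>)
    also have "\<dots> = real (\<Prod>S) * ((thinning_const k * B + E) * W)"
    proof -
      have "\<Prod>S = \<Prod>S1 * \<Prod>S2" unfolding S12(1)[symmetric] by (rule prod.union_disjoint) (use S12 in auto)
      then show ?thesis by (simp only: of_nat_mult) (simp only: algebra_simps)
    qed
    also have "\<dots> \<le> real (\<Prod>S) * (C * (real N + 1) ^ A * (P * real h + (P * real h) ^ (k div 2)))"
    proof (rule mult_left_mono)
      \<comment> \<open>Thinning gives a bound in terms of \<open>p\<close>, whereas the claim has
        \<open>P = P1 * p\<close>. The price \<open>1 / P1\<close> is at most \<open>G\<close>, a
        constant times a power of \<open>N + 1\<close>.\<close>
      define G where "G = g * (real N + 1) ^ 8"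
      have N1: "1 \<le> (real N + 1) ^ n" for n by (rule one_le_power) simp
      have G1: "1 \<le> G" unfolding G_def using mult_mono[OF g1 N1[of 8]] g1 by simp
      have m1: "1 \<le> m" using k by (simp add: m_def)
      have "1 / (2 * real m ^ 8) \<le> P1"
        unfolding P1_def by (rule coprime_density_ge[OF m1]) (use S in \<open>auto simp: S1_def Y_def\<close>)
      moreover have "2 * real m ^ 8 = G"
      proof -
        have "real m = (2 * real k) * (real N + 1)" by (simp add: m_def distrib_left)
        then show ?thesis by (simp add: G_def g_def power_mult_distrib)
      qed
      ultimately have "1 \<le> G * P1" using G1 by (simp add: field_simps)
      then have "1 * (p * real h) \<le> (G * P1) * (p * real h)" using p01 by (intro mult_right_mono) auto
      then have ph: "p * real h \<le> G * (P * real h)" by (simp add: P mult_ac)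
      define Z where "Z = P * real h"
      have Z0: "0 \<le> Z" unfolding Z_def using d01[of S] by (simp add: P_def)
      have "W \<le> G * Z + (G * Z) ^ (k div 2)"
        unfolding W_def Z_def using ph p01 by (intro add_mono power_mono) auto
      also have "\<dots> \<le> G ^ (k div 2) * Z + G ^ (k div 2) * Z ^ (k div 2)"
        unfolding power_mult_distrib using G1 Z0 k self_le_power[of G "k div 2"] by (intro add_mono mult_right_mono) auto
      finally have W: "W \<le> G ^ (k div 2) * (Z + Z ^ (k div 2))" by (simp add: distrib_left)
      have "(thinning_const k * B + E) * W \<le> ((thinning_const k * C1 + E) * (real N + 1) ^ A1) * (G ^ (k div 2) * (Z + Z ^ (k div 2)))"
      proof (rule mult_mono[OF _ W])
        have "E * 1 \<le> E * (real N + 1) ^ A1" by (rule mult_left_mono[OF N1 E0])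
        then show "thinning_const k * B + E \<le> (thinning_const k * C1 + E) * (real N + 1) ^ A1"
          by (simp add: B_def distrib_right)
        show "0 \<le> (thinning_const k * C1 + E) * (real N + 1) ^ A1" using thinning_const_nonneg[of k] C1 E0 by simp
        show "0 \<le> W" unfolding W_def using p01 by simp
      qed
      also have "\<dots> = C * (real N + 1) ^ A * (Z + Z ^ (k div 2))"
        unfolding C_def A_def G_def by (simp only: power_mult_distrib power_add power_mult mult_ac)
      finally show "(thinning_const k * B + E) * W \<le> C * (real N + 1) ^ A * (P * real h + (P * real h) ^ (k div 2))"
        unfolding Z_def .
    qed (simp del: of_nat_prod)
    finally show "\<bar>\<Sum>n<\<Prod>S. (real (window_count S h n) - coprime_density S * real h) ^ k\<bar>
      \<le> real (\<Prod>S) * (C * (real N + 1) ^ A * (coprime_density S * real h + (coprime_density S * real h) ^ (k div 2)))"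
      unfolding P_def .
  qed
qed

section \<open>From \<open>q\<close> to the product of its prime divisors\<close>

lemma coprime_prime_factors_iff:
  assumes "0 < q"
  shows "gcd m (int q) = 1 \<longleftrightarrow> (\<forall>p\<in>prime_factors q. \<not> int p dvd m)"
proof
  assume g: "gcd m (int q) = 1"
  show "\<forall>p\<in>prime_factors q. \<not> int p dvd m"
  proof (intro ballI notI)
    fix p assume p: "p \<in> prime_factors q" "int p dvd m"
    then have "p dvd q" "prime p" by (auto simp: in_prime_factors_iff)
    then have "int p dvd gcd m (int q)" using p(2) by simp
    then show False using g \<open>prime p\<close> by simp
  qed
next
  assume a: "\<forall>p\<in>prime_factors q. \<not> int p dvd m"
  show "gcd m (int q) = 1"
  proof (rule ccontr)
    assume "gcd m (int q) \<noteq> 1"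
    then have "nat (gcd m (int q)) \<noteq> 1" by simp
    then obtain p where p: "prime p" "p dvd nat (gcd m (int q))" using prime_factor_nat by blast
    then have d: "int p dvd gcd m (int q)" by (simp add: int_dvd_int_iff[symmetric] del: int_dvd_int_iff)
    then have "int p dvd m" "p dvd q" by (auto simp: int_dvd_int_iff[symmetric] simp del: int_dvd_int_iff)
    then show False using a p(1) assms by (auto simp: in_prime_factors_iff)
  qed
qed

text \<open>Coprimality and the density depend only on the primes dividing \<open>q\<close>, so the
  summand has period \<open>\<Prod>S\<close>, and \<open>q\<close> is a multiple of that
  period.\<close>

lemma M_eq_squarefree:
  assumes q: "0 < q"
  defines "S \<equiv> prime_factors q"
  shows "M k q h * real (\<Prod>S) = real q * (\<Sum>n<\<Prod>S. (real (window_count S h n) - coprime_density S * real h) ^ k)"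
    and "real (totient q) / real q = coprime_density S"
proof -
  have S: "finite S" "\<forall>p\<in>S. prime p" by (auto simp: S_def in_prime_factors_iff)
  show tot: "real (totient q) / real q = coprime_density S"
    unfolding totient_formula2 coprime_density_def S_def using q by simp
  define f where "f = (\<lambda>n. (real (window_count S h n) - coprime_density S * real h) ^ k)"
  have "int (\<Prod>S) dvd int q"
    by (rule prod_primes_dvd[OF S]) (auto simp: S_def in_prime_factors_iff)
  then have "\<Prod>S dvd q" by (simp only: of_nat_dvd_iff)
  then obtain t where t: "q = t * \<Prod>S" by (metis dvd_def mult.commute)
  have per: "f (n + r) = f n" if "\<forall>p\<in>S. p dvd r" for n r
    unfolding f_def window_count_periodic[OF that] ..
  have "M k q h = (\<Sum>n=1..q. f n)"
    unfolding M_def f_def tot card_coprime_window[OF coprime_prime_factors_iff[OF q]] S_def ..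
  also have "\<dots> = (\<Sum>n<q. f n)"
    by (rule sum_period_shift) (use per[of q 0] in \<open>auto simp: S_def in_prime_factors_iff\<close>)
  also have "\<dots> = real t * (\<Sum>n<\<Prod>S. f n)"
    unfolding t by (rule sum_periodic_blocks) (rule per, use dvd_prodI[OF S(1), of _ "\<lambda>x. x"] in simp)
  finally have "M k q h * real (\<Prod>S) = real (t * \<Prod>S) * (\<Sum>n<\<Prod>S. f n)" by simp
  then show "M k q h * real (\<Prod>S) = real q * (\<Sum>n<\<Prod>S. (real (window_count S h n) - coprime_density S * real h) ^ k)"
    unfolding t[symmetric] f_def .
qed

(* The implied constant C and the exponent A may depend on k only.
   max 1 (ln h) is ln h for h >= 3; it only matters at h = 1, where ln h = 0
   (at h = 2 the difference is absorbed by C). *)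
theorem theorem1p1:
  fixes k :: nat
  assumes "odd k" and "k \<ge> 3"
  shows "\<exists>(C::real) (A::nat). \<forall>(q::nat) (h::nat). q \<ge> 1 \<longrightarrow> h \<ge> 1 \<longrightarrow>
    \<bar>M k q h\<bar> \<le> C * (max 1 (ln (real h)) ^ A *
      (real (totient q) / real q * real h
        + (real (totient q) / real q * real h) ^ ((k - 1) div 2)) * real q)"
proof -
  obtain C A where sm: "0 \<le> C \<and> (\<forall>S h N. finite S \<longrightarrow> (\<forall>p\<in>S. prime p) \<longrightarrow> 1 \<le> h \<longrightarrow> h \<le> 2 ^ N \<longrightarrow> 2 ^ N \<le> 2 * h \<longrightarrow>
    \<bar>\<Sum>n<\<Prod>S. (real (window_count S h n) - coprime_density S * real h) ^ k\<bar>
      \<le> real (\<Prod>S) * (C * (real N + 1) ^ A * (coprime_density S * real h + (coprime_density S * real h) ^ (k div 2))))"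
    using squarefree_moment_bound[OF assms] by (elim exE) (rule that)
  note C = conjunct1[OF sm] and bound = conjunct2[OF sm, rule_format]
  show ?thesis
  proof (intro exI[of _ "C * 4 ^ A"] exI[of _ A] allI impI)
    fix q h :: nat assume q: "1 \<le> q" and h: "1 \<le> h"
    define S where "S = prime_factors q"
    define P where "P = coprime_density S"
    define N where "N = floor_log2 h + 1"
    have S: "finite S" "\<forall>p\<in>S. prime p" by (auto simp: S_def in_prime_factors_iff)
    have q0: "0 < q" using q by simp
    note eq = M_eq_squarefree(1)[OF q0, of k h, folded S_def] and tot = M_eq_squarefree(2)[OF q0, folded S_def P_def]
    have r0: "0 < real (\<Prod>S)" using S by (simp add: prod_pos prime_gt_0_nat del: of_nat_prod)
    define V where "V = P * real h + (P * real h) ^ (k div 2)"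
    have P0: "0 \<le> P" unfolding tot[symmetric] by simp
    have V0: "0 \<le> V" using P0 by (simp add: V_def)
    have N: "h \<le> 2 ^ N" "2 ^ N \<le> 2 * h" using floor_log2[OF h] by (simp_all add: N_def)
    \<comment> \<open>As \<open>ln 2\<close> is at least 1/2, \<open>N + 1\<close> is at most
      \<open>2 * ln h + 2\<close>, whence the factor 4.\<close>
    have logN: "real N + 1 \<le> 4 * max 1 (ln (real h))"
    proof -
      have "real (2 ^ floor_log2 h) \<le> real h" using floor_log2[OF h] by (simp only: of_nat_le_iff)
      then have "ln (2 ^ floor_log2 h) \<le> ln (real h)" using h by simp
      then have 1: "real (floor_log2 h) * ln 2 \<le> ln (real h)" by (simp add: ln_realpow)
      have "ln (1 / 2) \<le> 1 / 2 - (1::real)" by (rule ln_le_minus_one) simp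
      then have "1 / 2 \<le> ln (2::real)" by (simp add: ln_div)
      then have "real (floor_log2 h) * (1 / 2) \<le> real (floor_log2 h) * ln 2" by (intro mult_left_mono) auto
      then show ?thesis using 1 by (simp add: N_def)
    qed
    have "\<bar>M k q h\<bar> * real (\<Prod>S) = real q * \<bar>\<Sum>n<\<Prod>S. (real (window_count S h n) - P * real h) ^ k\<bar>"
      using arg_cong[OF eq, of abs] by (simp add: abs_mult P_def del: of_nat_prod)
    also have "\<dots> \<le> real q * (real (\<Prod>S) * (C * (real N + 1) ^ A * V))"
      unfolding P_def V_def using S(2) by (intro mult_left_mono bound S(1) h N) simp_all
    also have "\<dots> = (real q * (C * (real N + 1) ^ A * V)) * real (\<Prod>S)" by (simp only: mult_ac)
    finally have "\<bar>M k q h\<bar> \<le> real q * (C * (real N + 1) ^ A * V)" using r0 by (simp only: mult_le_cancel_right_pos)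
    also have "\<dots> \<le> real q * (C * (4 * max 1 (ln (real h))) ^ A * V)"
      by (intro mult_left_mono mult_right_mono power_mono logN C V0) auto
    also have "\<dots> = C * 4 ^ A * (max 1 (ln (real h)) ^ A * V * real q)" by (simp only: power_mult_distrib mult_ac)
    also have "V = real (totient q) / real q * real h + (real (totient q) / real q * real h) ^ ((k - 1) div 2)"
    proof -
      have "(k - 1) div 2 = k div 2" using assms(1) by (elim oddE) simp
      then show ?thesis unfolding V_def tot by simp
    qed
    finally show "\<bar>M k q h\<bar> \<le> C * 4 ^ A * (max 1 (ln (real h)) ^ A *
      (real (totient q) / real q * real h
        + (real (totient q) / real q * real h) ^ ((k - 1) div 2)) * real q)" .
  qed
qed

end
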